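(* Let $b$ be an extreme point of the closed unit ball of $H^\infty$ which is not an inner function, and let $\varphi\in H^\infty\cap C(\mathbb T)$. Then the operator $T_{\overline{\varphi}}:\mathcal H(b)\to\mathcal H(b)$, $f\mapsto P_+(\overline{\varphi}f)$, is compact if and only if $\varphi=0$.
   Context: $\mathbb D$ is the open unit disc, $\mathbb T=\partial\mathbb D$ with normalized Lebesgue measure $m$, $H^2$ is the Hardy space of $\mathbb D$ (identified via boundary values with a closed subspace of $L^2(\mathbb T)=L^2(\mathbb T,m)$), and $H^\infty$ is the algebra of bounded analytic functions on $\mathbb D$ with the supremum norm. $H^\infty\cap C(\mathbb T)$ denotes the functions in $H^\infty$ whose boundary function is continuous on $\mathbb T$. $P_+:L^2(\mathbb T)\to H^2$ is the orthogonal projection. For $b$ in the closed unit ball of $H^\infty$, the de Branges-Rovnyak space $\mathcal H(b)$ is the Hilbert space of analytic functions on $\mathbb D$ with reproducing kernel $k_\lambda^b(z)=\frac{1-\overline{b(\lambda)}b(z)}{1-\overline{\lambda}z}$, $\lambda,z\in\mathbb D$; it is contractively contained in $H^2$. $b$ is an extreme point of the closed unit ball of $H^\infty$ if and only if $\log(1-|b|)\notin L^1(\mathbb T)$. $b$ is inner if it lies in the closed unit ball of $H^\infty$ and $|b(\zeta)|=1$ for almost every $\zeta\in\mathbb T$. For $\varphi\in H^\infty$, the Toeplitz operator $T_{\overline\varphi}f=P_+(\overline\varphi f)$ on $H^2$ maps $\mathcal H(b)$ into itself and is bounded on $\mathcal H(b)$ with norm at most $\|\varphi\|_\infty$. *)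

theory Defs
  imports "HOL-Complex_Analysis.Complex_Analysis"
begin

section \<open>Functions on the unit disc and the unit circle\<close>

text \<open>Functions on the disc are total functions on the complex plane that vanish outside
  the open disc; in this way equality of functions is equality on the disc.\<close>

abbreviation unit_disc :: "complex set" where
  "unit_disc \<equiv> ball 0 1"

definition analytic_disc :: "(complex \<Rightarrow> complex) set" where
  "analytic_disc = {f. f holomorphic_on unit_disc \<and> (\<forall>z. z \<notin> unit_disc \<longrightarrow> f z = 0)}"

definition circle_measure :: "complex measure" where
  "circle_measure = distr (uniform_measure lborel {0..<2 * pi}) borel cis"

text \<open>Radial boundary values. For functions in the Hardy spaces the limit exists for almost every
  point of the circle; elsewhere the value is an unspecified constant.\<close>

definition boundary_value :: "(complex \<Rightarrow> complex) \<Rightarrow> complex \<Rightarrow> complex" where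
  "boundary_value f \<zeta> = Lim (at_left (1::real)) (\<lambda>r. f (of_real r * \<zeta>))"


section \<open>Bounded analytic functions\<close>

definition Hinf :: "(complex \<Rightarrow> complex) set" where
  "Hinf = {f \<in> analytic_disc. bounded (f ` unit_disc)}"

definition Hinf_norm :: "(complex \<Rightarrow> complex) \<Rightarrow> real" where
  "Hinf_norm f = (SUP z\<in>unit_disc. cmod (f z))"

definition Hinf_unit_ball :: "(complex \<Rightarrow> complex) set" where
  "Hinf_unit_ball = {f \<in> Hinf. Hinf_norm f \<le> 1}"

text \<open>This is \<open>extreme_point_of\<close> spelled out, since the function type is not an instance
  of \<open>real_vector\<close>.\<close>

definition extreme_point_Hinf_unit_ball :: "(complex \<Rightarrow> complex) \<Rightarrow> bool" where
  "extreme_point_Hinf_unit_ball b \<longleftrightarrow>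
     b \<in> Hinf_unit_ball \<and>
     (\<forall>f\<in>Hinf_unit_ball. \<forall>g\<in>Hinf_unit_ball.
        \<not> (f \<noteq> g \<and> (\<exists>t::real. 0 < t \<and> t < 1 \<and>
              b = (\<lambda>z. of_real (1 - t) * f z + of_real t * g z))))"

definition inner_function :: "(complex \<Rightarrow> complex) \<Rightarrow> bool" where
  "inner_function b \<longleftrightarrow>
     b \<in> Hinf_unit_ball \<and> (AE \<zeta> in circle_measure. cmod (boundary_value b \<zeta>) = 1)"

definition Hinf_continuous :: "(complex \<Rightarrow> complex) set" where
  "Hinf_continuous =
     {f \<in> Hinf. \<exists>g. continuous_on (sphere 0 1) g \<and>
                    (AE \<zeta> in circle_measure. boundary_value f \<zeta> = g \<zeta>)}"


section \<open>The Hardy space, the orthogonal projection onto it, and Toeplitz operators\<close>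

definition hardy_space :: "(complex \<Rightarrow> complex) set" where
  "hardy_space = {f \<in> analytic_disc.
     bdd_above ((\<lambda>r::real. \<integral>\<zeta>. (cmod (f (of_real r * \<zeta>)))\<^sup>2 \<partial>circle_measure) ` {0..<1})}"

text \<open>The projection of a square-integrable \<open>g\<close> is returned as an analytic function on the disc,
  the one whose boundary function differs from \<open>g\<close> by something orthogonal to the
  boundary functions of the Hardy space. For \<open>g\<close> not square-integrable the value is irrelevant.\<close>

definition hardy_projection :: "(complex \<Rightarrow> complex) \<Rightarrow> complex \<Rightarrow> complex" where
  "hardy_projection g =
     (THE f. f \<in> hardy_space \<and>
        (\<forall>h\<in>hardy_space.
           (\<integral>\<zeta>. (g \<zeta> - boundary_value f \<zeta>) * cnj (boundary_value h \<zeta>) \<partial>circle_measure) = 0))"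

definition toeplitz_cnj :: "(complex \<Rightarrow> complex) \<Rightarrow> (complex \<Rightarrow> complex) \<Rightarrow> complex \<Rightarrow> complex" where
  "toeplitz_cnj \<phi> f = hardy_projection (\<lambda>\<zeta>. cnj (boundary_value \<phi> \<zeta>) * boundary_value f \<zeta>)"


section \<open>Hilbert spaces of functions and compact operators\<close>

text \<open>The inner product is linear in the first argument, and only its values on \<open>H\<close> matter.\<close>

locale function_inner_space =
  fixes H :: "('a \<Rightarrow> complex) set"
    and ip :: "('a \<Rightarrow> complex) \<Rightarrow> ('a \<Rightarrow> complex) \<Rightarrow> complex"
  assumes zero_mem: "(\<lambda>_. 0) \<in> H"
    and add_mem: "\<And>f g. f \<in> H \<Longrightarrow> g \<in> H \<Longrightarrow> (\<lambda>z. f z + g z) \<in> H"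
    and scale_mem: "\<And>c f. f \<in> H \<Longrightarrow> (\<lambda>z. c * f z) \<in> H"
    and ip_add: "\<And>f g h. f \<in> H \<Longrightarrow> g \<in> H \<Longrightarrow> h \<in> H \<Longrightarrow> ip (\<lambda>z. f z + g z) h = ip f h + ip g h"
    and ip_scale: "\<And>c f h. f \<in> H \<Longrightarrow> h \<in> H \<Longrightarrow> ip (\<lambda>z. c * f z) h = c * ip f h"
    and ip_cnj: "\<And>f g. f \<in> H \<Longrightarrow> g \<in> H \<Longrightarrow> ip g f = cnj (ip f g)"
    and ip_pos: "\<And>f. f \<in> H \<Longrightarrow> f \<noteq> (\<lambda>_. 0) \<Longrightarrow> 0 < Re (ip f f)"
begin

definition ip_norm :: "('a \<Rightarrow> complex) \<Rightarrow> real" where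
  "ip_norm f = sqrt (Re (ip f f))"

text \<open>The guard is needed because \<open>Metric_space\<close> requires non-negativity and symmetry
  on the whole type.\<close>

definition ip_dist :: "('a \<Rightarrow> complex) \<Rightarrow> ('a \<Rightarrow> complex) \<Rightarrow> real" where
  "ip_dist f g = (if f \<in> H \<and> g \<in> H then ip_norm (\<lambda>z. f z - g z) else 0)"

lemma diff_mem: "f \<in> H \<Longrightarrow> g \<in> H \<Longrightarrow> (\<lambda>z. f z - g z) \<in> H"
  using add_mem[of f "\<lambda>z. (-1) * g z"] scale_mem[of g "-1"] by simp

lemma ip_zero_left: "h \<in> H \<Longrightarrow> ip (\<lambda>_. 0) h = 0"
  using ip_scale[of "\<lambda>_. 0" h 0] zero_mem by simp

lemma ip_self_nonneg: "f \<in> H \<Longrightarrow> 0 \<le> Re (ip f f)"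
  by (cases "f = (\<lambda>_. 0)") (auto simp: ip_zero_left zero_mem intro: less_imp_le[OF ip_pos])

lemma ip_self_add_scale:
  assumes "f \<in> H" "g \<in> H"
  shows "Re (ip (\<lambda>z. f z + c * g z) (\<lambda>z. f z + c * g z)) =
           Re (ip f f) + 2 * Re (c * ip g f) + (cmod c)\<^sup>2 * Re (ip g g)"
proof -
  let ?s = "\<lambda>z. f z + c * g z"
  have cg: "(\<lambda>z. c * g z) \<in> H" and s: "?s \<in> H"
    using assms add_mem scale_mem by blast+
  have left: "ip ?s h = ip f h + c * ip g h" if "h \<in> H" for h
    using that assms cg by (simp add: ip_add ip_scale)
  have right: "ip h ?s = ip h f + cnj c * ip h g" if "h \<in> H" for h
    using ip_cnj[OF s that] ip_cnj[OF assms(1) that] ip_cnj[OF assms(2) that] left[OF that]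
    by simp
  have "ip ?s ?s = ip f f + (cnj c * ip f g + c * ip g f) + c * cnj c * ip g g"
    using left[OF s] right[OF assms(1)] right[OF assms(2)] by (simp add: algebra_simps)
  moreover have "Re (cnj c * ip f g) = Re (c * ip g f)"
    using ip_cnj[OF assms(2,1)] by (simp add: algebra_simps)
  moreover have "c * cnj c = of_real ((cmod c)\<^sup>2)"
    by (simp only: complex_norm_square)
  ultimately show ?thesis
    by (simp only: plus_complex.sel Re_complex_of_real times_complex.sel Im_complex_of_real) simp
qed

lemma cauchy_schwarz:
  assumes "f \<in> H" "g \<in> H"
  shows "cmod (ip g f) \<le> ip_norm f * ip_norm g"
proof (cases "g = (\<lambda>_. 0)")
  case True
  then show ?thesis
    using assms by (simp add: ip_zero_left ip_norm_def)
next
  case False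
  define G where "G = Re (ip g g)"
  have G: "0 < G"
    using False assms ip_pos G_def by blast
  define c where "c = - cnj (ip g f) / of_real G"
  have "0 \<le> Re (ip (\<lambda>z. f z + c * g z) (\<lambda>z. f z + c * g z))"
    using assms add_mem scale_mem ip_self_nonneg by blast
  also have "\<dots> = Re (ip f f) + 2 * Re (c * ip g f) + (cmod c)\<^sup>2 * G"
    using ip_self_add_scale[OF assms] G_def by simp
  also have "c * ip g f = of_real (- (cmod (ip g f))\<^sup>2 / G)"
    using complex_norm_square[of "ip g f"] by (simp add: c_def mult.commute)
  also have "(cmod c)\<^sup>2 * G = (cmod (ip g f))\<^sup>2 / G"
    using G by (simp add: c_def norm_divide power_divide power2_eq_square)
  finally have "(cmod (ip g f))\<^sup>2 / G \<le> Re (ip f f)"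
    by simp
  then have "(cmod (ip g f))\<^sup>2 \<le> Re (ip f f) * G"
    using G by (simp add: field_simps)
  then have "sqrt ((cmod (ip g f))\<^sup>2) \<le> sqrt (Re (ip f f) * G)"
    by (rule real_sqrt_le_mono)
  then show ?thesis
    by (simp add: ip_norm_def G_def real_sqrt_mult)
qed

lemma ip_norm_triangle:
  assumes "f \<in> H" "g \<in> H"
  shows "ip_norm (\<lambda>z. f z + g z) \<le> ip_norm f + ip_norm g"
proof (rule power2_le_imp_le)
  have sq: "(ip_norm h)\<^sup>2 = Re (ip h h)" if "h \<in> H" for h
    using ip_self_nonneg[OF that] by (simp add: ip_norm_def)
  have "Re (ip g f) \<le> ip_norm f * ip_norm g"
    using cauchy_schwarz[OF assms] complex_Re_le_cmod order_trans by blast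
  then show "(ip_norm (\<lambda>z. f z + g z))\<^sup>2 \<le> (ip_norm f + ip_norm g)\<^sup>2"
    using ip_self_add_scale[OF assms, of 1] sq assms add_mem
    by (simp add: power2_sum)
  show "0 \<le> ip_norm f + ip_norm g"
    using assms ip_self_nonneg by (simp add: ip_norm_def)
qed

lemma metric_space_ip_dist: "Metric_space H ip_dist"
proof
  fix f g h
  show "0 \<le> ip_dist f g"
    by (simp add: ip_dist_def ip_norm_def ip_self_nonneg diff_mem)
  have "ip_norm (\<lambda>z. f z - g z) = ip_norm (\<lambda>z. g z - f z)" if "f \<in> H" "g \<in> H"
    using ip_self_add_scale[OF zero_mem diff_mem[OF that], of "-1"] diff_mem[OF that]
      ip_cnj[OF diff_mem[OF that] zero_mem] ip_zero_left zero_mem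
    by (simp add: ip_norm_def)
  then show "ip_dist f g = ip_dist g f"
    by (simp add: ip_dist_def)
  show "ip_dist f g = 0 \<longleftrightarrow> f = g" if "f \<in> H" "g \<in> H"
  proof (cases "f = g")
    case True
    then show ?thesis
      using that by (simp add: ip_dist_def ip_norm_def ip_zero_left zero_mem)
  next
    case False
    then have "(\<lambda>z. f z - g z) \<noteq> (\<lambda>_. 0)"
      by (auto simp: fun_eq_iff)
    then show ?thesis
      using ip_pos[OF diff_mem[OF that]] False that by (simp add: ip_dist_def ip_norm_def)
  qed
  show "ip_dist f h \<le> ip_dist f g + ip_dist g h" if "f \<in> H" "g \<in> H" "h \<in> H"
    using ip_norm_triangle[OF diff_mem diff_mem, of f g g h] that by (simp add: ip_dist_def)
qed

sublocale Metric_space H ip_dist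
  by (rule metric_space_ip_dist)

definition linear_operator :: "(('a \<Rightarrow> complex) \<Rightarrow> ('a \<Rightarrow> complex)) \<Rightarrow> bool" where
  "linear_operator T \<longleftrightarrow>
     T ` H \<subseteq> H \<and>
     (\<forall>f\<in>H. \<forall>g\<in>H. T (\<lambda>z. f z + g z) = (\<lambda>z. T f z + T g z)) \<and>
     (\<forall>c. \<forall>f\<in>H. T (\<lambda>z. c * f z) = (\<lambda>z. c * T f z))"

definition compact_operator :: "(('a \<Rightarrow> complex) \<Rightarrow> ('a \<Rightarrow> complex)) \<Rightarrow> bool" where
  "compact_operator T \<longleftrightarrow>
     linear_operator T \<and>
     compactin mtopology (mtopology closure_of (T ` {f \<in> H. ip_norm f \<le> 1}))"

end

locale reproducing_kernel_hilbert_space = function_inner_space H ip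
  for H :: "('a \<Rightarrow> complex) set" and ip +
  fixes X :: "'a set" and K :: "'a \<Rightarrow> 'a \<Rightarrow> complex"
  assumes complete: "mcomplete"
    and kernel_mem: "\<And>w. w \<in> X \<Longrightarrow> K w \<in> H"
    and reproducing: "\<And>f w. f \<in> H \<Longrightarrow> w \<in> X \<Longrightarrow> f w = ip f (K w)"


section \<open>de Branges-Rovnyak spaces\<close>

definition dBR_kernel :: "(complex \<Rightarrow> complex) \<Rightarrow> complex \<Rightarrow> complex \<Rightarrow> complex" where
  "dBR_kernel b w z =
     (if z \<in> unit_disc then (1 - cnj (b w) * b z) / (1 - cnj w * z) else 0)"

text \<open>The pair \<open>(H, ip)\<close> is the space \<open>H(b)\<close> together with its inner product. A Hilbert
  space of functions on the disc is determined by its reproducing kernel, so for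
  each \<open>b\<close> in the unit ball there is exactly one such \<open>H\<close>, and \<open>ip\<close> is unique on it.\<close>

definition de_Branges_Rovnyak_space ::
  "(complex \<Rightarrow> complex) \<Rightarrow> (complex \<Rightarrow> complex) set \<Rightarrow>
   ((complex \<Rightarrow> complex) \<Rightarrow> (complex \<Rightarrow> complex) \<Rightarrow> complex) \<Rightarrow> bool" where
  "de_Branges_Rovnyak_space b H ip \<longleftrightarrow>
     H \<subseteq> analytic_disc \<and> reproducing_kernel_hilbert_space H ip unit_disc (dBR_kernel b)"

end

theory Submission
  imports Defs
begin

text \<open>
  The substantial direction tests a compact operator \<open>T\<close>, the Toeplitz operator with symbol the
  conjugate of \<open>\<phi>\<close>, on the normalised reproducing kernels of \<open>H(b)\<close>. Let \<open>k\<^sub>w\<close>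
  be the kernel at \<open>w\<close>, let \<open>g\<close> be the continuous boundary function of \<open>\<phi>\<close>, and let \<open>P\<^sub>w\<close> be the
  Poisson kernel. Writing the projection as a Cauchy integral shows that
  \<open>(1 - |w|\<^sup>2) (T k\<^sub>w)(w)\<close> is the integral of \<open>cnj g (1 - cnj (b w) b) P\<^sub>w\<close>, while the same integral with 1 in place
  of \<open>g\<close> is \<open>1 - |b w|\<^sup>2\<close>, that is, \<open>1 - |w|\<^sup>2\<close> times the squared norm of \<open>k\<^sub>w\<close>. Let \<open>w\<close> move
  radially to a point \<open>p\<close> at which \<open>b\<close> has a radial limit of modulus less than one. The Poisson kernel
  concentrates at \<open>p\<close>, so the quadratic form of \<open>T\<close> at the normalised kernels tends to the conjugate of
  \<open>g p\<close> (\<open>toeplitz_kernel_quotient_limit\<close>). On the other hand the norms of the kernels grow like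
  \<open>(1 - |w|)\<close> to the power \<open>-1/2\<close>, whereas every function of the Hardy space grows
  more slowly than that (\<open>hardy_growth\<close>). The normalised kernels therefore become orthogonal to
  every function \<open>T k\<^sub>v\<close>, and compactness forces the quadratic form to tend to zero
  (\<open>compact_operator_orthogonal_limit\<close>). So \<open>g\<close> vanishes almost everywhere on the set where the boundary values
  of \<open>b\<close> have modulus less than one. As \<open>b\<close> is not inner this set has positive measure, and an
  analytic function with this property is zero (\<open>hardy_boundary_uniqueness\<close>).

  The argument rests on three classical facts about the Hardy space. Fatou's theorem
  (\<open>fatou_radial_limit\<close>) is proved by integrating a square-summable power series once: the integral is
  continuous up to the circle, differentiable along the circle almost everywhere by Lebesgue's
  theorem, and a Poisson-type estimate converts its tangential derivative into the radial limit of
  the series. The projection is the Cauchy integral (\<open>hardy_projection_eq_cauchy_transform\<close>), which also settles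
  the converse direction: the operator with symbol zero maps everything to zero. Boundary
  uniqueness is Jensen's inequality, obtained by comparing the function with outer functions
  (\<open>outer_function_estimate\<close>).
\<close>

section \<open>Integration over the unit circle\<close>

lemma circle_measure_density:
  "circle_measure = distr (density lborel (\<lambda>t. ennreal (indicator {0..<2 * pi} t / (2 * pi)))) borel cis"
proof -
  have "uniform_measure lborel {0..<2 * pi} = density lborel (\<lambda>t. ennreal (indicator {0..<2 * pi} t / (2 * pi)))"
    unfolding uniform_measure_def
    by (intro arg_cong[where f="density lborel"] ext)
       (auto simp: indicator_def divide_ennreal simp flip: ennreal_1)
  then show ?thesis by (simp add: circle_measure_def)
qed

lemma sets_circle_measure [simp, measurable_cong]: "sets circle_measure = sets borel"
  by (simp add: circle_measure_def)

lemma space_circle_measure [simp]: "space circle_measure = UNIV"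
  by (simp add: circle_measure_def)

lemma borel_measurable_cis [measurable]: "cis \<in> borel_measurable borel"
  by (intro borel_measurable_continuous_onI continuous_intros)

lemma finite_measure_circle: "finite_measure circle_measure"
  and emeasure_circle_UNIV: "emeasure circle_measure UNIV = 1"
proof -
  have "emeasure circle_measure UNIV = emeasure lborel {0..<2*pi} / emeasure lborel {0..<2*pi}"
    unfolding circle_measure_def
    by (subst emeasure_distr) (auto simp: emeasure_uniform_measure)
  also have "\<dots> = 1"
    by (simp add: divide_ennreal)
  finally show *: "emeasure circle_measure UNIV = 1" .
  show "finite_measure circle_measure"
    by (rule finite_measureI) (simp add: *)
qed

interpretation circle: finite_measure circle_measure
  by (rule finite_measure_circle)

abbreviation circle_integral :: "(complex \<Rightarrow> 'a::{banach, second_countable_topology}) \<Rightarrow> 'a"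
    (binder "\<ointegral>" 10)
  where "circle_integral h \<equiv> integral\<^sup>L circle_measure h"

abbreviation radial_limit :: "(complex \<Rightarrow> complex) \<Rightarrow> complex \<Rightarrow> complex \<Rightarrow> bool" where
  "radial_limit f x L \<equiv> ((\<lambda>r. f (of_real r * x)) \<longlongrightarrow> L) (at_left 1)"

lemma measure_circle_UNIV [simp]: "measure circle_measure UNIV = 1"
  by (simp add: measure_def emeasure_circle_UNIV)

lemma integrable_circle_iff:
  fixes h :: "complex \<Rightarrow> 'a::{banach, second_countable_topology}"
  assumes [measurable]: "h \<in> borel_measurable borel"
  shows "integrable circle_measure h \<longleftrightarrow> set_integrable lborel {0..<2 * pi} (\<lambda>t. h (cis t))"
proof -
  have "integrable circle_measure h \<longleftrightarrow>
     integrable lborel (\<lambda>t. (indicator {0..<2 * pi} t / (2 * pi)) *\<^sub>R h (cis t))"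
    unfolding circle_measure_density
    by (subst integrable_distr_eq) (simp_all add: integrable_density)
  also have "\<dots> \<longleftrightarrow> integrable lborel (\<lambda>t. (1 / (2 * pi)) *\<^sub>R (indicator {0..<2 * pi} t *\<^sub>R h (cis t)))"
    by (intro Bochner_Integration.integrable_cong) auto
  also have "\<dots> \<longleftrightarrow> integrable lborel (\<lambda>t. indicator {0..<2 * pi} t *\<^sub>R h (cis t))"
  proof
    assume "integrable lborel (\<lambda>t. (1 / (2 * pi)) *\<^sub>R (indicator {0..<2 * pi} t *\<^sub>R h (cis t)))"
    from integrable_scaleR_right[OF this, of "2 * pi"]
    show "integrable lborel (\<lambda>t. indicator {0..<2 * pi} t *\<^sub>R h (cis t))" by simp
  qed (rule integrable_scaleR_right)
  finally show ?thesis
    by (simp only: set_integrable_def)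
qed

lemma integral_circle_eq:
  fixes h :: "complex \<Rightarrow> 'a::{banach, second_countable_topology}"
  assumes [measurable]: "h \<in> borel_measurable borel"
  shows "(\<ointegral>x. h x) = (1 / (2 * pi)) *\<^sub>R (LINT t:{0..<2 * pi}|lborel. h (cis t))"
proof -
  have "(\<ointegral>x. h x) =
     (\<integral>t. (indicator {0..<2 * pi} t / (2 * pi)) *\<^sub>R h (cis t) \<partial>lborel)"
    unfolding circle_measure_density
    by (subst integral_distr) (simp_all add: integral_density)
  also have "\<dots> = (\<integral>t. (1 / (2 * pi)) *\<^sub>R (indicator {0..<2 * pi} t *\<^sub>R h (cis t)) \<partial>lborel)"
    by (intro Bochner_Integration.integral_cong) auto
  also have "\<dots> = (1 / (2 * pi)) *\<^sub>R (\<integral>t. indicator {0..<2 * pi} t *\<^sub>R h (cis t) \<partial>lborel)"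
    by (rule integral_scaleR_right)
  finally show ?thesis by (simp add: set_lebesgue_integral_def)
qed

lemma AE_circle_on: "AE x in circle_measure. cmod x = 1"
  unfolding circle_measure_def
  by (subst AE_distr_iff) auto

text \<open>The converse transfer along \<open>cis\<close> is immediate from the definition; this direction needs that
  \<open>cis\<close> maps a Borel null set of angles into a Borel null set.\<close>
lemma AE_circleI:
  assumes "AE t in lborel. 0 < t \<and> t < 2 * pi \<longrightarrow> P (cis t)"
  shows "AE x in circle_measure. P x"
proof -
  have "AE t in lborel. t \<noteq> 0 \<and> (0 < t \<and> t < 2 * pi \<longrightarrow> P (cis t))"
    using assms AE_lborel_singleton[of 0] by eventually_elim auto
  then obtain N where N: "N \<in> null_sets lborel" "{t. \<not> (t \<noteq> 0 \<and> (0 < t \<and> t < 2 * pi \<longrightarrow> P (cis t)))} \<subseteq> N"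
    by (auto simp: eventually_ae_filter)
  then have [measurable]: "N \<in> sets borel" by auto
  \<comment> \<open>An explicit Borel measurable inverse of \<open>cis\<close> on \<open>[0, 2 * pi)\<close>. The truncation makes the arccosine
    continuous on the whole line.\<close>
  define A0 where "A0 = (\<lambda>x. arccos (max (-1) (min 1 (Re x))))"
  have [measurable]: "A0 \<in> borel_measurable borel"
    unfolding A0_def by (intro borel_measurable_continuous_onI continuous_intros) auto
  define A where "A = (\<lambda>x. if 0 \<le> Im x then A0 x else 2 * pi - A0 x)"
  have [measurable]: "A \<in> borel_measurable borel" unfolding A_def by measurable
  have A: "A (cis t) = t" if "0 \<le> t" "t < 2 * pi" for t
  proof (cases "t \<le> pi")
    case True
    then show ?thesis using that by (simp add: A_def A0_def sin_ge_zero arccos_cos)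
  next
    case False
    then have "sin t < 0" using that sin_lt_zero by auto
    moreover have "arccos (cos t) = 2 * pi - t"
      using arccos_cos[of "2 * pi - t"] that False by (simp add: cos_diff)
    ultimately show ?thesis by (simp add: A_def A0_def)
  qed
  have "AE t in uniform_measure lborel {0..<2 * pi}. A (cis t) \<notin> N"
  proof (rule AE_uniform_measureI)
    show "{0..<2 * pi} \<in> sets lborel" by simp
    show "AE t in lborel. t \<in> {0..<2 * pi} \<longrightarrow> A (cis t) \<notin> N"
      using AE_not_in[OF N(1)] by eventually_elim (use A in auto)
  qed
  then have "AE x in circle_measure. A x \<notin> N"
    unfolding circle_measure_def by (subst AE_distr_iff) auto
  then show ?thesis
    using AE_circle_on
  proof eventually_elim
    case (elim x)
    then have "x \<noteq> 0" by auto
    have z: "x = cis (Arg2pi x)" 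
      using Arg2pi_eq[of x] elim by (simp add: cis_conv_exp)
    have "A x = Arg2pi x" 
      using A[of "Arg2pi x"] Arg2pi[of x] z by metis
    then have "Arg2pi x \<notin> N" using elim by simp
    then have "P (cis (Arg2pi x))"
      using subsetD[OF N(2), of "Arg2pi x"] Arg2pi_ge_0[of x] Arg2pi_lt_2pi[of x]
      by (metis (mono_tags, lifting) mem_Collect_eq order_le_less)
    then show "P x" using z by metis
  qed
qed

lemma integrable_circle_bounded:
  fixes h :: "complex \<Rightarrow> 'a::{banach, second_countable_topology}"
  assumes "h \<in> borel_measurable borel" "AE x in circle_measure. norm (h x) \<le> B"
  shows "integrable circle_measure h"
  using assms by (intro circle.integrable_const_bound) auto

lemma integrable_circle_continuous:
  fixes h :: "complex \<Rightarrow> 'a::{banach, second_countable_topology}"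
  assumes "h \<in> borel_measurable borel" "continuous_on (sphere 0 1) h"
  shows "integrable circle_measure h"
proof -
  have "bounded (h ` sphere 0 1)"
    by (intro compact_imp_bounded compact_continuous_image assms) auto
  then obtain B where B: "\<forall>x\<in>h ` sphere 0 1. norm x \<le> B" unfolding bounded_iff by blast
  show ?thesis
    by (rule integrable_circle_bounded[OF assms(1), of B])
       (use AE_circle_on in eventually_elim, use B in auto)
qed

lemma bounded_on_circle:
  fixes u :: "complex \<Rightarrow> 'a::real_normed_vector"
  assumes "continuous_on (sphere 0 1) u"
  obtains M where "0 < M" "\<And>x. cmod x = 1 \<Longrightarrow> norm (u x) \<le> M"
proof -
  have "bounded (u ` sphere 0 1)"
    by (intro compact_imp_bounded compact_continuous_image assms) auto
  then obtain M where "M > 0" "\<forall>x\<in>u ` sphere 0 1. norm x \<le> M" unfolding bounded_pos by blast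
  then show ?thesis by (intro that[of M]) auto
qed

lemma filterlim_at_left_1: "filterlim (\<lambda>n. 1 - 1 / (real n + 2)) (at_left 1) sequentially"
proof (rule tendsto_imp_filterlim_at_left)
  have "(\<lambda>n. 1 - inverse (real (Suc (Suc n)))) \<longlonglongrightarrow> 1 - 0"
    by (rule tendsto_diff[OF tendsto_const LIMSEQ_Suc[OF LIMSEQ_inverse_real_of_nat]])
  then show "(\<lambda>n. 1 - 1 / (real n + 2)) \<longlonglongrightarrow> 1" by (simp add: inverse_eq_divide add.commute)
qed simp

lemma integral_circle_mono_on:
  fixes f h :: "complex \<Rightarrow> real"
  assumes "integrable circle_measure f" "integrable circle_measure h"
    "\<And>x. cmod x = 1 \<Longrightarrow> f x \<le> h x"
  shows "(\<ointegral>x. f x) \<le> (\<ointegral>x. h x)"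
  by (rule integral_mono_AE[OF assms(1,2)]) (use AE_circle_on in eventually_elim, auto intro: assms(3))

lemma integral_circle_contour:
  fixes h :: "complex \<Rightarrow> complex"
  assumes m: "h \<in> borel_measurable borel" and c: "continuous_on (sphere 0 1) h"
    and I: "(h has_contour_integral I) (circlepath 0 1)"
  shows "(\<ointegral>x. h x * x) = I / (2 * of_real pi * \<i>)"
proof -
  have "((\<lambda>t. h (cis t) * \<i> * cis t) has_integral I) {0..2*pi}"
    using I by (simp add: circlepath_def has_contour_integral_part_circlepath_iff)
  then have "((\<lambda>t. - \<i> * (h (cis t) * \<i> * cis t)) has_integral - \<i> * I) {0..2*pi}"
    by (rule has_integral_mult_right)
  then have 1: "((\<lambda>t. h (cis t) * cis t) has_integral - \<i> * I) {0..2*pi}"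
    by (simp add: mult_ac)
  have "integrable circle_measure (\<lambda>x. h x * x)"
    by (intro integrable_circle_continuous continuous_intros c borel_measurable_times m) simp
  then have "set_integrable lborel {0..<2*pi} (\<lambda>t. h (cis t) * cis t)"
    using integrable_circle_iff[of "\<lambda>x. h x * x"] m by simp
  then have "integral {0..<2*pi} (\<lambda>t. h (cis t) * cis t) = (LINT t:{0..<2 * pi}|lborel. h (cis t) * cis t)"
    by (rule set_borel_integral_eq_integral(2)[symmetric])
  moreover have "integral {0..<2*pi} (\<lambda>t. h (cis t) * cis t) = integral {0..2*pi} (\<lambda>t. h (cis t) * cis t)"
    by (rule integral_spike_set) (rule negligible_subset[of "{2*pi}"], auto)+
  ultimately have "(LINT t:{0..<2 * pi}|lborel. h (cis t) * cis t) = - \<i> * I"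
    using integral_unique[OF 1] by simp
  then have "(\<ointegral>x. h x * x) = (1 / (2 * pi)) *\<^sub>R (- \<i> * I)"
    using integral_circle_eq[of "\<lambda>x. h x * x"] m by simp
  then show ?thesis by (simp add: scaleR_conv_of_real field_simps)
qed

section \<open>Mean values and the Poisson kernel\<close>

lemma integral_circle_mean_value:
  assumes m: "u \<in> borel_measurable borel" and c: "continuous_on (cball 0 1) u"
    and h: "u holomorphic_on ball 0 1"
  shows "(\<ointegral>x. u x) = u 0"
proof -
  have "((\<lambda>x. u x / (x - 0)) has_contour_integral (2 * of_real pi * \<i> * u 0)) (circlepath 0 1)"
    by (rule Cauchy_integral_circlepath) (use c h in auto)
  then have "(\<ointegral>x. (u x / x) * x) = (2 * of_real pi * \<i> * u 0) / (2 * of_real pi * \<i>)"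
    by (intro integral_circle_contour) (use m c in \<open>auto intro!: continuous_intros intro: continuous_on_subset\<close>)
  moreover have "(\<ointegral>x. (u x / x) * x) = (\<ointegral>x. u x)"
  proof (rule integral_cong_AE)
    show "AE x in circle_measure. u x / x * x = u x"
      using AE_circle_on by eventually_elim auto
  qed (use m in measurable)
  ultimately show ?thesis by simp
qed

lemma one_minus_disc_circle_ne_0:
  fixes z x :: complex
  assumes "cmod z < 1" "cmod x \<le> 1"
  shows "1 - z * x \<noteq> 0"
proof
  assume "1 - z * x = 0"
  then have "cmod z * cmod x = 1" by (metis eq_iff_diff_eq_0 norm_mult norm_one)
  moreover have "cmod z * cmod x \<le> cmod z * 1" by (rule mult_left_mono) (use assms in auto)
  ultimately show False using assms by simp
qed

definition poisson :: "complex \<Rightarrow> complex \<Rightarrow> real" where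
  "poisson z x = (1 - (cmod z)\<^sup>2) / (cmod (1 - cnj z * x))\<^sup>2"

lemma borel_measurable_poisson [measurable]: "poisson z \<in> borel_measurable borel"
  unfolding poisson_def by measurable

lemma poisson_nonneg: "cmod z < 1 \<Longrightarrow> 0 \<le> poisson z x"
  by (simp add: poisson_def abs_square_le_1)

lemma continuous_poisson: "cmod z < 1 \<Longrightarrow> continuous_on (sphere 0 1) (poisson z)"
  unfolding poisson_def
  by (intro continuous_intros) (use one_minus_disc_circle_ne_0[of "cnj z"] in auto)

lemma integrable_poisson: "cmod z < 1 \<Longrightarrow> integrable circle_measure (poisson z)"
  by (intro integrable_circle_continuous continuous_poisson) auto

lemma poisson_eq_Re:
  assumes "cmod z < 1" "cmod x = 1"
  shows "poisson z x = Re (2 / (1 - cnj z * x) - 1)"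
proof -
  define w where "w = cnj z * x"
  have nw: "cmod w = cmod z" using assms by (simp add: w_def norm_mult)
  have "1 - w \<noteq> 0" using one_minus_disc_circle_ne_0[of "cnj z" x] assms by (simp add: w_def)
  then have "2 / (1 - w) - 1 = (1 + w) / (1 - w)"
    by (simp add: field_simps)
  also have "\<dots> = (1 + w) * cnj (1 - w) / ((1 - w) * cnj (1 - w))"
    using \<open>1 - w \<noteq> 0\<close> by (metis complex_cnj_zero_iff mult_divide_mult_cancel_right)
  also have "\<dots> = (1 + w) * cnj (1 - w) / of_real ((cmod (1 - w))\<^sup>2)"
    by (simp only: complex_norm_square)
  also have "Re \<dots> = Re ((1 + w) * cnj (1 - w)) / (cmod (1 - w))\<^sup>2"
    by (simp only: Re_divide_of_real)
  also have "Re ((1 + w) * cnj (1 - w)) = 1 - (cmod w)\<^sup>2"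
    by (simp only: cmod_power2) (simp add: algebra_simps power2_eq_square)
  finally show ?thesis using nw by (simp add: poisson_def w_def)
qed

lemma integral_poisson:
  assumes "cmod z < 1"
  shows "(\<ointegral>x. poisson z x) = 1"
proof -
  let ?u = "\<lambda>x. 2 / (1 - cnj z * x) - 1"
  have ne: "1 - cnj z * x \<noteq> 0" if "cmod x \<le> 1" for x
    using one_minus_disc_circle_ne_0[of "cnj z" x] that assms by simp
  have c: "continuous_on (cball 0 1) ?u"
    by (intro continuous_intros) (use ne in auto)
  have h: "?u holomorphic_on ball 0 1"
    by (intro holomorphic_intros) (use ne in auto)
  have i: "integrable circle_measure ?u"
    by (rule integrable_circle_continuous) (auto intro: continuous_on_subset[OF c])
  have "(\<ointegral>x. poisson z x) = (\<ointegral>x. Re (?u x))"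
    by (rule integral_cong_AE)
       (use AE_circle_on poisson_eq_Re[OF assms] in \<open>auto elim!: eventually_mono\<close>)
  also have "\<dots> = Re (\<ointegral>x. ?u x)"
    by (rule integral_Re[OF i])
  also have "(\<ointegral>x. ?u x) = ?u 0"
    by (rule integral_circle_mean_value[OF _ c h]) measurable
  finally show ?thesis by simp
qed

text \<open>For \<open>z = r p\<close> on the radius of \<open>p\<close>, the modulus of \<open>1 - cnj z * x\<close> is the distance from \<open>x\<close> to \<open>z\<close>,
  and \<open>z\<close> is no farther from \<open>p\<close> than from any other point of the circle. So the denominators of the
  radial kernels control the distance to the boundary point \<open>p\<close>.\<close>
lemma dist_circle_radius:
  assumes "cmod x = 1" "cmod p = 1" "0 \<le> r" "r < 1"
  shows "cmod (x - p) \<le> 2 * cmod (1 - cnj (of_real r * p) * x)"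
proof -
  have e: "cmod (1 - cnj (of_real r * p) * x) = cmod (x - of_real r * p)"
  proof -
    have "p * cnj p = 1" using assms(2) complex_norm_square[of p] by simp
    then have "p * (1 - cnj (of_real r * p) * x) = p - of_real r * x"
      by (simp add: algebra_simps)
    then have "cmod (1 - cnj (of_real r * p) * x) = cmod (p - of_real r * x)"
      using assms(2) by (metis mult_1 norm_mult)
    also have "(cmod (p - of_real r * x))\<^sup>2 = (cmod (x - of_real r * p))\<^sup>2"
    proof -
      have 1: "(Re x)\<^sup>2 + (Im x)\<^sup>2 = 1" "(Re p)\<^sup>2 + (Im p)\<^sup>2 = 1"
        using assms(1,2) by (metis cmod_power2 one_power2)+
      have "(cmod (p - of_real r * x))\<^sup>2 - (cmod (x - of_real r * p))\<^sup>2
        = (((Re p)\<^sup>2 + (Im p)\<^sup>2) - ((Re x)\<^sup>2 + (Im x)\<^sup>2)) * (1 - r\<^sup>2)"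
        by (simp only: cmod_power2) (simp add: power2_eq_square algebra_simps)
      also have "\<dots> = 0" using 1 by simp
      finally show ?thesis by simp
    qed
    then have "cmod (p - of_real r * x) = cmod (x - of_real r * p)" by simp
    finally show ?thesis .
  qed
  have "cmod (of_real r * p - p) = 1 - r"
  proof -
    have "of_real r * p - p = of_real (r - 1) * p" by (simp add: algebra_simps)
    then show ?thesis using assms by (simp add: norm_mult del: of_real_diff)
  qed
  moreover have "1 - r \<le> cmod (x - of_real r * p)"
    using norm_triangle_ineq2[of x "of_real r * p"] assms by (simp add: norm_mult)
  moreover have "cmod (x - p) \<le> cmod (x - of_real r * p) + cmod (of_real r * p - p)"
    using norm_triangle_ineq[of "x - of_real r * p" "of_real r * p - p"] by simp
  ultimately show ?thesis using e by simp
qed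

lemma poisson_far:
  assumes "cmod x = 1" "cmod p = 1" "0 \<le> r" "r < 1" "0 < d" "d \<le> cmod (x - p)"
  shows "poisson (of_real r * p) x \<le> (1 - r\<^sup>2) * (4 / d\<^sup>2)"
proof -
  have "d / 2 \<le> cmod (1 - cnj (of_real r * p) * x)"
    using dist_circle_radius[OF assms(1-4)] assms by simp
  then have "(d / 2)\<^sup>2 \<le> (cmod (1 - cnj (of_real r * p) * x))\<^sup>2"
    using assms by (intro power_mono) auto
  moreover have "0 \<le> 1 - r\<^sup>2" using assms by (simp add: abs_square_le_1)
  moreover have "(cmod (of_real r * p))\<^sup>2 = r\<^sup>2" using assms by (simp add: norm_mult)
  ultimately have "poisson (of_real r * p) x \<le> (1 - r\<^sup>2) / (d/2)\<^sup>2"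
    unfolding poisson_def using assms by (simp only:) (intro divide_left_mono mult_pos_pos, auto)
  then show ?thesis by (simp add: power_divide)
qed

text \<open>The Poisson kernels of the points of a radius have total mass one and tend to zero uniformly away
  from the end of the radius; near that end the integrand is small by continuity.\<close>
lemma tendsto_integral_poisson_0:
  fixes h :: "complex \<Rightarrow> real"
  assumes m [measurable]: "h \<in> borel_measurable borel" and c: "continuous_on (sphere 0 1) h"
    and z0: "cmod p = 1" and h0: "h p = 0" and nn: "\<And>x. 0 \<le> h x"
  shows "((\<lambda>r. \<ointegral>x. h x * poisson (of_real r * p) x) \<longlongrightarrow> 0) (at_left 1)"
proof (rule tendstoI)
  fix e :: real assume e: "0 < e"
  obtain B where "B > 0" "\<And>x. cmod x = 1 \<Longrightarrow> norm (h x) \<le> B" using bounded_on_circle[OF c] by blast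
  then have B: "\<And>x. cmod x = 1 \<Longrightarrow> h x \<le> B" "B > 0" by (auto simp: abs_le_iff)
  obtain d where d: "d > 0" "\<And>x. cmod x = 1 \<Longrightarrow> cmod (x - p) < d \<Longrightarrow> h x < e / 2"
    using c z0 h0 e nn unfolding continuous_on_iff 
    by (metis dist_norm half_gt_zero mem_sphere_0 abs_of_nonneg diff_zero real_norm_def)
  have "((\<lambda>r. B * ((1 - r\<^sup>2) * (4 / d\<^sup>2))) \<longlongrightarrow> B * ((1 - 1\<^sup>2) * (4 / d\<^sup>2))) (at_left (1::real))"
    by (intro tendsto_intros)
  then have "\<forall>\<^sub>F r in at_left 1. B * ((1 - r\<^sup>2) * (4 / d\<^sup>2)) < e / 2"
    using e by (auto dest!: order_tendstoD(2)[where a = "e/2"])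
  moreover have "\<forall>\<^sub>F r in at_left 1. (0::real) < r \<and> r < 1"
    using eventually_at_left_real[of 0 1] by (auto elim: eventually_mono)
  ultimately show "\<forall>\<^sub>F r in at_left 1. dist (\<ointegral>x. h x * poisson (of_real r * p) x) 0 < e"
  proof eventually_elim
    case (elim r)
    define z where "z = of_real r * p"
    have z: "cmod z < 1" using elim z0 by (simp add: z_def norm_mult)
    have [measurable]: "poisson z \<in> borel_measurable borel" by (rule borel_measurable_poisson)
    have i1: "integrable circle_measure (\<lambda>x. h x * poisson z x)"
      by (rule integrable_circle_continuous) (use c continuous_poisson[OF z] in \<open>auto intro: continuous_on_mult\<close>)
    have i2: "integrable circle_measure (\<lambda>x. (e / 2) * poisson z x + B * ((1 - r\<^sup>2) * (4 / d\<^sup>2)))"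
      using integrable_poisson[OF z] by auto
    have "(\<ointegral>x. h x * poisson z x)
       \<le> (\<ointegral>x. (e / 2) * poisson z x + B * ((1 - r\<^sup>2) * (4 / d\<^sup>2)))"
    proof (rule integral_circle_mono_on[OF i1 i2])
      fix x :: complex assume x: "cmod x = 1"
      have r2: "0 \<le> (1 - r\<^sup>2) * (4 / d\<^sup>2)" using elim by (simp add: abs_square_le_1)
      show "h x * poisson z x \<le> (e / 2) * poisson z x + B * ((1 - r\<^sup>2) * (4 / d\<^sup>2))"
      proof (cases "cmod (x - p) < d")
        case True
        then have "h x * poisson z x \<le> (e / 2) * poisson z x"
          using d(2)[OF x] poisson_nonneg[OF z, of x] by (intro mult_right_mono) auto
        then show ?thesis using r2 B(2) mult_nonneg_nonneg[of B "(1 - r\<^sup>2) * (4 / d\<^sup>2)"] by linarith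
      next
        case False
        have "h x * poisson z x \<le> B * ((1 - r\<^sup>2) * (4 / d\<^sup>2))"
          unfolding z_def using poisson_far[OF x z0 _ _ d(1)] elim False B(1)[OF x] B(2) poisson_nonneg[OF z] z_def
          by (intro mult_mono) auto
        moreover have "0 \<le> (e / 2) * poisson z x" using e poisson_nonneg[OF z] by simp
        ultimately show ?thesis by linarith
      qed
    qed
    also have "\<dots> = e / 2 + B * ((1 - r\<^sup>2) * (4 / d\<^sup>2))"
      using integrable_poisson[OF z] integral_poisson[OF z] by (subst Bochner_Integration.integral_add) auto
    also have "\<dots> < e" using elim(1) by linarith
    finally have "(\<ointegral>x. h x * poisson z x) < e" .
    moreover have "0 \<le> (\<ointegral>x. h x * poisson z x)"
      using nn poisson_nonneg[OF z] by (intro integral_nonneg_AE) auto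
    ultimately show ?case by (simp add: z_def)
  qed
qed

section \<open>Square-integrable functions on the circle\<close>

lemma borel_measurable_cnj [measurable]: "cnj \<in> borel_measurable borel"
  by (intro borel_measurable_continuous_onI continuous_intros)

definition L2 :: "(complex \<Rightarrow> complex) \<Rightarrow> bool" where
  "L2 u \<longleftrightarrow>
     u \<in> borel_measurable borel \<and> integrable circle_measure (\<lambda>x. (cmod (u x))\<^sup>2)"

lemma L2_measurable [measurable_dest]: "L2 u \<Longrightarrow> u \<in> borel_measurable borel"
  by (simp add: L2_def)

lemma L2_norm_sq_integrable: "L2 u \<Longrightarrow> integrable circle_measure (\<lambda>x. (cmod (u x))\<^sup>2)"
  by (simp add: L2_def)

lemma L2_bounded:
  assumes "u \<in> borel_measurable borel" "AE x in circle_measure. cmod (u x) \<le> B"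
  shows "L2 u"
  unfolding L2_def
proof
  show "integrable circle_measure (\<lambda>x. (cmod (u x))\<^sup>2)"
  proof (rule integrable_circle_bounded)
    show "AE x in circle_measure. norm ((cmod (u x))\<^sup>2) \<le> B\<^sup>2"
      using assms(2) by eventually_elim (auto intro: power_mono)
  qed (use assms(1) in measurable)
qed (fact assms)

lemma L2_continuous:
  assumes "u \<in> borel_measurable borel" "continuous_on (sphere 0 1) u"
  shows "L2 u"
  unfolding L2_def
  by (intro conjI assms integrable_circle_continuous continuous_intros) (use assms(1) in measurable)

lemma integrable_circle_mult:
  assumes "L2 u" "L2 v"
  shows "integrable circle_measure (\<lambda>x. u x * v x)"
proof (rule Bochner_Integration.integrable_bound)
  show "integrable circle_measure (\<lambda>x. (cmod (u x))\<^sup>2 + (cmod (v x))\<^sup>2)"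
    using assms by (auto simp: L2_def)
  show "(\<lambda>x. u x * v x) \<in> borel_measurable circle_measure"
    using assms by measurable
  have "cmod (u x) * cmod (v x) \<le> (cmod (u x))\<^sup>2 + (cmod (v x))\<^sup>2" for x
    using sum_squares_bound[of "cmod (u x)" "cmod (v x)"]
      mult_nonneg_nonneg[of "cmod (u x)" "cmod (v x)"] norm_ge_zero[of "u x"] norm_ge_zero[of "v x"]
    by linarith
  then show "AE x in circle_measure. norm (u x * v x) \<le> norm ((cmod (u x))\<^sup>2 + (cmod (v x))\<^sup>2)"
    by (simp add: norm_mult)
qed

lemma L2_1 [simp]: "L2 (\<lambda>_. c)"
  by (rule L2_bounded[of _ "cmod c"]) auto

lemma L2_imp_integrable:
  "L2 u \<Longrightarrow> integrable circle_measure u"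
  using integrable_circle_mult[of u "\<lambda>_. 1"] by simp

lemma L2_cnj: "L2 u \<Longrightarrow> L2 (\<lambda>x. cnj (u x))"
  unfolding L2_def by (auto intro: measurable_compose[of u _ _ cnj])

lemma L2_diff:
  assumes "L2 u" "L2 v"
  shows "L2 (\<lambda>x. u x - v x)"
  unfolding L2_def
proof
  show m: "(\<lambda>x. u x - v x) \<in> borel_measurable borel" using assms by measurable
  show "integrable circle_measure (\<lambda>x. (cmod (u x - v x))\<^sup>2)"
  proof (rule Bochner_Integration.integrable_bound)
    show "integrable circle_measure (\<lambda>x. 2 * (cmod (u x))\<^sup>2 + 2 * (cmod (v x))\<^sup>2)"
      using assms by (auto simp: L2_def)
    have "(cmod (u x - v x))\<^sup>2 \<le> 2 * (cmod (u x))\<^sup>2 + 2 * (cmod (v x))\<^sup>2" for x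
    proof -
      have "(cmod (u x - v x))\<^sup>2 \<le> (cmod (u x) + cmod (v x))\<^sup>2"
        by (intro power_mono norm_triangle_ineq4) auto
      then show ?thesis
        using sum_squares_bound[of "cmod (u x)" "cmod (v x)"] by (simp add: power2_sum)
    qed
    then show "AE x in circle_measure. norm ((cmod (u x - v x))\<^sup>2) \<le> norm (2 * (cmod (u x))\<^sup>2 + 2 * (cmod (v x))\<^sup>2)"
      by simp
  qed (use m in measurable)
qed

lemma L2_mult_bounded:
  assumes "L2 u" "v \<in> borel_measurable borel" "AE x in circle_measure. cmod (v x) \<le> B"
  shows "L2 (\<lambda>x. v x * u x)"
  unfolding L2_def
proof
  show m: "(\<lambda>x. v x * u x) \<in> borel_measurable borel" using assms by measurable
  show "integrable circle_measure (\<lambda>x. (cmod (v x * u x))\<^sup>2)"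
  proof (rule Bochner_Integration.integrable_bound)
    show "integrable circle_measure (\<lambda>x. B\<^sup>2 * (cmod (u x))\<^sup>2)"
      using assms by (auto simp: L2_def)
    show "AE x in circle_measure. norm ((cmod (v x * u x))\<^sup>2) \<le> norm (B\<^sup>2 * (cmod (u x))\<^sup>2)"
      using assms(3) by eventually_elim (auto simp: norm_mult power_mult_distrib intro!: mult_right_mono power_mono)
  qed (use m in measurable)
qed

text \<open>In place of the Cauchy-Schwarz inequality, \<open>2 s t \<le> s\<^sup>2 / d + d t\<^sup>2\<close> is integrated, with a fixed \<open>d\<close>
  so small that the contribution of \<open>v\<close> is below the required accuracy.\<close>
lemma tendsto_integral_mult_L2:
  assumes u: "\<And>k. L2 (u k)" and l: "L2 l" and v: "L2 v"
    and lim: "((\<lambda>k. \<ointegral>x. (cmod (u k x - l x))\<^sup>2) \<longlongrightarrow> 0) F"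
  shows "((\<lambda>k. \<ointegral>x. u k x * v x) \<longlongrightarrow> (\<ointegral>x. l x * v x)) F"
proof (rule tendstoI)
  fix e :: real assume e: "0 < e"
  define V where "V = (\<ointegral>x. (cmod (v x))\<^sup>2)"
  have V: "0 \<le> V" unfolding V_def by (intro integral_nonneg_AE) auto
  define d where "d = e / (V + 1)"
  have d: "0 < d" using V e by (simp add: d_def)
  have "d * e > 0" using d e by simp
  from order_tendstoD(2)[OF lim this]
  show "\<forall>\<^sub>F k in F. dist (\<ointegral>x. u k x * v x) (\<ointegral>x. l x * v x) < e"
  proof eventually_elim
    case (elim k)
    have ul: "L2 (\<lambda>x. u k x - l x)" by (rule L2_diff[OF u l])
    have "(\<ointegral>x. u k x * v x) - (\<ointegral>x. l x * v x) = (\<ointegral>x. (u k x - l x) * v x)"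
      using integrable_circle_mult[OF u v] integrable_circle_mult[OF l v]
      by (simp add: left_diff_distrib)
    also have "cmod \<dots> \<le> (\<ointegral>x. cmod ((u k x - l x) * v x))"
      by (rule integral_norm_bound)
    also have "\<dots> \<le> (\<ointegral>x. 1 / (2 * d) * (cmod (u k x - l x))\<^sup>2 + d / 2 * (cmod (v x))\<^sup>2)"
    proof (rule integral_mono)
      show "integrable circle_measure (\<lambda>x. cmod ((u k x - l x) * v x))"
        by (intro integrable_norm integrable_circle_mult ul v)
      show "integrable circle_measure (\<lambda>x. 1 / (2 * d) * (cmod (u k x - l x))\<^sup>2 + d / 2 * (cmod (v x))\<^sup>2)"
        using L2_norm_sq_integrable[OF ul] L2_norm_sq_integrable[OF v] by auto
      show "cmod ((u k x - l x) * v x) \<le> 1 / (2 * d) * (cmod (u k x - l x))\<^sup>2 + d / 2 * (cmod (v x))\<^sup>2" for x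
      proof -
        have "0 \<le> (cmod (u k x - l x) - d * cmod (v x))\<^sup>2" by simp
        then have "2 * d * (cmod (u k x - l x) * cmod (v x)) \<le> (cmod (u k x - l x))\<^sup>2 + d\<^sup>2 * (cmod (v x))\<^sup>2"
          by (simp add: power2_diff power_mult_distrib algebra_simps)
        then have "cmod (u k x - l x) * cmod (v x) \<le> ((cmod (u k x - l x))\<^sup>2 + d\<^sup>2 * (cmod (v x))\<^sup>2) / (2 * d)"
          using d by (simp add: pos_le_divide_eq mult_ac)
        also have "\<dots> = 1 / (2 * d) * (cmod (u k x - l x))\<^sup>2 + d / 2 * (cmod (v x))\<^sup>2"
          using d by (simp add: add_divide_distrib power2_eq_square)
        finally show ?thesis by (simp only: norm_mult)
      qed
    qed
    also have "\<dots> = 1 / (2 * d) * (\<ointegral>x. (cmod (u k x - l x))\<^sup>2) + d / 2 * V"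
      using L2_norm_sq_integrable[OF ul] L2_norm_sq_integrable[OF v]
      by (subst Bochner_Integration.integral_add) (auto simp: V_def)
    also have "\<dots> < e"
    proof -
      have "1 / (2 * d) * (\<ointegral>x. (cmod (u k x - l x))\<^sup>2) < e / 2"
        using elim d by (simp add: field_simps)
      moreover have "d * V \<le> e" using V e by (simp add: d_def field_simps)
      ultimately show ?thesis by simp
    qed
    finally show ?case by (simp add: dist_norm)
  qed
qed

lemma integral_circle_monomials:
  "(\<ointegral>x. x ^ n * cnj (x ^ m)) = (if n = m then 1 else 0)"
proof -
  have *: "(\<ointegral>x. x ^ n * cnj (x ^ m)) = (if n = m then 1 else 0)" if "m \<le> n" for n m
  proof -
    have "(\<ointegral>x. x ^ n * cnj (x ^ m)) = (\<ointegral>x. x ^ (n - m))"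
    proof (rule integral_cong_AE)
      show "AE x in circle_measure. x ^ n * cnj (x ^ m) = x ^ (n - m)"
        using AE_circle_on
      proof eventually_elim
        case (elim x)
        then have "x * cnj x = 1" using complex_norm_square[of x] by simp
        moreover have "x ^ n = x ^ (n - m) * x ^ m" using that by (simp flip: power_add)
        ultimately show ?case by (simp add: mult.assoc flip: power_mult_distrib)
      qed
    qed (measurable; intro borel_measurable_continuous_onI continuous_intros)+
    also have "\<dots> = 0 ^ (n - m)"
      by (rule integral_circle_mean_value) (auto intro!: continuous_intros holomorphic_intros)
    finally show ?thesis using that by auto
  qed
  show ?thesis
  proof (cases "m \<le> n")
    case False
    have "(\<ointegral>x. x ^ n * cnj (x ^ m)) = cnj (\<ointegral>x. x ^ m * cnj (x ^ n))"
    proof -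
      have "cnj (\<ointegral>x. x ^ m * cnj (x ^ n)) = (\<ointegral>x. cnj (x ^ m * cnj (x ^ n)))"
        by (rule Bochner_Integration.integral_cnj[symmetric])
      then show ?thesis by (simp add: mult.commute)
    qed
    then show ?thesis using *[of n m] False by simp
  qed (rule *)
qed

lemma L2_poly: "L2 (\<lambda>x. \<Sum>n\<in>A. c n * x ^ n)"
  by (intro L2_continuous continuous_intros borel_measurable_continuous_onI)

lemma L2_power: "L2 (\<lambda>x. x ^ n)"
  by (intro L2_continuous continuous_intros borel_measurable_continuous_onI)

lemma integral_circle_poly_coeff:
  assumes "finite A"
  shows "(\<ointegral>x. (\<Sum>n\<in>A. c n * x ^ n) * cnj (x ^ m)) = (if m \<in> A then c m else 0)"
proof -
  have "(\<ointegral>x. (\<Sum>n\<in>A. c n * x ^ n) * cnj (x ^ m)) =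
        (\<ointegral>x. (\<Sum>n\<in>A. c n * (x ^ n * cnj (x ^ m))))"
    by (simp add: sum_distrib_right mult.assoc)
  also have "\<dots> = (\<Sum>n\<in>A. c n * (\<ointegral>x. x ^ n * cnj (x ^ m)))"
    by (subst Bochner_Integration.integral_sum)
       (auto intro!: integrable_mult_right integrable_circle_mult L2_cnj[OF L2_power, simplified] L2_power)
  also have "\<dots> = (\<Sum>n\<in>A. if m = n then c n else 0)"
    by (intro sum.cong refl) (auto simp only: integral_circle_monomials mult_1_right mult_zero_right split: if_split)
  finally show ?thesis using assms by simp
qed

lemma parseval_poly:
  assumes "finite A"
  shows "(\<ointegral>x. (cmod (\<Sum>n\<in>A. c n * x ^ n))\<^sup>2) = (\<Sum>n\<in>A. (cmod (c n))\<^sup>2)"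
proof -
  have "complex_of_real (\<ointegral>x. (cmod (\<Sum>n\<in>A. c n * x ^ n))\<^sup>2)
      = (\<ointegral>x. (\<Sum>m\<in>A. cnj (c m) * ((\<Sum>n\<in>A. c n * x ^ n) * cnj (x ^ m))))"
    by (subst integral_complex_of_real[symmetric])
       (simp only: complex_norm_square cnj_sum complex_cnj_mult sum_distrib_left mult_ac)
  also have "\<dots> = (\<Sum>m\<in>A. cnj (c m) * (\<ointegral>x. (\<Sum>n\<in>A. c n * x ^ n) * cnj (x ^ m)))"
    by (subst Bochner_Integration.integral_sum)
       (auto intro!: integrable_mult_right integrable_circle_mult L2_cnj[OF L2_power, simplified] L2_poly)
  also have "\<dots> = (\<Sum>m\<in>A. cnj (c m) * c m)"
    by (intro sum.cong refl) (simp only: integral_circle_poly_coeff[OF assms] if_True)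
  also have "\<dots> = complex_of_real (\<Sum>n\<in>A. (cmod (c n))\<^sup>2)"
    by (simp only: of_real_sum complex_norm_square mult.commute)
  finally show ?thesis by (simp only: of_real_eq_iff)
qed

section \<open>Square-summable coefficients and boundary functions\<close>

text \<open>Completeness of \<open>L\<^sup>2\<close> for the case at hand: along partial sums whose squared tails decrease like a geometric sequence,
  consecutive differences are summable in \<open>L\<^sup>1\<close>, so these partial sums converge almost everywhere, and
  Fatou's lemma transfers the tail estimates to the limit.\<close>
lemma riesz_fischer:
  fixes c :: "nat \<Rightarrow> complex"
  assumes c: "summable (\<lambda>n. (cmod (c n))\<^sup>2)"
  obtains g where "L2 g"
    "\<And>N. (\<ointegral>x. (cmod (g x - (\<Sum>n<N. c n * x ^ n)))\<^sup>2) \<le> (\<Sum>n. (cmod (c (n + N)))\<^sup>2)"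
proof -
  define s where "s = (\<lambda>N x. \<Sum>n<N. c n * x ^ n)"
  define \<tau> where "\<tau> = (\<lambda>N. \<Sum>n. (cmod (c (n + N)))\<^sup>2)"
  have s_sq: "L2 (s N)" for N
    unfolding s_def by (rule L2_poly)
  then have s_meas [measurable]: "s N \<in> borel_measurable borel" for N
    by (rule L2_measurable)
  have \<tau>0: "\<tau> \<longlonglongrightarrow> 0"
    unfolding \<tau>_def using suminf_exist_split2[OF c] by simp
  have \<tau>_nonneg: "0 \<le> \<tau> N" for N
    unfolding \<tau>_def by (intro suminf_nonneg) (use c in \<open>auto simp: summable_iff_shift[of "\<lambda>n. (cmod (c n))\<^sup>2"]\<close>)
  have diff: "(\<ointegral>x. (cmod (s M x - s N x))\<^sup>2) \<le> \<tau> N" if "N \<le> M" for M N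
  proof -
    have "s M x - s N x = (\<Sum>n\<in>{N..<M}. c n * x ^ n)" for x
      unfolding s_def using that by (simp add: lessThan_atLeast0 sum_diff_nat_ivl)
    then have "(\<ointegral>x. (cmod (s M x - s N x))\<^sup>2) = (\<Sum>n\<in>{N..<M}. (cmod (c n))\<^sup>2)"
      by (simp only:) (rule parseval_poly, simp)
    also have "\<dots> = (\<Sum>n<M - N. (cmod (c (n + N)))\<^sup>2)"
      using that by (intro sum.reindex_bij_witness[of _ "\<lambda>n. n + N" "\<lambda>n. n - N"]) auto
    also have "\<dots> \<le> \<tau> N"
      unfolding \<tau>_def by (intro sum_le_suminf) (use c in \<open>auto simp: summable_iff_shift[of "\<lambda>n. (cmod (c n))\<^sup>2"]\<close>)
    finally show ?thesis .
  qed
  have "\<exists>N. \<forall>n\<ge>N. \<tau> n \<le> (1/4) ^ k" for k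
    using order_tendstoD(2)[OF \<tau>0, of "(1/4) ^ k"] by (auto simp: eventually_sequentially intro: less_imp_le)
  then obtain N0 where N0: "\<And>k n. N0 k \<le> n \<Longrightarrow> \<tau> n \<le> (1/4) ^ k" by metis
  \<comment> \<open>Summing the thresholds makes the indices monotone; the summand \<open>k\<close> makes them unbounded.\<close>
  define N where "N = (\<lambda>k. k + (\<Sum>j\<le>k. N0 j))"
  have N_mono: "N k \<le> N (Suc k)" for k by (simp add: N_def)
  have N_ge: "k \<le> N k" for k by (simp add: N_def)
  have \<tau>N: "\<tau> (N k) \<le> (1/4) ^ k" for k
    by (rule N0) (auto simp: N_def intro: trans_le_add2 member_le_sum)
  define D where "D = (\<lambda>k x. s (N (Suc k)) x - s (N k) x)"
  have D_sq: "L2 (D k)" for k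
    unfolding D_def by (intro L2_diff s_sq)
  have D_meas [measurable]: "D k \<in> borel_measurable borel" for k
    by (rule L2_measurable[OF D_sq])
  have D_int: "(\<ointegral>x. cmod (D k x)) \<le> (1/2) ^ k" for k
  proof -
    have "(\<ointegral>x. cmod (D k x)) \<le> (\<ointegral>x. (1/2) * (1/2) ^ k + (1/2) * 2 ^ k * (cmod (D k x))\<^sup>2)"
    proof (rule integral_mono)
      show "integrable circle_measure (\<lambda>x. cmod (D k x))"
        by (intro integrable_norm L2_imp_integrable D_sq)
      show "integrable circle_measure (\<lambda>x. (1/2) * (1/2) ^ k + (1/2) * 2 ^ k * (cmod (D k x))\<^sup>2)"
        using L2_norm_sq_integrable[OF D_sq] by auto
      \<comment> \<open>The weights \<open>2 ^ k\<close> balance the bound \<open>(1/4) ^ k\<close> for the squares.\<close>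
      show "cmod (D k x) \<le> (1/2) * (1/2) ^ k + (1/2) * 2 ^ k * (cmod (D k x))\<^sup>2" for x
      proof -
        have "0 \<le> (1 - 2 ^ k * cmod (D k x))\<^sup>2" by simp
        then have "2 * 2 ^ k * cmod (D k x) \<le> 1 + 2 ^ k * 2 ^ k * (cmod (D k x))\<^sup>2"
          by (simp add: power2_diff power_mult_distrib power2_eq_square algebra_simps)
        then show ?thesis by (simp add: power_divide field_simps)
      qed
    qed
    also have "\<dots> = (1/2) * (1/2) ^ k + (1/2) * 2 ^ k * (\<ointegral>x. (cmod (D k x))\<^sup>2)"
      using L2_norm_sq_integrable[OF D_sq] by (subst Bochner_Integration.integral_add) auto
    also have "(\<ointegral>x. (cmod (D k x))\<^sup>2) \<le> (1/4) ^ k"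
      using diff[OF N_mono] \<tau>N[of k] unfolding D_def by (rule order_trans)
    also have "(1/2) * (1/2) ^ k + (1/2) * 2 ^ k * (1/4) ^ k = ((1/2) ^ k :: real)"
      by (simp flip: power_mult_distrib)
    finally show ?thesis by simp
  qed
  have "(\<integral>\<^sup>+x. (\<Sum>k. ennreal (cmod (D k x))) \<partial>circle_measure) = (\<Sum>k. \<integral>\<^sup>+x. ennreal (cmod (D k x)) \<partial>circle_measure)"
    by (intro nn_integral_suminf) measurable
  also have "\<dots> \<le> (\<Sum>k. ennreal ((1/2) ^ k))"
  proof (intro suminf_le summableI)
    fix k
    have "(\<integral>\<^sup>+x. ennreal (cmod (D k x)) \<partial>circle_measure) = ennreal (\<ointegral>x. cmod (D k x))"
      by (intro nn_integral_eq_integral integrable_norm L2_imp_integrable D_sq) auto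
    then show "(\<integral>\<^sup>+x. ennreal (cmod (D k x)) \<partial>circle_measure) \<le> ennreal ((1/2) ^ k)"
      using D_int by (simp add: ennreal_leI)
  qed
  also have "\<dots> = ennreal (\<Sum>k. (1/2) ^ k)"
    by (intro suminf_ennreal2 summable_geometric) auto
  finally have "(\<integral>\<^sup>+x. (\<Sum>k. ennreal (cmod (D k x))) \<partial>circle_measure) \<noteq> \<infinity>"
    by (auto simp: top_unique)
  then have "AE x in circle_measure. (\<Sum>k. ennreal (cmod (D k x))) \<noteq> \<infinity>"
    by (intro nn_integral_PInf_AE) auto
  then have AE_conv: "AE x in circle_measure. convergent (\<lambda>k. s (N k) x)"
  proof eventually_elim
    case (elim x)
    then have "summable (\<lambda>k. cmod (D k x))"
      by (intro summable_suminf_not_top) auto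
    then have "summable (\<lambda>k. D k x)" by (rule summable_norm_cancel)
    then have "convergent (\<lambda>k. \<Sum>j<k. D j x)" by (simp add: summable_iff_convergent)
    moreover have "(\<Sum>j<k. D j x) = s (N k) x - s (N 0) x" for k
      unfolding D_def by (rule sum_lessThan_telescope)
    ultimately have "convergent (\<lambda>k. s (N k) x - s (N 0) x)" by simp
    then have "convergent (\<lambda>k. (s (N k) x - s (N 0) x) + s (N 0) x)" by (intro convergent_add convergent_const)
    then show ?case by simp
  qed
  define g where "g = (\<lambda>x. lim (\<lambda>k. s (N k) x))"
  have g_meas [measurable]: "g \<in> borel_measurable borel"
    unfolding g_def by measurable
  have AE_lim: "AE x in circle_measure. (\<lambda>k. s (N k) x) \<longlonglongrightarrow> g x"
    using AE_conv by eventually_elim (simp add: g_def convergent_LIMSEQ_iff)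
  have fatou: "(\<integral>\<^sup>+x. ennreal ((cmod (g x - s M x))\<^sup>2) \<partial>circle_measure) \<le> ennreal (\<tau> M)" for M
  proof -
    have "(\<integral>\<^sup>+x. ennreal ((cmod (g x - s M x))\<^sup>2) \<partial>circle_measure)
        = (\<integral>\<^sup>+x. liminf (\<lambda>k. ennreal ((cmod (s (N k) x - s M x))\<^sup>2)) \<partial>circle_measure)"
    proof (rule nn_integral_cong_AE)
      show "AE x in circle_measure. ennreal ((cmod (g x - s M x))\<^sup>2) = liminf (\<lambda>k. ennreal ((cmod (s (N k) x - s M x))\<^sup>2))"
        using AE_lim
      proof eventually_elim
        case (elim x)
        then have "(\<lambda>k. ennreal ((cmod (s (N k) x - s M x))\<^sup>2)) \<longlonglongrightarrow> ennreal ((cmod (g x - s M x))\<^sup>2)"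
          by (intro tendsto_intros)
        then show ?case by (intro lim_imp_Liminf[symmetric]) auto
      qed
    qed
    also have "\<dots> \<le> liminf (\<lambda>k. \<integral>\<^sup>+x. ennreal ((cmod (s (N k) x - s M x))\<^sup>2) \<partial>circle_measure)"
      by (rule nn_integral_liminf) measurable
    also have "\<dots> \<le> liminf (\<lambda>k. ennreal (\<tau> M))"
    proof (rule Liminf_mono)
      show "\<forall>\<^sub>F k in sequentially. (\<integral>\<^sup>+x. ennreal ((cmod (s (N k) x - s M x))\<^sup>2) \<partial>circle_measure) \<le> ennreal (\<tau> M)"
        using eventually_ge_at_top[of M]
      proof eventually_elim
        case (elim k)
        have "(\<integral>\<^sup>+x. ennreal ((cmod (s (N k) x - s M x))\<^sup>2) \<partial>circle_measure) = ennreal (\<ointegral>x. (cmod (s (N k) x - s M x))\<^sup>2)"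
          by (intro nn_integral_eq_integral L2_norm_sq_integrable L2_diff s_sq) auto
        also have "\<dots> \<le> ennreal (\<tau> M)"
          using diff[of M "N k"] N_ge[of k] elim by (intro ennreal_leI) auto
        finally show ?case .
      qed
    qed
    also have "\<dots> = ennreal (\<tau> M)" by (simp add: Liminf_const)
    finally show ?thesis .
  qed
  have gs_int: "integrable circle_measure (\<lambda>x. (cmod (g x - s M x))\<^sup>2)" for M
    using fatou[of M] by (intro integrableI_bounded) (auto simp: le_less_trans ennreal_less_top)
  show ?thesis
  proof (rule that)
    show "L2 g"
      using gs_int[of 0] by (simp add: L2_def s_def)
    show "(\<ointegral>x. (cmod (g x - (\<Sum>n<M. c n * x ^ n)))\<^sup>2) \<le> (\<Sum>n. (cmod (c (n + M)))\<^sup>2)" for M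
    proof -
      have "ennreal (\<ointegral>x. (cmod (g x - s M x))\<^sup>2) = (\<integral>\<^sup>+x. ennreal ((cmod (g x - s M x))\<^sup>2) \<partial>circle_measure)"
        by (rule nn_integral_eq_integral[symmetric, OF gs_int]) auto
      then have "ennreal (\<ointegral>x. (cmod (g x - s M x))\<^sup>2) \<le> ennreal (\<tau> M)"
        using fatou[of M] by simp
      then show ?thesis
        using \<tau>_nonneg[of M] by (simp add: s_def \<tau>_def)
    qed
  qed
qed

section \<open>Derivatives at boundary points\<close>

text \<open>Subtracting the affine part, \<open>F\<close> may be replaced by \<open>G\<close> with \<open>G x = o(x - p)\<close> on the circle. Cauchy's
  formula for the derivative of \<open>G\<close> has a kernel of size \<open>1 / D\<^sup>2\<close>, \<open>D\<close> being the distance from \<open>x\<close> to \<open>z\<close>;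
  against \<open>G\<close> this would leave a logarithmically divergent integral. The kernel may be changed by
  functions whose integral against \<open>G\<close> vanishes. Subtracting the corresponding
  kernel of the reflected point \<open>1 / cnj z\<close> brings it down to \<open>2 (1 - r\<^sup>2) / D\<^sup>3\<close>, and its product with
  \<open>G\<close> is then a small multiple of the Poisson kernel.\<close>
lemma radial_limit_of_derivative:
  assumes m: "F \<in> borel_measurable borel" and c: "continuous_on (cball 0 1) F"
    and h: "F holomorphic_on ball 0 1" and z0: "cmod p = 1"
    and A: "\<And>e. 0 < e \<Longrightarrow> \<exists>d>0. \<forall>x. cmod x = 1 \<longrightarrow> cmod (x - p) < d \<longrightarrow>
               cmod (F x - F p - A * (x - p)) \<le> e * cmod (x - p)"
  shows "((\<lambda>r. deriv F (of_real r * p)) \<longlongrightarrow> A) (at_left 1)"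
proof (rule tendstoI)
  fix e :: real assume e: "0 < e"
  define G where "G = (\<lambda>x. F x - F p - A * (x - p))"
  have G_m [measurable]: "G \<in> borel_measurable borel" unfolding G_def using m by measurable
  have G_c: "continuous_on (cball 0 1) G" unfolding G_def by (intro continuous_intros c)
  have G_h: "G holomorphic_on ball 0 1" unfolding G_def by (intro holomorphic_intros h)
  have G_cs: "continuous_on (sphere 0 1) G" by (rule continuous_on_subset[OF G_c]) auto
  obtain B where B: "B > 0" "\<And>x. cmod x = 1 \<Longrightarrow> cmod (G x) \<le> B" using bounded_on_circle[OF G_cs] by blast
  obtain d where d: "d > 0" "\<And>x. cmod x = 1 \<Longrightarrow> cmod (x - p) < d \<Longrightarrow> cmod (G x) \<le> e / 8 * cmod (x - p)"
    using A[of "e / 8"] e unfolding G_def by auto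
  have "((\<lambda>r. (1 - r\<^sup>2) * (16 * B / d ^ 3)) \<longlongrightarrow> (1 - 1\<^sup>2) * (16 * B / d ^ 3)) (at_left (1::real))"
    by (intro tendsto_intros)
  then have "\<forall>\<^sub>F r in at_left 1. (1 - r\<^sup>2) * (16 * B / d ^ 3) < e / 2"
    using e by (auto dest!: order_tendstoD(2)[where a = "e/2"])
  moreover have "\<forall>\<^sub>F r in at_left 1. (0::real) < r \<and> r < 1"
    using eventually_at_left_real[of 0 1] by (auto elim: eventually_mono)
  ultimately show "\<forall>\<^sub>F r in at_left 1. dist (deriv F (of_real r * p)) A < e"
  proof eventually_elim
    case (elim r)
    define z where "z = of_real r * p"
    have nz: "cmod z = r" using elim z0 by (simp add: z_def norm_mult)
    have z: "z \<in> ball 0 1" "cmod z < 1" using elim nz by auto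
    have ne: "1 - cnj z * x \<noteq> 0" if "cmod x \<le> 1" for x
      using one_minus_disc_circle_ne_0[of "cnj z" x] that z by simp
    have ne2: "x - z \<noteq> 0" if "cmod x = 1" for x
      using that nz elim by auto
    define Q1 where "Q1 = (\<lambda>x. G x / (x - z) ^ 2 * x)"
    \<comment> \<open>The reflected kernel: its product with \<open>G\<close> is analytic and vanishes at the origin.\<close>
    define Q2 where "Q2 = (\<lambda>x. G x * ((cnj z)\<^sup>2 * x / (1 - cnj z * x)\<^sup>2))"
    have Q_m [measurable]: "Q1 \<in> borel_measurable borel" "Q2 \<in> borel_measurable borel"
      unfolding Q1_def Q2_def by measurable
    have "((\<lambda>u. G u / (u - z) ^ Suc 1) has_contour_integral ((2 * pi * \<i>) / fact 1 * (deriv ^^ 1) G z)) (circlepath 0 1)"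
      by (rule Cauchy_has_contour_integral_higher_derivative_circlepath[OF G_c G_h z(1)])
    then have "((\<lambda>u. G u / (u - z) ^ 2) has_contour_integral (2 * pi * \<i> * deriv G z)) (circlepath 0 1)"
      by (simp add: numeral_2_eq_2)
    then have "(\<ointegral>x. Q1 x) = (2 * pi * \<i> * deriv G z) / (2 * of_real pi * \<i>)"
      unfolding Q1_def using ne2 by (intro integral_circle_contour continuous_intros G_cs) auto
    then have I1: "(\<ointegral>x. Q1 x) = deriv G z" by simp
    have "(\<ointegral>x. Q2 x) = Q2 0"
    proof (rule integral_circle_mean_value)
      show "continuous_on (cball 0 1) Q2"
        unfolding Q2_def by (intro continuous_intros G_c) (use ne in auto)
      show "Q2 holomorphic_on ball 0 1"
        unfolding Q2_def by (intro holomorphic_intros G_h) (use ne in auto)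
    qed (fact Q_m)
    then have I2: "(\<ointegral>x. Q2 x) = 0" by (simp add: Q2_def)
    have Qi: "integrable circle_measure Q1" "integrable circle_measure Q2"
      unfolding Q1_def Q2_def
      by (intro integrable_circle_continuous continuous_intros G_cs; use ne ne2 in \<open>auto\<close>)+
    have "deriv G z = (\<ointegral>x. Q1 x - Q2 x)"
      using Qi I1 I2 by simp
    also have "cmod \<dots> \<le> (\<ointegral>x. cmod (Q1 x - Q2 x))"
      by (rule integral_norm_bound)
    also have "\<dots> \<le> (\<ointegral>x. e / 2 * poisson z x + (1 - r\<^sup>2) * (16 * B / d ^ 3))"
    proof (rule integral_circle_mono_on)
      show "integrable circle_measure (\<lambda>x. cmod (Q1 x - Q2 x))" using Qi by auto
      show "integrable circle_measure (\<lambda>x. e / 2 * poisson z x + (1 - r\<^sup>2) * (16 * B / d ^ 3))"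
        using integrable_poisson[OF z(2)] by auto
      fix x :: complex assume x: "cmod x = 1"
      define w where "w = cnj z * x"
      define D where "D = cmod (1 - w)"
      have w1: "1 - w \<noteq> 0" using ne[of x] x by (simp add: w_def)
      then have D: "D > 0" by (simp add: D_def)
      have nw: "cmod w = r" using x nz by (simp add: w_def norm_mult)
      have zz: "x * cnj x = 1" using x complex_norm_square[of x] by simp
      have D': "cmod (1 - cnj w) = D" unfolding D_def by (metis complex_cnj_diff complex_cnj_one complex_mod_cnj)
      have w2: "1 - cnj w \<noteq> 0" using D D' by auto
      have "x - z = x * (1 - cnj w)"
        using zz by (simp add: w_def algebra_simps)
      then have "x / (x - z)\<^sup>2 = x / (x\<^sup>2 * (1 - cnj w)\<^sup>2)" by (simp add: power_mult_distrib)
      also have "\<dots> = cnj x / (1 - cnj w)\<^sup>2"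
      proof -
        have "x = cnj x * x\<^sup>2" using zz by (simp add: power2_eq_square algebra_simps flip: mult.assoc)
        moreover have "x \<noteq> 0" using x by auto
        ultimately show ?thesis by (metis mult.commute mult_divide_mult_cancel_left power_not_zero)
      qed
      finally have e1: "x / (x - z)\<^sup>2 = cnj x / (1 - cnj w)\<^sup>2" .
      have e2: "(cnj z)\<^sup>2 * x = cnj x * w\<^sup>2"
        using zz by (simp add: w_def power2_eq_square algebra_simps)
      have "Q1 x - Q2 x = G x * (x / (x - z)\<^sup>2 - (cnj z)\<^sup>2 * x / (1 - w)\<^sup>2)"
        by (simp add: Q1_def Q2_def w_def algebra_simps)
      also have "\<dots> = G x * cnj x * (1 / (1 - cnj w)\<^sup>2 - w\<^sup>2 / (1 - w)\<^sup>2)"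
        by (simp only: e1 e2) (simp add: algebra_simps)
      also have "1 / (1 - cnj w)\<^sup>2 - w\<^sup>2 / (1 - w)\<^sup>2 =
          ((1 - w) - w * (1 - cnj w)) * ((1 - w) + w * (1 - cnj w)) / ((1 - cnj w)\<^sup>2 * (1 - w)\<^sup>2)"
      proof -
        have "((1 - w) - w * (1 - cnj w)) * ((1 - w) + w * (1 - cnj w)) = (1 - w)\<^sup>2 - w\<^sup>2 * (1 - cnj w)\<^sup>2"
          by (simp add: power2_eq_square algebra_simps)
        then show ?thesis using w1 w2 by (simp add: diff_divide_distrib)
      qed
      also have "(1 - w) + w * (1 - cnj w) = of_real (1 - r\<^sup>2)"
        using complex_norm_square[of w] nw by (simp add: algebra_simps)
      finally have Q12: "Q1 x - Q2 x = G x * cnj x * (((1 - w) - w * (1 - cnj w)) * of_real (1 - r\<^sup>2) / ((1 - cnj w)\<^sup>2 * (1 - w)\<^sup>2))" .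
      have "cmod (Q1 x - Q2 x) = cmod (G x) * (cmod ((1 - w) - w * (1 - cnj w)) * (1 - r\<^sup>2) / (D\<^sup>2 * D\<^sup>2))"
      proof -
        have "cmod (of_real (1 - r\<^sup>2)) = 1 - r\<^sup>2" using elim by (simp add: abs_square_le_1 del: of_real_diff)
        moreover have "cmod (cnj x) = 1" using x by simp
        ultimately show ?thesis
          unfolding Q12 by (simp only: norm_mult norm_divide norm_power D' D_def[symmetric] mult_1_right)
      qed
      also have "\<dots> \<le> cmod (G x) * ((2 * D) * (1 - r\<^sup>2) / (D\<^sup>2 * D\<^sup>2))"
      proof -
        have "cmod ((1 - w) - w * (1 - cnj w)) \<le> cmod (1 - w) + cmod (w * (1 - cnj w))"
          by (rule norm_triangle_ineq4)
        also have "\<dots> = D + r * D" by (simp only: norm_mult nw D' D_def[symmetric])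
        also have "\<dots> \<le> 2 * D" using elim D by simp
        finally show ?thesis using D elim
          by (intro mult_left_mono divide_right_mono mult_right_mono) (auto simp: abs_square_le_1)
      qed
      also have "\<dots> = cmod (G x) * (2 * (1 - r\<^sup>2) / D ^ 3)"
        using D by (simp add: power2_eq_square power3_eq_cube)
      finally have bound: "cmod (Q1 x - Q2 x) \<le> cmod (G x) * (2 * (1 - r\<^sup>2) / D ^ 3)" .
      have P: "poisson z x = (1 - r\<^sup>2) / D\<^sup>2" by (simp add: poisson_def nz D_def w_def)
      have r2: "0 \<le> 1 - r\<^sup>2" using elim by (simp add: abs_square_le_1)
      have near: "cmod (x - p) \<le> 2 * D"
        using dist_circle_radius[OF x z0, of r] elim by (simp add: D_def w_def z_def)
      show "cmod (Q1 x - Q2 x) \<le> e / 2 * poisson z x + (1 - r\<^sup>2) * (16 * B / d ^ 3)"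
      proof (cases "cmod (x - p) < d")
        case True
        have "cmod (G x) \<le> e / 8 * (2 * D)"
          using d(2)[OF x True] near e by (smt (verit) mult_left_mono divide_nonneg_nonneg)
        then have "cmod (G x) * (2 * (1 - r\<^sup>2) / D ^ 3) \<le> e / 8 * (2 * D) * (2 * (1 - r\<^sup>2) / D ^ 3)"
          using r2 D by (intro mult_right_mono) auto
        also have "\<dots> = e / 2 * poisson z x"
          using D by (simp add: P power2_eq_square power3_eq_cube field_simps)
        finally show ?thesis using bound r2 B(1) d(1) mult_nonneg_nonneg[OF r2, of "16 * B / d ^ 3"]
            divide_nonneg_nonneg[of "16 * B" "d ^ 3"] zero_le_power[of d 3]
          by linarith
      next
        case False
        then have dD: "d / 2 \<le> D" using near by simp
        have "2 * (1 - r\<^sup>2) / D ^ 3 \<le> 2 * (1 - r\<^sup>2) / (d / 2) ^ 3"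
          using r2 dD d(1) D by (intro divide_left_mono power_mono) auto
        also have "\<dots> = 16 * (1 - r\<^sup>2) / d ^ 3" by (simp add: power_divide)
        finally have "cmod (G x) * (2 * (1 - r\<^sup>2) / D ^ 3) \<le> B * (16 * (1 - r\<^sup>2) / d ^ 3)"
          using B(2)[OF x] B(1) r2 D by (intro mult_mono) auto
        also have "\<dots> = (1 - r\<^sup>2) * (16 * B / d ^ 3)" by simp
        finally show ?thesis using bound poisson_nonneg[OF z(2), of x] e
          by (smt (verit) mult_nonneg_nonneg divide_nonneg_nonneg)
      qed
    qed
    also have "\<dots> = e / 2 + (1 - r\<^sup>2) * (16 * B / d ^ 3)"
      using integrable_poisson[OF z(2)] integral_poisson[OF z(2)] by (subst Bochner_Integration.integral_add) auto
    also have "\<dots> < e" using elim(1) by linarith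
    finally have "cmod (deriv G z) < e" .
    moreover have "deriv G z = deriv F z - A"
    proof -
      have "(F has_field_derivative deriv F z) (at z)"
        by (rule holomorphic_derivI[OF h _ z(1)]) auto
      then have "(G has_field_derivative deriv F z - A) (at z)"
        unfolding G_def by (auto intro!: derivative_eq_intros)
      then show ?thesis by (rule DERIV_imp_deriv)
    qed
    ultimately show ?case by (simp add: dist_norm z_def)
  qed
qed

text \<open>The differentiation theorem for integrals over intervals with left endpoint \<open>t\<close> is applied to the
  function and to its reflection.\<close>
lemma lebesgue_differentiation_real:
  fixes f :: "real \<Rightarrow> complex"
  assumes f: "\<And>a b. f integrable_on {a..b}"
  obtains N where "negligible N"
    "\<And>t e. t \<notin> N \<Longrightarrow> 0 < e \<Longrightarrow> \<exists>d>0. \<forall>h. 0 < h \<and> h < d \<longrightarrow>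
        cmod (integral {t..t + h} f - of_real h * f t) \<le> e * h \<and>
        cmod (integral {t - h..t} f - of_real h * f t) \<le> e * h"
proof -
  have one: "\<exists>N. negligible N \<and> (\<forall>t e. t \<notin> N \<longrightarrow> 0 < e \<longrightarrow> (\<exists>d>0. \<forall>h. 0 < h \<and> h < d \<longrightarrow>
        cmod (integral {t..t + h} f - of_real h * f t) \<le> e * h))"
    if f: "\<And>a b. f integrable_on {a..b}" for f :: "real \<Rightarrow> complex"
  proof -
    obtain N where N: "negligible N"
       "\<And>x e. \<lbrakk>x \<notin> N; 0 < e\<rbrakk> \<Longrightarrow> \<exists>d>0. \<forall>h. 0 < h \<and> h < d \<longrightarrow>
          norm (integral (cbox x (x + h *\<^sub>R One)) f /\<^sub>R h ^ DIM(real) - f x) < e"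
      using integrable_ccontinuous_explicit[of f] f by auto
    have "cmod (integral {t..t + h} f - of_real h * f t) \<le> e * h"
      if "0 < h" "norm (integral (cbox t (t + h *\<^sub>R One)) f /\<^sub>R h ^ DIM(real) - f t) < e" for t e h
    proof -
      have "integral {t..t + h} f - of_real h * f t = of_real h * (integral (cbox t (t + h *\<^sub>R One)) f /\<^sub>R h ^ DIM(real) - f t)"
        using that by (simp add: scaleR_conv_of_real field_simps)
      then have "cmod (integral {t..t + h} f - of_real h * f t) = h * norm (integral (cbox t (t + h *\<^sub>R One)) f /\<^sub>R h ^ DIM(real) - f t)"
        using that by (simp only: norm_mult norm_of_real abs_of_pos)
      also have "\<dots> \<le> h * e" using that by (intro mult_left_mono) auto
      finally show ?thesis by (simp add: mult.commute)
    qed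
    then show ?thesis using N by meson
  qed
  obtain N1 where N1: "negligible N1" "\<And>t e. t \<notin> N1 \<Longrightarrow> 0 < e \<Longrightarrow> \<exists>d>0. \<forall>h. 0 < h \<and> h < d \<longrightarrow>
        cmod (integral {t..t + h} f - of_real h * f t) \<le> e * h"
    using one[OF f] by blast
  have "(\<lambda>x. f (- x)) integrable_on {a..b}" for a b
    using f[of "-b" "-a"] Henstock_Kurzweil_Integration.integrable_reflect_real[where f = f and a = "-b" and b = "-a"] by simp
  then obtain N2 where N2: "negligible N2" "\<And>t e. t \<notin> N2 \<Longrightarrow> 0 < e \<Longrightarrow> \<exists>d>0. \<forall>h. 0 < h \<and> h < d \<longrightarrow>
        cmod (integral {t..t + h} (\<lambda>x. f (- x)) - of_real h * f (- t)) \<le> e * h"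
    using one[of "\<lambda>x. f (- x)"] by blast
  show ?thesis
  proof (rule that[of "N1 \<union> uminus ` N2"])
    have "negligible (uminus ` N2)"
      by (rule negligible_differentiable_image_negligible[OF _ N2(1)]) (auto simp: differentiable_on_def)
    then show "negligible (N1 \<union> uminus ` N2)" using N1(1) by (rule negligible_Un[rotated])
    fix t e :: real assume t: "t \<notin> N1 \<union> uminus ` N2" and e: "0 < e"
    then have "- t \<notin> N2" by (metis UnI2 image_eqI minus_minus)
    then obtain d2 where d2: "d2 > 0" "\<forall>h. 0 < h \<and> h < d2 \<longrightarrow>
        cmod (integral {-t..-t + h} (\<lambda>x. f (- x)) - of_real h * f t) \<le> e * h"
      using N2(2)[of "-t" e] e by auto
    obtain d1 where d1: "d1 > 0" "\<forall>h. 0 < h \<and> h < d1 \<longrightarrow>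
        cmod (integral {t..t + h} f - of_real h * f t) \<le> e * h"
      using N1(2)[of t e] e t by auto
    have "integral {-t..-t + h} (\<lambda>x. f (- x)) = integral {t - h..t} f" for h
      using Henstock_Kurzweil_Integration.integral_reflect_real[where f = f and a = "t - h" and b = t] by simp
    then show "\<exists>d>0. \<forall>h. 0 < h \<and> h < d \<longrightarrow>
        cmod (integral {t..t + h} f - of_real h * f t) \<le> e * h \<and>
        cmod (integral {t - h..t} f - of_real h * f t) \<le> e * h"
      using d1 d2 by (intro exI[of _ "min d1 d2"]) auto
  qed
qed

section \<open>Radial limits of square-summable power series\<close>

lemma cis_inj_on: "inj_on cis {0..<2 * pi}"
proof (rule inj_onI)
  fix x y assume "x \<in> {0..<2 * pi}" "y \<in> {0..<2 * pi}" "cis x = cis y"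
  then show "x = y"
    using Arg2pi_unique[of 1 x "cis x"] Arg2pi_unique[of 1 y "cis y"] by (simp add: cis_conv_exp)
qed

text \<open>The contour integral over the arc of angles from \<open>s\<close> to \<open>t\<close>, written as integration over the
  whole circle so that it is continuous for convergence in mean square.\<close>
definition arc_form :: "real \<Rightarrow> real \<Rightarrow> complex \<Rightarrow> complex" where
  "arc_form s t \<zeta> = \<i> * \<zeta> * indicator (cis ` {s..t}) \<zeta>"

lemma L2_arc_form: "L2 (arc_form s t)"
proof (rule L2_bounded)
  have "compact (cis ` {s..t})"
    by (intro compact_continuous_image continuous_intros) auto
  then have [measurable]: "cis ` {s..t} \<in> sets borel" by (simp add: borel_compact)
  show "arc_form s t \<in> borel_measurable borel"
    unfolding arc_form_def[abs_def] by measurable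
  show "AE \<zeta> in circle_measure. cmod (arc_form s t \<zeta>) \<le> 1"
    using AE_circle_on by eventually_elim (simp add: arc_form_def norm_mult indicator_def)
qed

lemma integral_arc_form:
  assumes u: "L2 u" and st: "0 \<le> s" "t < 2 * pi"
  shows "integral {s..t} (\<lambda>x. u (cis x) * (\<i> * cis x)) = (2 * pi) * (\<ointegral>\<zeta>. u \<zeta> * arc_form s t \<zeta>)"
proof -
  have [measurable]: "u \<in> borel_measurable borel" "arc_form s t \<in> borel_measurable borel"
    using u L2_arc_form by (auto dest: L2_measurable)
  have eq: "indicator {0..<2 * pi} x *\<^sub>R (u (cis x) * arc_form s t (cis x)) = indicator {s..t} x *\<^sub>R (u (cis x) * (\<i> * cis x))" for x
  proof (cases "x \<in> {0..<2*pi}")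
    case True
    have "cis x \<in> cis ` {s..t} \<longleftrightarrow> x \<in> {s..t}"
      using inj_on_image_mem_iff[OF cis_inj_on True, of "{s..t}"] st by (simp add: subset_eq)
    then show ?thesis using True by (simp add: arc_form_def indicator_def)
  qed (use st in \<open>auto simp: indicator_def\<close>)
  have "set_integrable lborel {0..<2 * pi} (\<lambda>x. u (cis x) * arc_form s t (cis x))"
    using integrable_circle_mult[OF u L2_arc_form[of s t]]
    by (subst (asm) integrable_circle_iff) auto
  then have i: "set_integrable lborel {s..t} (\<lambda>x. u (cis x) * (\<i> * cis x))"
    by (simp only: set_integrable_def eq)
  have "(\<ointegral>\<zeta>. u \<zeta> * arc_form s t \<zeta>) = (1 / (2 * pi)) *\<^sub>R (LINT x:{0..<2 * pi}|lborel. u (cis x) * arc_form s t (cis x))"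
    by (rule integral_circle_eq) measurable
  also have "(LINT x:{0..<2 * pi}|lborel. u (cis x) * arc_form s t (cis x)) = (LINT x:{s..t}|lborel. u (cis x) * (\<i> * cis x))"
    by (simp only: set_lebesgue_integral_def eq)
  also have "\<dots> = integral {s..t} (\<lambda>x. u (cis x) * (\<i> * cis x))"
    by (rule set_borel_integral_eq_integral(2)[OF i])
  finally show ?thesis by (simp add: scaleR_conv_of_real)
qed

text \<open>Fatou's theorem for the Hardy space. The power series is the derivative of a function \<open>F\<close> whose
  coefficients are absolutely summable, so \<open>F\<close> is continuous up to the circle. There its increments are
  integrals of the mean-square limit \<open>g\<close> of the partial sums, hence \<open>F\<close> has
  the derivative \<open>g\<close> along the circle almost everywhere, and \<open>radial_limit_of_derivative\<close> turns the
  tangential derivative into the radial limit of the power series.\<close>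
lemma fatou_radial_limit:
  fixes c :: "nat \<Rightarrow> complex"
  assumes c: "summable (\<lambda>n. (cmod (c n))\<^sup>2)"
  obtains g where "L2 g"
    "\<And>N. (\<ointegral>\<zeta>. (cmod (g \<zeta> - (\<Sum>n<N. c n * \<zeta> ^ n)))\<^sup>2) \<le> (\<Sum>n. (cmod (c (n + N)))\<^sup>2)"
    "AE \<zeta> in circle_measure. ((\<lambda>r. \<Sum>n. c n * (of_real r * \<zeta>) ^ n) \<longlongrightarrow> g \<zeta>) (at_left 1)"
proof -
  obtain g where g: "L2 g"
    and gN: "\<And>N. (\<ointegral>\<zeta>. (cmod (g \<zeta> - (\<Sum>n<N. c n * \<zeta> ^ n)))\<^sup>2) \<le> (\<Sum>n. (cmod (c (n + N)))\<^sup>2)"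
    using riesz_fischer[OF c] by blast
  have g_meas [measurable]: "g \<in> borel_measurable borel" using g by (rule L2_measurable)
  define a where "a = (\<lambda>m. case m of 0 \<Rightarrow> 0 | Suc n \<Rightarrow> c n / of_nat (Suc n))"
  define F where "F = (\<lambda>z. \<Sum>m. a m * z ^ m)"
  have a_summable: "summable (\<lambda>m. cmod (a m))"
  proof -
    have "summable (\<lambda>n. (cmod (c n))\<^sup>2 + inverse (of_nat (Suc n) ^ 2))"
      using inverse_power_summable[of 2, where 'a = real] by (intro summable_add c) (subst summable_Suc_iff, simp)
    then have "summable (\<lambda>n. cmod (a (Suc n)))"
    proof (rule summable_comparison_test'[where N = 0])
      fix n :: nat
      define y where "y = inverse (of_nat (Suc n) :: real)"
      have "cmod (a (Suc n)) = cmod (c n) * y"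
        by (simp add: a_def norm_divide y_def field_simps del: of_nat_Suc)
      also have "\<dots> \<le> (cmod (c n))\<^sup>2 + y\<^sup>2"
      proof -
        have "0 \<le> cmod (c n) * y" by (simp add: y_def)
        then show ?thesis using sum_squares_bound[of "cmod (c n)" y] by linarith
      qed
      finally show "norm (cmod (a (Suc n))) \<le> (cmod (c n))\<^sup>2 + inverse (of_nat (Suc n) ^ 2)"
        by (simp add: y_def power_inverse)
    qed
    then show ?thesis by (subst (asm) summable_Suc_iff)
  qed
  have F_unif: "uniform_limit (cball 0 1) (\<lambda>N z. \<Sum>m<N. a m * z ^ m) F sequentially"
    unfolding F_def
  proof (rule Weierstrass_m_test)
    show "norm (a m * z ^ m) \<le> cmod (a m)" if "z \<in> cball 0 1" for m z
      using that by (simp add: norm_mult norm_power mult_left_le power_le_one)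
  qed (fact a_summable)
  have F_cont: "continuous_on (cball 0 1) F"
    by (rule uniform_limit_theorem[OF _ F_unif]) (auto intro!: always_eventually continuous_intros)
  have F_meas: "F \<in> borel_measurable borel"
    unfolding F_def by measurable
  have F_deriv: "(F has_field_derivative (\<Sum>n. c n * z ^ n)) (at z)" if "cmod z < 1" for z
  proof -
    have "(F has_field_derivative (\<Sum>n. diffs a n * z ^ n)) (at z)"
      unfolding F_def
    proof (rule termdiffs_strong'[where K = 1])
      fix z :: complex assume "cmod z < 1"
      then show "summable (\<lambda>n. a n * z ^ n)"
        by (intro summable_comparison_test'[OF a_summable, of 0]) (simp add: norm_mult norm_power mult_left_le power_le_one)
    qed (use that in auto)
    also have "diffs a = c"
      by (simp add: diffs_def a_def fun_eq_iff del: of_nat_Suc)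
    finally show ?thesis .
  qed
  have F_hol: "F holomorphic_on ball 0 1"
    by (rule holomorphic_onI) (meson F_deriv mem_ball_0 field_differentiable_def field_differentiable_at_within)
  have F_arc: "F (cis t) - F (cis s) = integral {s..t} (\<lambda>x. g (cis x) * (\<i> * cis x))"
    if st: "0 \<le> s" "s \<le> t" "t < 2 * pi" for s t
  proof -
    define S where "S = (\<lambda>N z. \<Sum>m<N. a m * z ^ m)"
    define p where "p = (\<lambda>N z. \<Sum>n<N. c n * z ^ n)"
    have S_deriv: "(S (Suc N) has_field_derivative p N z) (at z)" for N z
    proof -
      have "S (Suc N) = (\<lambda>z. \<Sum>n<N. a (Suc n) * z ^ Suc n)"
        unfolding S_def by (simp only: sum.lessThan_Suc_shift) (simp add: a_def)
      moreover have "((\<lambda>z. \<Sum>n<N. a (Suc n) * z ^ Suc n) has_field_derivative (\<Sum>n<N. a (Suc n) * (of_nat (Suc n) * z ^ n))) (at z)"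
      proof (rule DERIV_sum)
        show "((\<lambda>z. a (Suc n) * z ^ Suc n) has_field_derivative a (Suc n) * (of_nat (Suc n) * z ^ n)) (at z)" for n
          using DERIV_cmult[OF DERIV_power[OF DERIV_ident, where n = "Suc n"], of "a (Suc n)" z UNIV]
          by (simp del: of_nat_Suc power_Suc)
      qed
      moreover have "(\<Sum>n<N. a (Suc n) * (of_nat (Suc n) * z ^ n)) = p N z"
        unfolding p_def by (intro sum.cong) (simp_all add: a_def del: of_nat_Suc)
      ultimately show ?thesis by simp
    qed
    have SN: "S (Suc N) (cis t) - S (Suc N) (cis s) = (2 * pi) * (\<ointegral>\<zeta>. p N \<zeta> * arc_form s t \<zeta>)" for N
    proof -
      have "((\<lambda>x. p N (cis x) * (\<i> * cis x)) has_integral S (Suc N) (cis t) - S (Suc N) (cis s)) {s..t}"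
      proof (rule fundamental_theorem_of_calculus[OF st(2)])
        fix x assume "x \<in> {s..t}"
        have "(cis has_vector_derivative (\<i> * cis x)) (at x within {s..t})"
          by (auto intro!: derivative_eq_intros simp: has_vector_derivative_def has_derivative_cis scaleR_conv_of_real)
        then have "((S (Suc N) \<circ> cis) has_vector_derivative (\<i> * cis x) * p N (cis x)) (at x within {s..t})"
          by (rule field_vector_diff_chain_within) (rule DERIV_subset[OF S_deriv], simp)
        then show "((\<lambda>x. S (Suc N) (cis x)) has_vector_derivative p N (cis x) * (\<i> * cis x)) (at x within {s..t})"
          by (simp add: o_def mult.commute)
      qed
      then have "integral {s..t} (\<lambda>x. p N (cis x) * (\<i> * cis x)) = S (Suc N) (cis t) - S (Suc N) (cis s)"
        by (rule integral_unique)
      moreover have "L2 (p N)" unfolding p_def by (rule L2_poly)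
      ultimately show ?thesis using integral_arc_form[of "p N" s t] st by simp
    qed
    have "(\<lambda>N. S (Suc N) (cis t) - S (Suc N) (cis s)) \<longlonglongrightarrow> F (cis t) - F (cis s)"
      unfolding S_def using F_unif
      by (intro tendsto_diff LIMSEQ_Suc tendsto_uniform_limitI) auto
    then have "(\<lambda>N. (2 * pi) * (\<ointegral>\<zeta>. p N \<zeta> * arc_form s t \<zeta>)) \<longlonglongrightarrow> F (cis t) - F (cis s)"
      unfolding SN .
    moreover have "(\<lambda>N. (2 * pi) * (\<ointegral>\<zeta>. p N \<zeta> * arc_form s t \<zeta>)) \<longlonglongrightarrow> (2 * pi) * (\<ointegral>\<zeta>. g \<zeta> * arc_form s t \<zeta>)"
    proof (intro tendsto_intros tendsto_integral_mult_L2 g L2_arc_form)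
      show "L2 (p N)" for N unfolding p_def by (rule L2_poly)
      show "(\<lambda>N. \<ointegral>\<zeta>. (cmod (p N \<zeta> - g \<zeta>))\<^sup>2) \<longlonglongrightarrow> 0"
      proof (rule tendsto_sandwich[OF _ _ tendsto_const suminf_exist_split2[OF c]])
        show "\<forall>\<^sub>F N in sequentially. (\<ointegral>\<zeta>. (cmod (p N \<zeta> - g \<zeta>))\<^sup>2) \<le> (\<Sum>n. (cmod (c (n + N)))\<^sup>2)"
          using gN by (simp add: p_def norm_minus_commute)
      qed (auto intro!: always_eventually integral_nonneg_AE)
    qed
    ultimately have "F (cis t) - F (cis s) = (2 * pi) * (\<ointegral>\<zeta>. g \<zeta> * arc_form s t \<zeta>)"
      by (rule LIMSEQ_unique)
    then show ?thesis using integral_arc_form[OF g, of s t] st by simp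
  qed
  define \<psi> where "\<psi> = (\<lambda>x. indicator {0..<2 * pi} x *\<^sub>R (g (cis x) * (\<i> * cis x)))"
  have "\<psi> integrable_on {l..u}" for l u
  proof -
    have "integrable circle_measure (\<lambda>\<zeta>. g \<zeta> * (\<i> * \<zeta>))"
      by (intro integrable_circle_mult g L2_continuous continuous_intros) measurable
    then have "integrable lborel \<psi>"
      by (subst (asm) integrable_circle_iff) (auto simp: set_integrable_def \<psi>_def)
    then have "set_integrable lborel {l..u} \<psi>"
      unfolding set_integrable_def by (intro integrable_mult_indicator) auto
    then show ?thesis by (rule set_borel_integral_eq_integral)
  qed
  then obtain N where N: "negligible N"
    "\<And>t e. t \<notin> N \<Longrightarrow> 0 < e \<Longrightarrow> \<exists>d>0. \<forall>h. 0 < h \<and> h < d \<longrightarrow>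
        cmod (integral {t..t + h} \<psi> - of_real h * \<psi> t) \<le> e * h \<and>
        cmod (integral {t - h..t} \<psi> - of_real h * \<psi> t) \<le> e * h"
    using lebesgue_differentiation_real by blast
  have arc\<psi>: "F (cis t) - F (cis s) = integral {s..t} \<psi>" if "0 \<le> s" "s \<le> t" "t < 2 * pi" for s t
    using F_arc[OF that] that by (auto simp: \<psi>_def intro!: Henstock_Kurzweil_Integration.integral_cong)
  have radial: "((\<lambda>r. \<Sum>n. c n * (of_real r * cis t) ^ n) \<longlongrightarrow> g (cis t)) (at_left 1)"
    if t: "0 < t" "t < 2 * pi" and tN: "t \<notin> N" for t
  proof -
    define A where "A = g (cis t)"
    have \<psi>t: "\<psi> t = A * (\<i> * cis t)" using t by (simp add: \<psi>_def A_def)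
    have "((\<lambda>r. deriv F (of_real r * cis t)) \<longlongrightarrow> A) (at_left 1)"
    proof (rule radial_limit_of_derivative[OF F_meas F_cont F_hol])
      fix e :: real assume e: "0 < e"
      define e' where "e' = min 1 (e / (2 + cmod A))"
      have e'0: "0 < e'" using e by (simp add: e'_def add_pos_nonneg)
      have e'1: "e' \<le> 1" by (simp add: e'_def)
      have "e' \<le> e / (2 + cmod A)" by (simp add: e'_def)
      moreover have "0 < 2 + cmod A" by (simp add: add_pos_nonneg)
      ultimately have e'2: "e' * (2 + cmod A) \<le> e" by (simp add: pos_le_divide_eq)
      obtain d1 where d1: "d1 > 0" "\<forall>h. 0 < h \<and> h < d1 \<longrightarrow>
        cmod (integral {t..t + h} \<psi> - of_real h * \<psi> t) \<le> e' * h \<and>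
        cmod (integral {t - h..t} \<psi> - of_real h * \<psi> t) \<le> e' * h"
        using N(2)[OF tN e'0] by blast
      define d2 where "d2 = min d1 (min t (2 * pi - t))"
      have d2: "0 < d2" "d2 \<le> d1" "d2 \<le> t" "d2 \<le> 2 * pi - t" using d1 t by (auto simp: d2_def)
      have param: "cmod (F (cis s) - F (cis t) - of_real (s - t) * \<psi> t) \<le> e' * \<bar>s - t\<bar>" if "\<bar>s - t\<bar> < d2" for s
      proof -
        consider "s = t" | "s > t" | "s < t" by linarith
        then show ?thesis
        proof cases
          case 2
          then have "F (cis s) - F (cis t) = integral {t..t + (s - t)} \<psi>"
            using arc\<psi>[of t s] t that d2 by simp
          then show ?thesis using d1(2)[rule_format, of "s - t"] that d2 2 by simp
        next
          case 3
          then have "F (cis s) - F (cis t) = - integral {t - (t - s)..t} \<psi>"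
            using arc\<psi>[of s t] t that d2 by (simp add: algebra_simps)
          then have "F (cis s) - F (cis t) - of_real (s - t) * \<psi> t = - (integral {t - (t - s)..t} \<psi> - of_real (t - s) * \<psi> t)"
            by (simp add: algebra_simps)
          then show ?thesis using d1(2)[rule_format, of "t - s"] that d2 3 by (simp only: norm_minus_cancel) simp
        qed simp
      qed
      have "(Ln has_field_derivative 1) (at 1)"
        using has_field_derivative_Ln[of 1] by simp
      then obtain d3 where d3: "d3 > 0" "\<And>w. cmod (w - 1) < d3 \<Longrightarrow> cmod (Ln w - (w - 1)) \<le> e' * cmod (w - 1)"
        using e'0 unfolding has_field_derivative_def has_derivative_at_alt by fastforce
      define d where "d = min d3 (min 1 (d2 / 2))"
      show "\<exists>d>0. \<forall>\<zeta>. cmod \<zeta> = 1 \<longrightarrow> cmod (\<zeta> - cis t) < d \<longrightarrow>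
               cmod (F \<zeta> - F (cis t) - A * (\<zeta> - cis t)) \<le> e * cmod (\<zeta> - cis t)"
      proof (intro exI[of _ d] conjI allI impI)
        show "0 < d" using d3 d2 by (simp add: d_def)
        fix \<zeta> :: complex assume \<zeta>: "cmod \<zeta> = 1" "cmod (\<zeta> - cis t) < d"
        \<comment> \<open>The angle of \<open>\<zeta>\<close> is recovered from the logarithm of \<open>w\<close>, which differs from \<open>w - 1\<close> to second order.\<close>
        define w where "w = \<zeta> / cis t"
        have \<zeta>w: "\<zeta> = cis t * w" by (simp add: w_def)
        have nw: "cmod w = 1" using \<zeta> by (simp add: w_def norm_divide)
        have w1: "cmod (\<zeta> - cis t) = cmod (w - 1)"
        proof -
          have "\<zeta> - cis t = cis t * (w - 1)" by (simp add: \<zeta>w algebra_simps)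
          then show ?thesis by (simp add: norm_mult del: right_diff_distrib')
        qed
        have w0: "w \<noteq> 0" using nw by auto
        define s where "s = t + Im (Ln w)"
        have Lnw: "Ln w = \<i> * of_real (s - t)"
          using w0 nw by (simp add: complex_eq_iff s_def)
        have "exp (Ln w) = w" using w0 by simp
        then have cis_s: "cis s = \<zeta>"
          unfolding \<zeta>w Lnw by (simp add: cis_conv_exp right_diff_distrib exp_diff field_simps)
        have Lb: "cmod (Ln w - (w - 1)) \<le> e' * cmod (w - 1)"
          using d3(2)[of w] \<zeta>(2) w1 by (simp add: d_def)
        have "cmod (Ln w) \<le> cmod (Ln w - (w - 1)) + cmod (w - 1)"
          using norm_triangle_ineq[of "Ln w - (w - 1)" "w - 1"] by simp
        also have "\<dots> \<le> 1 * cmod (w - 1) + cmod (w - 1)"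
          using Lb mult_right_mono[OF e'1, of "cmod (w - 1)"] by simp
        finally have L2: "\<bar>s - t\<bar> \<le> 2 * cmod (w - 1)"
          unfolding Lnw by (simp add: norm_mult del: of_real_diff)
        then have "\<bar>s - t\<bar> < d2" using \<zeta>(2) w1 by (simp add: d_def)
        from param[OF this] have p: "cmod (F \<zeta> - F (cis t) - of_real (s - t) * \<psi> t) \<le> e' * \<bar>s - t\<bar>"
          by (simp add: cis_s)
        have "F \<zeta> - F (cis t) - A * (\<zeta> - cis t) = (F \<zeta> - F (cis t) - of_real (s - t) * \<psi> t) + A * cis t * (Ln w - (w - 1))"
          unfolding \<psi>t Lnw by (simp add: \<zeta>w algebra_simps)
        also have "cmod \<dots> \<le> e' * \<bar>s - t\<bar> + cmod A * (e' * cmod (w - 1))"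
          by (intro order_trans[OF norm_triangle_ineq] add_mono p)
             (use Lb in \<open>simp add: norm_mult mult_left_mono\<close>)
        also have "\<dots> \<le> e' * (2 * cmod (w - 1)) + cmod A * (e' * cmod (w - 1))"
          using L2 e'0 by simp
        also have "\<dots> = e' * (2 + cmod A) * cmod (w - 1)" by (simp add: algebra_simps)
        also have "\<dots> \<le> e * cmod (w - 1)" using e'2 by (intro mult_right_mono) auto
        finally show "cmod (F \<zeta> - F (cis t) - A * (\<zeta> - cis t)) \<le> e * cmod (\<zeta> - cis t)"
          by (simp only: w1)
      qed
    qed simp
    then show ?thesis
      unfolding A_def
    proof (rule Lim_transform_eventually)
      show "\<forall>\<^sub>F r in at_left 1. deriv F (of_real r * cis t) = (\<Sum>n. c n * (of_real r * cis t) ^ n)"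
        using eventually_at_left_real[OF zero_less_one]
      proof eventually_elim
        case (elim r)
        then show ?case
          by (intro DERIV_imp_deriv F_deriv) (auto simp: norm_mult)
      qed
    qed
  qed
  have "AE t in lborel. t \<notin> N"
    using AE_not_in[of N lebesgue] N(1) by (simp only: negligible_iff_null_sets AE_completion_iff)
  then have "AE t in lborel. 0 < t \<and> t < 2 * pi \<longrightarrow> ((\<lambda>r. \<Sum>n. c n * (of_real r * cis t) ^ n) \<longlongrightarrow> g (cis t)) (at_left 1)"
    by eventually_elim (use radial in auto)
  then have "AE \<zeta> in circle_measure. ((\<lambda>r. \<Sum>n. c n * (of_real r * \<zeta>) ^ n) \<longlongrightarrow> g \<zeta>) (at_left 1)"
    by (rule AE_circleI)
  with g gN show ?thesis by (rule that)
qed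

section \<open>Measurability of radial boundary values\<close>

lemma analytic_disc_measurable [measurable_dest]:
  assumes "f \<in> analytic_disc"
  shows "f \<in> borel_measurable borel"
proof -
  have "continuous_on unit_disc f"
    using assms by (auto simp: analytic_disc_def intro: holomorphic_on_imp_continuous_on)
  then have "(\<lambda>z. if z \<in> unit_disc then f z else 0) \<in> borel_measurable borel"
    by (intro borel_measurable_continuous_on_if) auto
  moreover have "(\<lambda>z. if z \<in> unit_disc then f z else 0) = f"
    using assms by (auto simp: analytic_disc_def fun_eq_iff)
  ultimately show ?thesis by simp
qed

text \<open>The Cauchy criterion for the limit at 1 from the left, tested on rational points only. The countable
  quantifiers make the set of those boundary points at which a radial limit exists a Borel set.\<close>
definition rational_cauchy_at_1 :: "(real \<Rightarrow> complex) \<Rightarrow> bool" where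
  "rational_cauchy_at_1 h \<longleftrightarrow> (\<forall>k::nat. \<exists>m::nat. \<forall>p q::rat.
     1 - 1 / (real m + 1) < of_rat p \<and> of_rat p < (1::real) \<and> 1 - 1 / (real m + 1) < of_rat q \<and> of_rat q < (1::real) \<longrightarrow>
     dist (h (of_rat p)) (h (of_rat q)) \<le> 1 / (real k + 1))"

lemma rational_cauchy_at_1_iff:
  assumes h: "continuous_on {0..<1} h"
  shows "rational_cauchy_at_1 h \<longleftrightarrow> (\<exists>L. (h \<longlongrightarrow> L) (at_left 1))"
proof
  assume "\<exists>L. (h \<longlongrightarrow> L) (at_left 1)"
  then obtain L where L: "(h \<longlongrightarrow> L) (at_left 1)" by blast
  show "rational_cauchy_at_1 h"
    unfolding rational_cauchy_at_1_def
  proof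
    fix k :: nat
    define e where "e = 1 / (real k + 1)"
    have "e > 0" by (simp add: e_def)
    then have "\<forall>\<^sub>F r in at_left 1. dist (h r) L < e / 2" using L by (intro tendstoD) auto
    then obtain b where b: "b < 1" "\<And>r. b < r \<Longrightarrow> r < 1 \<Longrightarrow> dist (h r) L < e / 2"
      unfolding eventually_at_left_field by blast
    obtain m where "inverse (real (Suc m)) < 1 - b" using reals_Archimedean[of "1 - b"] b by auto
    then have m: "b < 1 - 1 / (real m + 1)" by (simp add: inverse_eq_divide add.commute)
    show "\<exists>m::nat. \<forall>p q::rat. 1 - 1 / (real m + 1) < of_rat p \<and> of_rat p < (1::real) \<and> 1 - 1 / (real m + 1) < of_rat q \<and> of_rat q < (1::real) \<longrightarrow>
     dist (h (of_rat p)) (h (of_rat q)) \<le> 1 / (real k + 1)"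
    proof (intro exI[of _ m] allI impI)
      fix p q :: rat
      assume pq: "1 - 1 / (real m + 1) < of_rat p \<and> of_rat p < (1::real) \<and> 1 - 1 / (real m + 1) < of_rat q \<and> of_rat q < (1::real)"
      have "b < of_rat p" "b < of_rat q" using pq m by linarith+
      then have "dist (h (of_rat p)) L < e / 2" "dist (h (of_rat q)) L < e / 2"
        using pq b(2) by blast+
      then show "dist (h (of_rat p)) (h (of_rat q)) \<le> 1 / (real k + 1)"
        using dist_triangle_half_r[of L "h (of_rat p)" e "h (of_rat q)"] by (auto simp: e_def dist_commute)
    qed
  qed
next
  assume Q: "rational_cauchy_at_1 h"
  define x where "x = (\<lambda>n. 1 - 1 / (real n + 1))"
  have x_rat: "x n = of_rat (1 - 1 / (of_nat n + 1))" for n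
    by (simp add: x_def of_rat_diff of_rat_divide of_rat_add)
  have x_lt: "x n < 1" for n by (simp add: x_def)
  have x_mono: "x m < x n" if "m < n" for m n using that by (simp add: x_def frac_less2)
  have "Cauchy (\<lambda>n. h (x n))"
  proof (rule metric_CauchyI)
    fix e :: real assume "0 < e"
    then obtain k where k: "inverse (real (Suc k)) < e" using reals_Archimedean by blast
    obtain m where m: "\<And>p q::rat. x m < of_rat p \<Longrightarrow> of_rat p < (1::real) \<Longrightarrow> x m < of_rat q \<Longrightarrow> of_rat q < (1::real) \<Longrightarrow>
        dist (h (of_rat p)) (h (of_rat q)) \<le> 1 / (real k + 1)"
      using Q unfolding rational_cauchy_at_1_def x_def by meson
    show "\<exists>M. \<forall>i\<ge>M. \<forall>j\<ge>M. dist (h (x i)) (h (x j)) < e"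
    proof (intro exI[of _ "Suc m"] allI impI)
      fix i j assume "Suc m \<le> i" "Suc m \<le> j"
      then have "dist (h (x i)) (h (x j)) \<le> 1 / (real k + 1)"
        using m[of "1 - 1 / (of_nat i + 1)" "1 - 1 / (of_nat j + 1)"] x_lt x_mono
        unfolding x_rat[symmetric] by auto
      then show "dist (h (x i)) (h (x j)) < e" using k by (simp add: inverse_eq_divide add.commute)
    qed
  qed
  then obtain L where L: "(\<lambda>n. h (x n)) \<longlonglongrightarrow> L" by (auto simp: Cauchy_convergent_iff convergent_def)
  have "(h \<longlongrightarrow> L) (at_left 1)"
  proof (rule tendstoI)
    fix e :: real assume "0 < e"
    then have "0 < e / 2" by simp
    then obtain k where k: "inverse (real (Suc k)) < e / 2" using reals_Archimedean by blast
    obtain m where m: "\<And>p q::rat. x m < of_rat p \<Longrightarrow> of_rat p < (1::real) \<Longrightarrow> x m < of_rat q \<Longrightarrow> of_rat q < (1::real) \<Longrightarrow>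
        dist (h (of_rat p)) (h (of_rat q)) \<le> 1 / (real k + 1)"
      using Q unfolding rational_cauchy_at_1_def x_def by meson
    have rat: "dist (h (of_rat p)) L < e / 2" if p: "x m < of_rat p" "of_rat p < (1::real)" for p :: rat
    proof -
      have "dist (h (of_rat p)) L \<le> 1 / (real k + 1)"
      proof (rule LIMSEQ_le_const2)
        show "(\<lambda>n. dist (h (of_rat p)) (h (x n))) \<longlonglongrightarrow> dist (h (of_rat p)) L" by (intro tendsto_intros L)
        show "\<exists>N. \<forall>n\<ge>N. dist (h (of_rat p)) (h (x n)) \<le> 1 / (real k + 1)"
        proof (intro exI[of _ "Suc m"] allI impI)
          fix n assume "Suc m \<le> n"
          then show "dist (h (of_rat p)) (h (x n)) \<le> 1 / (real k + 1)"
            using m[of p "1 - 1 / (of_nat n + 1)"] x_lt x_mono p unfolding x_rat[symmetric] by auto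
        qed
      qed
      also have "\<dots> < e / 2" using k by (simp add: inverse_eq_divide add.commute)
      finally show ?thesis .
    qed
    have "dist (h r) L < e" if r: "x m < r" "r < 1" for r
    proof -
      have "0 \<le> x m" by (simp add: x_def)
      have "isCont h r"
        using h r \<open>0 \<le> x m\<close> continuous_on_interior[OF h, of r] by simp
      then obtain d where d: "d > 0" "\<And>y. dist y r < d \<Longrightarrow> dist (h y) (h r) < e / 2"
        using \<open>0 < e / 2\<close> unfolding continuous_at by (metis LIM_def continuous_at_eps_delta \<open>isCont h r\<close>)
      obtain p :: rat where p: "max (x m) (r - d) < of_rat p" "of_rat p < r"
        using of_rat_dense[of "max (x m) (r - d)" r] r d by auto
      then have "dist (h (of_rat p)) (h r) < e / 2" by (intro d) (auto simp: dist_real_def)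
      moreover have "dist (h (of_rat p)) L < e / 2" using p r by (intro rat) linarith+
      ultimately show ?thesis using dist_triangle_half_l[of "h (of_rat p)" "h r" e L] by (simp add: dist_triangle_half_r)
    qed
    then show "\<forall>\<^sub>F r in at_left 1. dist (h r) L < e"
      unfolding eventually_at_left_field using x_lt by blast
  qed
  then show "\<exists>L. (h \<longlongrightarrow> L) (at_left 1)" by blast
qed

lemma continuous_on_radius:
  assumes "f \<in> analytic_disc" "cmod x = 1"
  shows "continuous_on {0..<1} (\<lambda>r. f (of_real r * x))"
proof -
  have "continuous_on unit_disc f"
    using assms by (auto simp: analytic_disc_def intro: holomorphic_on_imp_continuous_on)
  then show ?thesis
    by (rule continuous_on_compose2) (use assms in \<open>auto intro!: continuous_intros simp: norm_mult\<close>)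
qed

lemma boundary_value_eqI:
  "radial_limit f x L \<Longrightarrow> boundary_value f x = L"
  unfolding boundary_value_def by (intro tendsto_Lim) auto

text \<open>On the circle the boundary value is a sequential limit where the radial limit exists, and one fixed
  value elsewhere because the definite description then has an empty predicate. Off the circle
  it is the value of \<open>f\<close> itself.\<close>
lemma borel_measurable_boundary_value:
  assumes f: "f \<in> analytic_disc"
  shows "boundary_value f \<in> borel_measurable borel"
proof -
  have [measurable]: "f \<in> borel_measurable borel" by (rule analytic_disc_measurable[OF f])
  define S where "S = {x. cmod x = 1 \<and> rational_cauchy_at_1 (\<lambda>r. f (of_real r * x))}"
  have S [measurable]: "S \<in> sets borel"
    unfolding S_def rational_cauchy_at_1_def by measurable
  define g where "g = (\<lambda>x. if x \<in> S then lim (\<lambda>n. f (of_real (1 - 1 / (real n + 2)) * x))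
     else if cmod x = 1 then (THE L. False) else f x)"
  have "boundary_value f = g"
  proof
    fix x
    show "boundary_value f x = g x"
    proof (cases "cmod x = 1")
      case True
      note iff = rational_cauchy_at_1_iff[OF continuous_on_radius[OF f True]]
      show ?thesis
      proof (cases "x \<in> S")
        case S: True
        then obtain L where L: "radial_limit f x L"
          using iff by (auto simp: S_def)
        from filterlim_compose[OF L filterlim_at_left_1] have "lim (\<lambda>n. f (of_real (1 - 1 / (real n + 2)) * x)) = L"
          by (rule limI)
        then show ?thesis using S boundary_value_eqI[OF L] by (simp add: g_def)
      next
        case False
        then have "(\<lambda>L. radial_limit f x L) = (\<lambda>L. False)"
          using iff True by (auto simp: S_def)
        then have "(THE L. radial_limit f x L) = (THE L. False)"
          by (rule arg_cong)
        then show ?thesis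
          using False True unfolding boundary_value_def t2_space_class.Lim_def by (simp add: g_def)
      qed
    next
      case False
      have "radial_limit f x (f x)"
      proof (cases "cmod x < 1")
        case True
        then have "isCont f x"
          using f by (auto simp: analytic_disc_def intro!: continuous_on_interior[OF holomorphic_on_imp_continuous_on] simp: interior_open)
        moreover have "((\<lambda>r. of_real r * x) \<longlongrightarrow> of_real 1 * x) (at_left 1)" by (intro tendsto_intros)
        then have "((\<lambda>r. of_real r * x) \<longlongrightarrow> x) (at_left 1)" by simp
        ultimately show ?thesis by (rule isCont_tendsto_compose)
      next
        case nless: False
        then have n1: "1 < cmod x" using False by simp
        have "((\<lambda>r. cmod (of_real r * x)) \<longlongrightarrow> cmod (of_real 1 * x)) (at_left 1)" by (intro tendsto_intros)
        then have "\<forall>\<^sub>F r in at_left 1. 1 < cmod (of_real r * x)"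
          using n1 by (intro order_tendstoD(1)) auto
        then have "\<forall>\<^sub>F r in at_left 1. f (of_real r * x) = 0"
          by eventually_elim (use f in \<open>auto simp: analytic_disc_def\<close>)
        moreover have "f x = 0" using f n1 by (auto simp: analytic_disc_def)
        ultimately show ?thesis by (simp add: tendsto_eventually)
      qed
      from boundary_value_eqI[OF this] show ?thesis using False by (simp add: g_def S_def)
    qed
  qed
  moreover have "g \<in> borel_measurable borel" unfolding g_def by measurable
  ultimately show ?thesis by simp
qed

section \<open>Hardy space functions and their coefficients\<close>

lemma bessel_circle:
  assumes u: "L2 u"
  shows "(\<Sum>n<N. (cmod (\<ointegral>x. u x * cnj (x ^ n)))\<^sup>2) \<le> (\<ointegral>x. (cmod (u x))\<^sup>2)"
proof -
  define c where "c = (\<lambda>n. \<ointegral>x. u x * cnj (x ^ n))"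
  define p where "p = (\<lambda>x. \<Sum>n<N. c n * x ^ n)"
  have p: "L2 p" unfolding p_def by (rule L2_poly)
  have pc: "L2 (\<lambda>x. cnj (p x))" by (rule L2_cnj[OF p])
  have nc: "L2 (\<lambda>x. cnj (x ^ n))" for n
    by (rule L2_cnj[OF L2_power])
  have pp: "(\<ointegral>x. (cmod (p x))\<^sup>2) = (\<Sum>n<N. (cmod (c n))\<^sup>2)"
    unfolding p_def by (rule parseval_poly) simp
  have up: "(\<ointegral>x. u x * cnj (p x)) = of_real (\<Sum>n<N. (cmod (c n))\<^sup>2)"
  proof -
    have "(\<ointegral>x. u x * cnj (p x)) = (\<ointegral>x. (\<Sum>n<N. cnj (c n) * (u x * cnj (x ^ n))))"
      by (rule Bochner_Integration.integral_cong) (simp_all add: p_def sum_distrib_left mult_ac)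
    also have "\<dots> = (\<Sum>n<N. \<ointegral>x. cnj (c n) * (u x * cnj (x ^ n)))"
      by (rule Bochner_Integration.integral_sum) (intro integrable_mult_right integrable_circle_mult u nc)
    also have "\<dots> = (\<Sum>n<N. cnj (c n) * c n)"
      unfolding c_def by (intro sum.cong refl Bochner_Integration.integral_mult_right) (intro integrable_circle_mult u nc)
    also have "\<dots> = of_real (\<Sum>n<N. (cmod (c n))\<^sup>2)"
      by (simp only: of_real_sum complex_norm_square mult.commute)
    finally show ?thesis .
  qed
  define w where "w = (\<lambda>x. u x * cnj (p x))"
  have w: "integrable circle_measure w" unfolding w_def by (rule integrable_circle_mult[OF u pc])
  have "0 \<le> (\<ointegral>x. (cmod (u x - p x))\<^sup>2)"
    by (intro integral_nonneg_AE) auto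
  also have "\<dots> = (\<ointegral>x. ((cmod (u x))\<^sup>2 - 2 * Re (w x)) + (cmod (p x))\<^sup>2)"
  proof (rule Bochner_Integration.integral_cong)
    show "(cmod (u x - p x))\<^sup>2 = ((cmod (u x))\<^sup>2 - 2 * Re (w x)) + (cmod (p x))\<^sup>2" for x
      unfolding w_def by (simp only: cmod_power2) (simp add: power2_eq_square algebra_simps)
  qed simp
  also have "\<dots> = (\<ointegral>x. (cmod (u x))\<^sup>2) - 2 * Re (\<ointegral>x. w x) + (\<ointegral>x. (cmod (p x))\<^sup>2)"
    using L2_norm_sq_integrable[OF u] L2_norm_sq_integrable[OF p] w by simp
  also have "\<dots> = (\<ointegral>x. (cmod (u x))\<^sup>2) - (\<Sum>n<N. (cmod (c n))\<^sup>2)"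
    unfolding w_def up pp by simp
  finally show ?thesis by (simp add: c_def)
qed

text \<open>Membership in the Hardy space in terms of a sequence of Taylor coefficients; the last clause is the
  convention that functions vanish off the disc.\<close>
definition hardy_coeffs :: "(complex \<Rightarrow> complex) \<Rightarrow> (nat \<Rightarrow> complex) \<Rightarrow> bool" where
  "hardy_coeffs f c \<longleftrightarrow> summable (\<lambda>n. (cmod (c n))\<^sup>2) \<and>
     (\<forall>z. cmod z < 1 \<longrightarrow> (\<lambda>n. c n * z ^ n) sums f z) \<and> (\<forall>z. 1 \<le> cmod z \<longrightarrow> f z = 0)"

lemma hardy_coeffs_summable_norm:
  assumes "summable (\<lambda>n. (cmod (c n))\<^sup>2)" "0 \<le> r" "r < 1"
  shows "summable (\<lambda>n. cmod (c n) * r ^ n)"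
proof (rule summable_comparison_test'[where N = 0])
  have "summable (\<lambda>n. (r\<^sup>2) ^ n)" using assms by (intro summable_geometric) (simp add: abs_square_less_1)
  then show "summable (\<lambda>n. (cmod (c n))\<^sup>2 + (r\<^sup>2) ^ n)" by (intro summable_add assms(1))
  fix n
  have "0 \<le> cmod (c n) * r ^ n" using assms by simp
  then have "cmod (c n) * r ^ n \<le> (cmod (c n))\<^sup>2 + (r ^ n)\<^sup>2"
    using sum_squares_bound[of "cmod (c n)" "r ^ n"] by linarith
  then show "norm (cmod (c n) * r ^ n) \<le> (cmod (c n))\<^sup>2 + (r\<^sup>2) ^ n"
    using assms by (simp add: power_mult[symmetric] mult.commute)
qed

lemma hardy_coeffs_analytic:
  assumes "hardy_coeffs f c"
  shows "f \<in> analytic_disc"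
proof -
  have s: "(\<lambda>n. c n * (z - 0) ^ n) sums f z" if "z \<in> ball 0 1" for z
    using assms that by (simp add: hardy_coeffs_def)
  have "f holomorphic_on ball 0 1" by (rule power_series_holomorphic[OF s])
  then show ?thesis using assms by (simp add: hardy_coeffs_def analytic_disc_def)
qed

lemma hardy_coeffs_imp_hardy_space:
  assumes f: "hardy_coeffs f c"
  shows "f \<in> hardy_space"
proof -
  have c: "summable (\<lambda>n. (cmod (c n))\<^sup>2)" and fz: "\<And>z. cmod z < 1 \<Longrightarrow> (\<lambda>n. c n * z ^ n) sums f z"
    using f by (auto simp: hardy_coeffs_def)
  note fa = hardy_coeffs_analytic[OF f]
  then have [measurable]: "f \<in> borel_measurable borel" by (rule analytic_disc_measurable)
  have "(\<ointegral>x. (cmod (f (of_real r * x)))\<^sup>2) \<le> (\<Sum>n. (cmod (c n))\<^sup>2)" if r: "0 \<le> r" "r < 1" for r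
  proof (rule LIMSEQ_le_const2)
    define B where "B = (\<Sum>n. cmod (c n) * r ^ n)"
    have sB: "summable (\<lambda>n. cmod (c n) * r ^ n)" by (rule hardy_coeffs_summable_norm[OF c r])
    show "(\<lambda>N. \<ointegral>x. (cmod (\<Sum>n<N. c n * (of_real r * x) ^ n))\<^sup>2) \<longlonglongrightarrow> (\<ointegral>x. (cmod (f (of_real r * x)))\<^sup>2)"
    proof (rule integral_dominated_convergence[where w = "\<lambda>_. B\<^sup>2"])
      show "AE x in circle_measure. (\<lambda>N. (cmod (\<Sum>n<N. c n * (of_real r * x) ^ n))\<^sup>2) \<longlonglongrightarrow> (cmod (f (of_real r * x)))\<^sup>2"
        using AE_circle_on
      proof eventually_elim
        case (elim x)
        then have "cmod (of_real r * x) < 1" using r by (simp add: norm_mult)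
        from fz[OF this] show ?case unfolding sums_def by (intro tendsto_intros)
      qed
      show "AE x in circle_measure. norm ((cmod (\<Sum>n<N. c n * (of_real r * x) ^ n))\<^sup>2) \<le> B\<^sup>2" for N
        using AE_circle_on
      proof eventually_elim
        case (elim x)
        have "cmod (\<Sum>n<N. c n * (of_real r * x) ^ n) \<le> (\<Sum>n<N. cmod (c n) * r ^ n)"
          using elim r by (intro order_trans[OF norm_sum] sum_mono) (simp add: norm_mult norm_power)
        also have "\<dots> \<le> B" unfolding B_def by (intro sum_le_suminf sB) (use r in auto)
        finally show ?case by (simp add: power_mono)
      qed
    qed auto
    have "(\<ointegral>x. (cmod (\<Sum>n<N. c n * (of_real r * x) ^ n))\<^sup>2) \<le> (\<Sum>n. (cmod (c n))\<^sup>2)" for N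
    proof -
      have "(\<ointegral>x. (cmod (\<Sum>n<N. c n * (of_real r * x) ^ n))\<^sup>2) = (\<Sum>n<N. (cmod (c n * of_real r ^ n))\<^sup>2)"
        by (subst parseval_poly[symmetric]) (simp_all add: power_mult_distrib mult.assoc)
      also have "\<dots> \<le> (\<Sum>n<N. (cmod (c n))\<^sup>2)"
        using r by (intro sum_mono power_mono) (auto simp: norm_mult norm_power mult_left_le power_le_one)
      also have "\<dots> \<le> (\<Sum>n. (cmod (c n))\<^sup>2)" by (intro sum_le_suminf c) auto
      finally show ?thesis .
    qed
    then show "\<exists>N. \<forall>n\<ge>N. (\<ointegral>x. (cmod (\<Sum>n<n. c n * (of_real r * x) ^ n))\<^sup>2) \<le> (\<Sum>n. (cmod (c n))\<^sup>2)"
      by blast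
  qed
  then have "bdd_above ((\<lambda>r::real. \<ointegral>x. (cmod (f (of_real r * x)))\<^sup>2) ` {0..<1})"
    by (intro bdd_aboveI[of _ "\<Sum>n. (cmod (c n))\<^sup>2"]) auto
  then show ?thesis using fa by (simp add: hardy_space_def)
qed

text \<open>By Bessel's inequality on the circle of radius \<open>r\<close>, the sums of the squares of \<open>c n * r ^ n\<close> are bounded
  independently of \<open>r\<close>; then \<open>r\<close> tends to 1 in each finite sum.\<close>
lemma hardy_space_imp_coeffs:
  assumes f: "f \<in> hardy_space"
  obtains c where "hardy_coeffs f c"
proof -
  have fa: "f \<in> analytic_disc" and hol: "f holomorphic_on ball 0 1" and f0: "\<And>z. 1 \<le> cmod z \<Longrightarrow> f z = 0"
    using f by (auto simp: hardy_space_def analytic_disc_def)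
  then have [measurable]: "f \<in> borel_measurable borel" by (simp add: analytic_disc_measurable)
  obtain B where "\<forall>r\<in>{0..<1}. (\<ointegral>x. (cmod (f (of_real r * x)))\<^sup>2) \<le> B"
    using f unfolding hardy_space_def bdd_above_def by auto
  then have B: "\<And>r. 0 \<le> r \<Longrightarrow> r < 1 \<Longrightarrow> (\<ointegral>x. (cmod (f (of_real r * x)))\<^sup>2) \<le> B"
    by simp
  define c where "c = (\<lambda>n. (deriv ^^ n) f 0 / fact n)"
  have fz: "(\<lambda>n. c n * z ^ n) sums f z" if "cmod z < 1" for z
    using holomorphic_power_series[OF hol, of z] that by (simp add: c_def)
  have coeff: "(\<ointegral>x. f (of_real r * x) * cnj (x ^ n)) = c n * of_real r ^ n" if r: "0 \<le> r" "r < 1" for r n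
  proof -
    define d where "d = (\<lambda>n. c n * of_real r ^ n)"
    have fd: "(\<lambda>n. d n * x ^ n) sums f (of_real r * x)" if "cmod x = 1" for x
      using fz[of "of_real r * x"] r that by (simp add: norm_mult d_def power_mult_distrib mult.assoc)
    have sB: "summable (\<lambda>n. cmod (d n))"
    proof -
      obtain r' where r': "r < r'" "r' < 1" using dense[OF r(2)] by blast
      have "summable (\<lambda>n. c n * of_real r' ^ n)" using fz[of "of_real r'"] r r' by (auto simp: sums_iff)
      from powser_insidea[OF this, of "of_real r"] show ?thesis
        using r r' by (simp add: d_def)
    qed
    define B where "B = (\<Sum>n. cmod (d n))"
    have "(\<lambda>N. \<ointegral>x. (\<Sum>k<N. d k * x ^ k) * cnj (x ^ n)) \<longlonglongrightarrow> (\<ointegral>x. f (of_real r * x) * cnj (x ^ n))"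
    proof (rule integral_dominated_convergence[where w = "\<lambda>_. B"])
      show "AE x in circle_measure. (\<lambda>N. (\<Sum>k<N. d k * x ^ k) * cnj (x ^ n)) \<longlonglongrightarrow> f (of_real r * x) * cnj (x ^ n)"
        using AE_circle_on by eventually_elim (intro tendsto_intros fd[unfolded sums_def])
      show "AE x in circle_measure. norm ((\<Sum>k<N. d k * x ^ k) * cnj (x ^ n)) \<le> B" for N
        using AE_circle_on
      proof eventually_elim
        case (elim x)
        have "norm ((\<Sum>k<N. d k * x ^ k) * cnj (x ^ n)) = cmod (\<Sum>k<N. d k * x ^ k)"
          using elim by (simp add: norm_mult norm_power)
        also have "\<dots> \<le> (\<Sum>k<N. cmod (d k))"
          using elim by (intro order_trans[OF norm_sum] sum_mono) (simp add: norm_mult norm_power)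
        also have "\<dots> \<le> B" unfolding B_def by (intro sum_le_suminf sB) auto
        finally show ?case .
      qed
    qed auto
    moreover have "\<forall>\<^sub>F N in sequentially. (\<ointegral>x. (\<Sum>k<N. d k * x ^ k) * cnj (x ^ n)) = d n"
      using eventually_gt_at_top[of n]
      by eventually_elim (simp only: integral_circle_poly_coeff[OF finite_lessThan] lessThan_iff if_True)
    ultimately have "(\<lambda>N. d n) \<longlonglongrightarrow> (\<ointegral>x. f (of_real r * x) * cnj (x ^ n))"
      by (rule Lim_transform_eventually)
    then show ?thesis unfolding d_def by (metis LIMSEQ_const_iff)
  qed
  have partial: "(\<Sum>n<N. (cmod (c n))\<^sup>2) \<le> B" for N
  proof (rule tendsto_upperbound)
    show "((\<lambda>r. \<Sum>n<N. (cmod (c n * of_real r ^ n))\<^sup>2) \<longlongrightarrow> (\<Sum>n<N. (cmod (c n))\<^sup>2)) (at_left (1::real))"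
      by (auto intro!: tendsto_eq_intros)
    show "\<forall>\<^sub>F r in at_left (1::real). (\<Sum>n<N. (cmod (c n * of_real r ^ n))\<^sup>2) \<le> B"
      using eventually_at_left_real[OF zero_less_one]
    proof eventually_elim
      case (elim r)
      then have r: "0 \<le> r" "r < 1" by auto
      have "L2 (\<lambda>x. f (of_real r * x))"
      proof (rule L2_continuous)
        show "continuous_on (sphere 0 1) (\<lambda>x. f (of_real r * x))"
          by (rule continuous_on_compose2[OF holomorphic_on_imp_continuous_on[OF hol]])
             (use r in \<open>auto intro!: continuous_intros simp: norm_mult\<close>)
      qed measurable
      from bessel_circle[OF this, of N] B[OF r] show ?case by (simp only: coeff[OF r])
    qed
  qed simp
  have "summable (\<lambda>n. (cmod (c n))\<^sup>2)"
    by (rule summableI_nonneg_bounded[OF _ partial]) simp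
  then have "hardy_coeffs f c" using fz f0 by (simp add: hardy_coeffs_def)
  then show ?thesis by (rule that)
qed

lemma bounded_analytic_hardy_space:
  assumes f: "f \<in> analytic_disc" and B: "\<And>z. cmod z < 1 \<Longrightarrow> cmod (f z) \<le> B"
  shows "f \<in> hardy_space"
proof -
  have [measurable]: "f \<in> borel_measurable borel" by (rule analytic_disc_measurable[OF f])
  have "(\<ointegral>x. (cmod (f (of_real r * x)))\<^sup>2) \<le> B\<^sup>2" if r: "0 \<le> r" "r < 1" for r
  proof -
    have ae: "AE x in circle_measure. (cmod (f (of_real r * x)))\<^sup>2 \<le> B\<^sup>2"
      using AE_circle_on by eventually_elim (use r in \<open>auto intro!: power_mono B simp: norm_mult\<close>)
    have "(\<ointegral>x. (cmod (f (of_real r * x)))\<^sup>2) \<le> (\<ointegral>x. B\<^sup>2)"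
      by (rule integral_mono_AE[OF _ _ ae], rule integrable_circle_bounded[of _ "B\<^sup>2"]) (use ae in auto)
    then show ?thesis by simp
  qed
  then have "bdd_above ((\<lambda>r::real. \<ointegral>x. (cmod (f (of_real r * x)))\<^sup>2) ` {0..<1})"
    by (intro bdd_aboveI[of _ "B\<^sup>2"]) auto
  then show ?thesis using f by (simp add: hardy_space_def)
qed

section \<open>Boundary values and the projection onto the Hardy space\<close>

lemma hardy_boundary_value:
  assumes f: "hardy_coeffs f c"
  shows L2_boundary_value: "L2 (boundary_value f)"
    and boundary_value_L2_bound:
      "(\<ointegral>x. (cmod ((\<Sum>n<N. c n * x ^ n) - boundary_value f x))\<^sup>2) \<le> (\<Sum>n. (cmod (c (n + N)))\<^sup>2)"
    and AE_tendsto_boundary_value: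
      "AE x in circle_measure. radial_limit f x (boundary_value f x)"
proof -
  have c: "summable (\<lambda>n. (cmod (c n))\<^sup>2)" and fz: "\<And>z. cmod z < 1 \<Longrightarrow> (\<lambda>n. c n * z ^ n) sums f z"
    using f by (auto simp: hardy_coeffs_def)
  obtain g where g: "L2 g"
    and gN: "\<And>N. (\<ointegral>x. (cmod (g x - (\<Sum>n<N. c n * x ^ n)))\<^sup>2) \<le> (\<Sum>n. (cmod (c (n + N)))\<^sup>2)"
    and g_lim: "AE x in circle_measure. ((\<lambda>r. \<Sum>n. c n * (of_real r * x) ^ n) \<longlongrightarrow> g x) (at_left 1)"
    using fatou_radial_limit[OF c] by blast
  have lim: "AE x in circle_measure. radial_limit f x (g x)"
    using g_lim AE_circle_on
  proof eventually_elim
    case (elim x)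
    show ?case
    proof (rule Lim_transform_eventually[OF elim(1)])
      show "\<forall>\<^sub>F r in at_left 1. (\<Sum>n. c n * (of_real r * x) ^ n) = f (of_real r * x)"
        using eventually_at_left_real[OF zero_less_one]
      proof eventually_elim
        case (elim r)
        then show ?case using \<open>cmod x = 1\<close> by (intro sums_unique[symmetric] fz) (simp add: norm_mult)
      qed
    qed
  qed
  have eq: "AE x in circle_measure. boundary_value f x = g x"
    using lim by eventually_elim (rule boundary_value_eqI)
  show "AE x in circle_measure. radial_limit f x (boundary_value f x)"
    using lim eq by eventually_elim simp
  have [measurable]: "boundary_value f \<in> borel_measurable borel" "g \<in> borel_measurable borel"
    by (rule borel_measurable_boundary_value[OF hardy_coeffs_analytic[OF f]])
       (rule L2_measurable[OF g])
  have "integrable circle_measure (\<lambda>x. (cmod (boundary_value f x))\<^sup>2) \<longleftrightarrow> integrable circle_measure (\<lambda>x. (cmod (g x))\<^sup>2)"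
    by (rule integrable_cong_AE) (use eq in \<open>auto elim: eventually_mono\<close>)
  then show "L2 (boundary_value f)"
    using g by (simp add: L2_def)
  have "(\<ointegral>x. (cmod ((\<Sum>n<N. c n * x ^ n) - boundary_value f x))\<^sup>2) = (\<ointegral>x. (cmod (g x - (\<Sum>n<N. c n * x ^ n)))\<^sup>2)"
    by (rule integral_cong_AE) (use eq in \<open>auto simp: norm_minus_commute elim!: eventually_mono\<close>)
  then show "(\<ointegral>x. (cmod ((\<Sum>n<N. c n * x ^ n) - boundary_value f x))\<^sup>2) \<le> (\<Sum>n. (cmod (c (n + N)))\<^sup>2)"
    using gN by simp
qed

lemma tendsto_integral_partial_sums:
  assumes f: "hardy_coeffs f c" and v: "L2 v"
  shows "(\<lambda>N. \<ointegral>x. (\<Sum>n<N. c n * x ^ n) * v x) \<longlonglongrightarrow> (\<ointegral>x. boundary_value f x * v x)"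
proof (rule tendsto_integral_mult_L2[OF L2_poly L2_boundary_value[OF f] v])
  have c: "summable (\<lambda>n. (cmod (c n))\<^sup>2)" using f by (auto simp: hardy_coeffs_def)
  show "(\<lambda>N. \<ointegral>x. (cmod ((\<Sum>n<N. c n * x ^ n) - boundary_value f x))\<^sup>2) \<longlonglongrightarrow> 0"
  proof (rule tendsto_sandwich[OF _ _ tendsto_const suminf_exist_split2[OF c]])
    show "\<forall>\<^sub>F N in sequentially. (\<ointegral>x. (cmod ((\<Sum>n<N. c n * x ^ n) - boundary_value f x))\<^sup>2) \<le> (\<Sum>n. (cmod (c (n + N)))\<^sup>2)"
      using boundary_value_L2_bound[OF f] by simp
  qed (auto intro!: always_eventually integral_nonneg_AE)
qed

lemma integral_boundary_value_coeff:
  assumes f: "hardy_coeffs f c"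
  shows "(\<ointegral>x. boundary_value f x * cnj (x ^ n)) = c n"
proof (rule LIMSEQ_unique[symmetric])
  show "(\<lambda>N. \<ointegral>x. (\<Sum>n<N. c n * x ^ n) * cnj (x ^ n)) \<longlonglongrightarrow> (\<ointegral>x. boundary_value f x * cnj (x ^ n))"
    by (rule tendsto_integral_partial_sums[OF f L2_cnj[OF L2_power]])
  have "\<forall>\<^sub>F N in sequentially. c n = (\<ointegral>x. (\<Sum>k<N. c k * x ^ k) * cnj (x ^ n))"
    using eventually_gt_at_top[of n]
    by eventually_elim (simp only: integral_circle_poly_coeff[OF finite_lessThan] lessThan_iff if_True)
  then show "(\<lambda>N. \<ointegral>x. (\<Sum>n<N. c n * x ^ n) * cnj (x ^ n)) \<longlonglongrightarrow> c n"
    by (rule Lim_transform_eventually[OF tendsto_const])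
qed

lemma L2_szego_cnj:
  assumes "cmod z < 1"
  shows "L2 (\<lambda>x. 1 / (1 - z * cnj x))"
proof (rule L2_continuous)
  show "continuous_on (sphere 0 1) (\<lambda>x. 1 / (1 - z * cnj x))"
    by (intro continuous_intros) (use one_minus_disc_circle_ne_0[OF assms, of "cnj _"] in auto)
qed measurable

text \<open>The geometric series for the Cauchy kernel converges in mean square on the circle, so it may be
  integrated against \<open>u\<close> term by term.\<close>
lemma cauchy_transform_sums:
  assumes u: "L2 u" and z: "cmod z < 1"
  shows "(\<lambda>n. (\<ointegral>x. u x * cnj (x ^ n)) * z ^ n) sums (\<ointegral>x. u x / (1 - z * cnj x))"
proof -
  let ?s = "\<lambda>N x. \<Sum>n<N. z ^ n * cnj (x ^ n)"
  have nc: "L2 (\<lambda>x. cnj (x ^ n))" for n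
    by (rule L2_cnj[OF L2_power])
  have s_sq: "L2 (?s N)" for N
    by (intro L2_continuous borel_measurable_continuous_onI continuous_intros)
  have "(\<lambda>N. \<ointegral>x. ?s N x * u x) \<longlonglongrightarrow> (\<ointegral>x. 1 / (1 - z * cnj x) * u x)"
  proof (rule tendsto_integral_mult_L2[OF s_sq L2_szego_cnj[OF z] u])
    define K where "K = (\<lambda>N. ((cmod z) ^ N / (1 - cmod z))\<^sup>2)"
    have "(\<lambda>N. (cmod z ^ N / (1 - cmod z))\<^sup>2) \<longlonglongrightarrow> (0 / (1 - cmod z))\<^sup>2"
      using z by (intro tendsto_intros LIMSEQ_power_zero) auto
    then have K: "K \<longlonglongrightarrow> 0" by (simp add: K_def)
    show "(\<lambda>N. \<ointegral>x. (cmod (?s N x - 1 / (1 - z * cnj x)))\<^sup>2) \<longlonglongrightarrow> 0"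
    proof (rule tendsto_sandwich[OF _ _ tendsto_const K])
      show "\<forall>\<^sub>F N in sequentially. (\<ointegral>x. (cmod (?s N x - 1 / (1 - z * cnj x)))\<^sup>2) \<le> K N"
      proof (intro always_eventually allI)
        fix N
        have "(\<ointegral>x. (cmod (?s N x - 1 / (1 - z * cnj x)))\<^sup>2) \<le> (\<ointegral>x. K N)"
        proof (rule integral_circle_mono_on)
          show "integrable circle_measure (\<lambda>x. (cmod (?s N x - 1 / (1 - z * cnj x)))\<^sup>2)"
            by (intro L2_norm_sq_integrable L2_diff s_sq L2_szego_cnj z)
          fix x :: complex assume x: "cmod x = 1"
          define w where "w = z * cnj x"
          have nw: "cmod w = cmod z" using x by (simp add: w_def norm_mult)
          then have w1: "w \<noteq> 1" using z by auto
          have "?s N x = (\<Sum>n<N. w ^ n)" by (simp add: w_def power_mult_distrib)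
          also have "\<dots> = (1 - w ^ N) / (1 - w)" using w1 by (simp add: sum_gp_strict)
          finally have "?s N x - 1 / (1 - z * cnj x) = - (w ^ N / (1 - w))"
            by (simp add: w_def[symmetric] diff_divide_distrib)
          then have "cmod (?s N x - 1 / (1 - z * cnj x)) = cmod z ^ N / cmod (1 - w)"
            by (simp add: norm_divide norm_power nw)
          also have "\<dots> \<le> cmod z ^ N / (1 - cmod z)"
          proof (rule divide_left_mono)
            show "1 - cmod z \<le> cmod (1 - w)" using norm_triangle_ineq2[of 1 w] nw by simp
            then show "0 < cmod (1 - w) * (1 - cmod z)" using z by (intro mult_pos_pos) linarith+
          qed simp
          finally show "(cmod (?s N x - 1 / (1 - z * cnj x)))\<^sup>2 \<le> K N"
            unfolding K_def by (rule power_mono) simp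
        qed simp
        then show "(\<ointegral>x. (cmod (?s N x - 1 / (1 - z * cnj x)))\<^sup>2) \<le> K N" by simp
      qed
    qed (auto intro!: always_eventually integral_nonneg_AE)
  qed
  moreover have "(\<ointegral>x. ?s N x * u x) = (\<Sum>n<N. (\<ointegral>x. u x * cnj (x ^ n)) * z ^ n)" for N
  proof -
    have "(\<ointegral>x. ?s N x * u x) = (\<ointegral>x. (\<Sum>n<N. (u x * cnj (x ^ n)) * z ^ n))"
      by (rule Bochner_Integration.integral_cong) (simp_all add: sum_distrib_left mult_ac)
    also have "\<dots> = (\<Sum>n<N. \<ointegral>x. (u x * cnj (x ^ n)) * z ^ n)"
      by (rule Bochner_Integration.integral_sum) (intro integrable_mult_left integrable_circle_mult u nc)
    also have "\<dots> = (\<Sum>n<N. (\<ointegral>x. u x * cnj (x ^ n)) * z ^ n)"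
      by (intro sum.cong refl Bochner_Integration.integral_mult_left) (intro integrable_circle_mult u nc)
    finally show ?thesis .
  qed
  ultimately show ?thesis by (simp add: sums_def)
qed

lemma hardy_cauchy_formula:
  assumes f: "hardy_coeffs f c" and z: "cmod z < 1"
  shows "f z = (\<ointegral>x. boundary_value f x / (1 - z * cnj x))"
proof (rule sums_unique2)
  show "(\<lambda>n. c n * z ^ n) sums f z" using f z by (simp add: hardy_coeffs_def)
  show "(\<lambda>n. c n * z ^ n) sums (\<ointegral>x. boundary_value f x / (1 - z * cnj x))"
    using cauchy_transform_sums[OF L2_boundary_value[OF f] z]
    by (simp only: integral_boundary_value_coeff[OF f])
qed

lemma hardy_zero_boundary_value:
  assumes f: "hardy_coeffs f c" and 0: "AE x in circle_measure. boundary_value f x = 0"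
  shows "f = (\<lambda>_. 0)"
proof
  fix z
  show "f z = 0"
  proof (cases "cmod z < 1")
    case True
    have "f z = (\<ointegral>x. boundary_value f x / (1 - z * cnj x))"
      by (rule hardy_cauchy_formula[OF f True])
    also have "\<dots> = 0"
      by (rule integral_eq_zero_AE) (use 0 in \<open>eventually_elim, simp\<close>)
    finally show ?thesis .
  qed (use f in \<open>simp add: hardy_coeffs_def\<close>)
qed

text \<open>The Cauchy integral of \<open>u\<close>; it keeps the Fourier coefficients of non-negative index, so it is
  the orthogonal projection of \<open>u\<close> onto the Hardy space.\<close>
definition cauchy_transform :: "(complex \<Rightarrow> complex) \<Rightarrow> complex \<Rightarrow> complex" where
  "cauchy_transform u z = (if cmod z < 1 then (\<ointegral>x. u x / (1 - z * cnj x)) else 0)"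

lemma hardy_coeffs_cauchy_transform:
  assumes u: "L2 u"
  shows "hardy_coeffs (cauchy_transform u) (\<lambda>n. \<ointegral>x. u x * cnj (x ^ n))"
  unfolding hardy_coeffs_def
proof (intro conjI allI impI)
  show "summable (\<lambda>n. (cmod (\<ointegral>x. u x * cnj (x ^ n)))\<^sup>2)"
    by (rule summableI_nonneg_bounded[OF _ bessel_circle[OF u]]) simp
  show "(\<lambda>n. (\<ointegral>x. u x * cnj (x ^ n)) * z ^ n) sums cauchy_transform u z" if "cmod z < 1" for z
    using cauchy_transform_sums[OF u that] that by (simp only: cauchy_transform_def if_True)
qed (simp add: cauchy_transform_def)

lemma hardy_coeffs_diff:
  assumes f: "hardy_coeffs f c" and h: "hardy_coeffs h d"
  shows "hardy_coeffs (\<lambda>z. f z - h z) (\<lambda>n. c n - d n)"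
  unfolding hardy_coeffs_def
proof (intro conjI allI impI)
  show "summable (\<lambda>n. (cmod (c n - d n))\<^sup>2)"
  proof (rule summable_comparison_test'[where N = 0])
    show "summable (\<lambda>n. 2 * (cmod (c n))\<^sup>2 + 2 * (cmod (d n))\<^sup>2)"
      using f h by (intro summable_add summable_mult) (auto simp: hardy_coeffs_def)
    fix n
    have "(cmod (c n - d n))\<^sup>2 \<le> (cmod (c n) + cmod (d n))\<^sup>2"
      by (intro power_mono norm_triangle_ineq4) auto
    then show "norm ((cmod (c n - d n))\<^sup>2) \<le> 2 * (cmod (c n))\<^sup>2 + 2 * (cmod (d n))\<^sup>2"
      using sum_squares_bound[of "cmod (c n)" "cmod (d n)"] by (simp add: power2_sum)
  qed
  show "(\<lambda>n. (c n - d n) * z ^ n) sums (f z - h z)" if "cmod z < 1" for z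
    using f h that unfolding hardy_coeffs_def left_diff_distrib by (intro sums_diff) auto
qed (use f h in \<open>simp add: hardy_coeffs_def\<close>)

text \<open>The predicate under the definite description in \<open>hardy_projection\<close>.\<close>
definition is_hardy_projection :: "(complex \<Rightarrow> complex) \<Rightarrow> (complex \<Rightarrow> complex) \<Rightarrow> bool" where
  "is_hardy_projection g f \<longleftrightarrow> f \<in> hardy_space \<and>
        (\<forall>h\<in>hardy_space.
           (\<ointegral>x. (g x - boundary_value f x) * cnj (boundary_value h x)) = 0)"

lemma is_hardy_projection_cauchy_transform:
  assumes u: "L2 u"
  shows "is_hardy_projection u (cauchy_transform u)"
  unfolding is_hardy_projection_def
proof (intro conjI ballI)
  let ?F = "cauchy_transform u"
  note F = hardy_coeffs_cauchy_transform[OF u]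
  show "?F \<in> hardy_space" by (rule hardy_coeffs_imp_hardy_space[OF F])
  have F_sq: "L2 (boundary_value ?F)" by (rule L2_boundary_value[OF F])
  define v where "v = (\<lambda>x. u x - boundary_value ?F x)"
  have v: "L2 v" unfolding v_def by (rule L2_diff[OF u F_sq])
  have nc: "L2 (\<lambda>x. cnj (x ^ n))" for n
    by (rule L2_cnj[OF L2_power])
  have orth: "(\<ointegral>x. v x * cnj (x ^ n)) = 0" for n
  proof -
    have "(\<ointegral>x. v x * cnj (x ^ n)) = (\<ointegral>x. u x * cnj (x ^ n) - boundary_value ?F x * cnj (x ^ n))"
      unfolding v_def left_diff_distrib ..
    also have "\<dots> = (\<ointegral>x. u x * cnj (x ^ n)) - (\<ointegral>x. boundary_value ?F x * cnj (x ^ n))"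
      by (intro Bochner_Integration.integral_diff integrable_circle_mult u F_sq nc)
    also have "\<dots> = 0"
      by (simp only: integral_boundary_value_coeff[OF F] diff_self)
    finally show ?thesis .
  qed
  fix h assume "h \<in> hardy_space"
  then obtain d where h: "hardy_coeffs h d" using hardy_space_imp_coeffs by blast
  have vc: "L2 (\<lambda>x. cnj (v x))" by (rule L2_cnj[OF v])
  have "(\<ointegral>x. (\<Sum>n<N. d n * x ^ n) * cnj (v x)) = 0" for N
  proof -
    have "(\<ointegral>x. (\<Sum>n<N. d n * x ^ n) * cnj (v x)) = (\<ointegral>x. (\<Sum>n<N. d n * cnj (v x * cnj (x ^ n))))"
      by (rule Bochner_Integration.integral_cong) (simp_all add: sum_distrib_left mult_ac)
    also have "\<dots> = (\<Sum>n<N. \<ointegral>x. d n * cnj (v x * cnj (x ^ n)))"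
      by (rule Bochner_Integration.integral_sum) (intro integrable_mult_right integrable_cnj integrable_circle_mult v nc)
    also have "\<dots> = (\<Sum>n<N. d n * (\<ointegral>x. cnj (v x * cnj (x ^ n))))"
      by (intro sum.cong refl Bochner_Integration.integral_mult_right integrable_cnj integrable_circle_mult v nc)
    also have "\<dots> = 0"
      by (simp only: Bochner_Integration.integral_cnj orth) simp
    finally show ?thesis .
  qed
  with tendsto_integral_partial_sums[OF h vc]
  have "(\<ointegral>x. boundary_value h x * cnj (v x)) = 0"
    by (simp add: LIMSEQ_const_iff)
  moreover have "(\<ointegral>x. v x * cnj (boundary_value h x)) = cnj (\<ointegral>x. boundary_value h x * cnj (v x))"
    unfolding Bochner_Integration.integral_cnj[symmetric]
    by (rule Bochner_Integration.integral_cong) (simp_all add: mult.commute)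
  ultimately show "(\<ointegral>x. (u x - boundary_value ?F x) * cnj (boundary_value h x)) = 0"
    by (simp add: v_def)
qed

text \<open>The difference of two candidates lies in the Hardy space and is orthogonal to itself, so its
  boundary values vanish, and by Cauchy's formula so does the difference.\<close>
lemma is_hardy_projection_unique:
  assumes u: "L2 u" and f: "is_hardy_projection u f" and h: "is_hardy_projection u h"
  shows "f = h"
proof -
  obtain c where c: "hardy_coeffs f c" using f hardy_space_imp_coeffs by (auto simp: is_hardy_projection_def)
  obtain d where d: "hardy_coeffs h d" using h hardy_space_imp_coeffs by (auto simp: is_hardy_projection_def)
  define k where "k = (\<lambda>z. f z - h z)"
  have k: "hardy_coeffs k (\<lambda>n. c n - d n)" unfolding k_def by (rule hardy_coeffs_diff[OF c d])
  let ?F = "boundary_value f" and ?H = "boundary_value h" and ?K = "boundary_value k"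
  have sq: "L2 ?F" "L2 ?H" "L2 ?K"
    using c d k by (auto intro: L2_boundary_value)
  note [measurable] = sq[THEN L2_measurable]
  have bk: "AE x in circle_measure. ?K x = ?F x - ?H x"
    using AE_tendsto_boundary_value[OF c] AE_tendsto_boundary_value[OF d]
    by eventually_elim (auto intro!: boundary_value_eqI tendsto_diff simp: k_def)
  have kc: "L2 (\<lambda>x. cnj (?K x))" by (rule L2_cnj[OF sq(3)])
  have ks: "k \<in> hardy_space" by (rule hardy_coeffs_imp_hardy_space[OF k])
  have "(\<ointegral>x. (u x - ?F x) * cnj (?K x)) = 0" "(\<ointegral>x. (u x - ?H x) * cnj (?K x)) = 0"
    using f h ks by (auto simp: is_hardy_projection_def)
  then have "0 = (\<ointegral>x. (u x - ?H x) * cnj (?K x) - (u x - ?F x) * cnj (?K x))"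
    by (subst Bochner_Integration.integral_diff) (auto intro!: integrable_circle_mult L2_diff u sq kc)
  also have "\<dots> = (\<ointegral>x. of_real ((cmod (?K x))\<^sup>2))"
  proof (rule integral_cong_AE)
    show "AE x in circle_measure. (u x - ?H x) * cnj (?K x) - (u x - ?F x) * cnj (?K x) = of_real ((cmod (?K x))\<^sup>2)"
      using bk
    proof eventually_elim
      case (elim x)
      have "(u x - ?H x) * cnj (?K x) - (u x - ?F x) * cnj (?K x) = (?F x - ?H x) * cnj (?K x)"
        by (simp add: algebra_simps)
      then show ?case using elim by (simp only: complex_norm_square)
    qed
  qed (use L2_measurable[OF u] in measurable)
  finally have "0 = complex_of_real (\<ointegral>x. (cmod (?K x))\<^sup>2)"
    by (simp only: integral_complex_of_real)
  then have "(\<ointegral>x. (cmod (?K x))\<^sup>2) = 0"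
    by (metis of_real_eq_0_iff)
  then have "AE x in circle_measure. (cmod (?K x))\<^sup>2 = 0"
    by (subst (asm) integral_nonneg_eq_0_iff_AE) (auto intro: L2_norm_sq_integrable sq)
  then have "AE x in circle_measure. ?K x = 0" by simp
  from hardy_zero_boundary_value[OF k this] show "f = h" by (simp add: k_def fun_eq_iff)
qed

lemma hardy_projection_eq_cauchy_transform:
  assumes u: "L2 u"
  shows "hardy_projection u = cauchy_transform u"
  unfolding hardy_projection_def is_hardy_projection_def[symmetric]
proof (rule the_equality)
  show "is_hardy_projection u (cauchy_transform u)" by (rule is_hardy_projection_cauchy_transform[OF u])
  then show "f = cauchy_transform u" if "is_hardy_projection u f" for f
    by (rule is_hardy_projection_unique[OF u that])
qed

text \<open>Point evaluation at \<open>z\<close> has norm \<open>1 / sqrt (1 - r\<^sup>2)\<close> on the Hardy space for \<open>cmod z = r\<close>. A function differs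
  from a polynomial, which is bounded, by a function of small norm, so it grows more slowly than that.\<close>
lemma hardy_growth:
  assumes f: "hardy_coeffs f c" and z0: "cmod p = 1"
  shows "((\<lambda>r. cmod (f (of_real r * p)) * sqrt (1 - r\<^sup>2)) \<longlongrightarrow> 0) (at_left 1)"
proof (rule tendstoI)
  fix e :: real assume e: "0 < e"
  have c: "summable (\<lambda>n. (cmod (c n))\<^sup>2)" and fz: "\<And>z. cmod z < 1 \<Longrightarrow> (\<lambda>n. c n * z ^ n) sums f z"
    using f by (auto simp: hardy_coeffs_def)
  define t where "t = e / 2"
  have t: "0 < t" using e by (simp add: t_def)
  have "\<forall>\<^sub>F N in sequentially. (\<Sum>n. (cmod (c (n + N)))\<^sup>2) < t\<^sup>2"
    by (rule order_tendstoD(2)[OF suminf_exist_split2[OF c]]) (use t in simp)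
  then obtain N where N: "(\<Sum>n. (cmod (c (n + N)))\<^sup>2) < t\<^sup>2" by (auto simp: eventually_sequentially)
  define P where "P = (\<Sum>n<N. cmod (c n))"
  have "((\<lambda>r. P * sqrt (1 - r\<^sup>2)) \<longlongrightarrow> P * sqrt (1 - 1\<^sup>2)) (at_left (1::real))"
    by (intro tendsto_intros)
  then have "\<forall>\<^sub>F r in at_left (1::real). P * sqrt (1 - r\<^sup>2) < t"
    using t by (auto dest!: order_tendstoD(2)[where a = t])
  then show "\<forall>\<^sub>F r in at_left 1. dist (cmod (f (of_real r * p)) * sqrt (1 - r\<^sup>2)) 0 < e"
    using eventually_at_left_real[OF zero_less_one]
  proof eventually_elim
    case (elim r)
    then have r: "0 < r" "r < 1" by auto
    define z where "z = of_real r * p"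
    have nz: "cmod z = r" using r z0 by (simp add: z_def norm_mult)
    define q where "q = sqrt (1 - r\<^sup>2)"
    have r2: "r\<^sup>2 < 1" using r by (simp add: abs_square_less_1)
    then have q: "0 < q" and q2: "q\<^sup>2 = 1 - r\<^sup>2" by (auto simp: q_def)
    have cN: "summable (\<lambda>n. (cmod (c (n + N)))\<^sup>2)" using c by (subst summable_iff_shift)
    have geo: "(\<lambda>n. (r\<^sup>2) ^ n) sums (1 / (1 - r\<^sup>2))" by (rule geometric_sums) (use r2 in simp)
    have term_le: "norm (c (n + N) * z ^ (n + N)) \<le> (cmod (c (n + N)))\<^sup>2 / (2 * t * q) + t * q / 2 * (r\<^sup>2) ^ n" for n
    proof -
      define x where "x = cmod (c (n + N))"
      define y where "y = r ^ n"
      have "norm (c (n + N) * z ^ (n + N)) = x * (y * r ^ N)" by (simp add: norm_mult norm_power nz x_def y_def power_add)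
      also have "\<dots> \<le> x * y" using r by (intro mult_left_mono) (auto simp: x_def y_def mult_left_le power_le_one)
      also have "\<dots> \<le> x\<^sup>2 / (2 * t * q) + t * q / 2 * y\<^sup>2"
      proof -
        \<comment> \<open>The Cauchy-Schwarz inequality for the tail, with a weight chosen so that each sum is at most \<open>t / (2 * q)\<close>.\<close>
        have "0 \<le> (x - (t * q) * y)\<^sup>2" by simp
        then have "(x * y) * (2 * (t * q)) \<le> x\<^sup>2 + (t * q)\<^sup>2 * y\<^sup>2"
          by (simp add: power2_diff power_mult_distrib algebra_simps)
        then have "x * y \<le> (x\<^sup>2 + (t * q)\<^sup>2 * y\<^sup>2) / (2 * (t * q))"
          using t q by (simp add: pos_le_divide_eq)
        also have "\<dots> = x\<^sup>2 / (2 * t * q) + t * q / 2 * y\<^sup>2"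
          using t q by (simp add: add_divide_distrib power2_eq_square)
        finally show ?thesis .
      qed
      finally show ?thesis by (simp add: x_def y_def power_mult[symmetric] mult.commute)
    qed
    have sR: "summable (\<lambda>n. (cmod (c (n + N)))\<^sup>2 / (2 * t * q) + t * q / 2 * (r\<^sup>2) ^ n)"
      by (intro summable_add summable_divide summable_mult cN sums_summable[OF geo])
    have fzs: "(\<lambda>n. c n * z ^ n) sums f z" by (rule fz) (simp only: nz r)
    have "f z = (\<Sum>n. c (n + N) * z ^ (n + N)) + (\<Sum>n<N. c n * z ^ n)"
      unfolding sums_unique[OF fzs] by (rule suminf_split_initial_segment[OF sums_summable[OF fzs]])
    then have "cmod (f z) \<le> cmod (\<Sum>n. c (n + N) * z ^ (n + N)) + cmod (\<Sum>n<N. c n * z ^ n)"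
      by (simp add: norm_triangle_ineq)
    also have "cmod (\<Sum>n<N. c n * z ^ n) \<le> P"
      unfolding P_def using r by (intro order_trans[OF norm_sum] sum_mono) (simp add: norm_mult norm_power nz mult_left_le power_le_one)
    also have "cmod (\<Sum>n. c (n + N) * z ^ (n + N)) \<le> (\<Sum>n. (cmod (c (n + N)))\<^sup>2 / (2 * t * q) + t * q / 2 * (r\<^sup>2) ^ n)"
      by (rule norm_suminf_le[OF term_le sR])
    also have "\<dots> = (\<Sum>n. (cmod (c (n + N)))\<^sup>2) / (2 * t * q) + t * q / 2 * (1 / (1 - r\<^sup>2))"
      by (intro sums_unique[symmetric] sums_add sums_divide sums_mult geo summable_sums cN)
    also have "\<dots> \<le> t\<^sup>2 / (2 * t * q) + t * q / 2 * (1 / q\<^sup>2)"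
      using N t q by (intro add_mono divide_right_mono) (auto simp: q2)
    also have "\<dots> = t / q" using t q by (simp add: power2_eq_square)
    finally have "cmod (f z) \<le> t / q + P" by simp
    then have "cmod (f z) * q \<le> (t / q + P) * q" using q by (intro mult_right_mono) auto
    also have "\<dots> = t + P * q" using q by (simp add: distrib_right)
    also have "\<dots> < e" using elim(1) by (simp add: q_def t_def)
    finally show ?case using q by (simp add: z_def q_def)
  qed
qed

section \<open>Uniqueness from boundary zeros\<close>

lemma hardy_mult_bounded:
  assumes f: "f \<in> hardy_space" and h: "h \<in> analytic_disc" and M: "\<And>z. cmod z < 1 \<Longrightarrow> cmod (h z) \<le> M"
  shows "(\<lambda>z. f z * h z) \<in> hardy_space"
proof -
  have fa: "f \<in> analytic_disc" using f by (simp add: hardy_space_def)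
  have fh: "(\<lambda>z. f z * h z) \<in> analytic_disc"
    using fa h by (auto simp: analytic_disc_def intro: holomorphic_on_mult)
  have [measurable]: "f \<in> borel_measurable borel" "h \<in> borel_measurable borel"
    using fa h by (auto intro: analytic_disc_measurable)
  have cont: "continuous_on (sphere 0 1) (\<lambda>x. k (of_real r * x))"
    if k: "k \<in> analytic_disc" and r: "0 \<le> r" "r < 1" for k and r :: real
  proof -
    have "k holomorphic_on ball 0 1" using k by (simp add: analytic_disc_def)
    from holomorphic_on_imp_continuous_on[OF this] show ?thesis
      by (rule continuous_on_compose2) (use r in \<open>auto intro!: continuous_intros simp: norm_mult\<close>)
  qed
  obtain B where B: "\<forall>r\<in>{0..<1}. (\<ointegral>x. (cmod (f (of_real r * x)))\<^sup>2) \<le> B"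
    using f unfolding hardy_space_def bdd_above_def by auto
  have "(\<ointegral>x. (cmod (f (of_real r * x) * h (of_real r * x)))\<^sup>2) \<le> M\<^sup>2 * B" if r: "0 \<le> r" "r < 1" for r
  proof -
    have "(\<ointegral>x. (cmod (f (of_real r * x) * h (of_real r * x)))\<^sup>2) \<le> (\<ointegral>x. M\<^sup>2 * (cmod (f (of_real r * x)))\<^sup>2)"
    proof (rule integral_circle_mono_on)
      show "integrable circle_measure (\<lambda>x. (cmod (f (of_real r * x) * h (of_real r * x)))\<^sup>2)"
        by (intro integrable_circle_continuous continuous_intros cont fa h r) measurable
      show "integrable circle_measure (\<lambda>x. M\<^sup>2 * (cmod (f (of_real r * x)))\<^sup>2)"
        by (intro integrable_circle_continuous continuous_intros cont fa r) measurable
      fix x :: complex assume "cmod x = 1"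
      then have "cmod (h (of_real r * x)) \<le> M" using r by (intro M) (simp add: norm_mult)
      then have "(cmod (f (of_real r * x)))\<^sup>2 * (cmod (h (of_real r * x)))\<^sup>2 \<le> (cmod (f (of_real r * x)))\<^sup>2 * M\<^sup>2"
        by (intro mult_left_mono power_mono) auto
      then show "(cmod (f (of_real r * x) * h (of_real r * x)))\<^sup>2 \<le> M\<^sup>2 * (cmod (f (of_real r * x)))\<^sup>2"
        by (simp add: norm_mult power_mult_distrib mult.commute)
    qed
    also have "\<dots> = M\<^sup>2 * (\<ointegral>x. (cmod (f (of_real r * x)))\<^sup>2)" by simp
    also have "\<dots> \<le> M\<^sup>2 * B" using B r by (intro mult_left_mono) auto
    finally show ?thesis .
  qed
  then have "bdd_above ((\<lambda>r::real. \<ointegral>x. (cmod (f (of_real r * x) * h (of_real r * x)))\<^sup>2) ` {0..<1})"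
    by (intro bdd_aboveI[of _ "M\<^sup>2 * B"]) auto
  then show ?thesis using fh by (simp add: hardy_space_def)
qed

lemma tendsto_poisson_integral:
  fixes u :: "complex \<Rightarrow> real"
  assumes u [measurable]: "u \<in> borel_measurable borel" and c: "continuous_on (sphere 0 1) u"
    and z0: "cmod p = 1"
  shows "((\<lambda>r. \<ointegral>x. u x * poisson (of_real r * p) x) \<longlongrightarrow> u p) (at_left 1)"
proof -
  have "((\<lambda>r. \<ointegral>x. \<bar>u x - u p\<bar> * poisson (of_real r * p) x) \<longlongrightarrow> 0) (at_left 1)"
    by (rule tendsto_integral_poisson_0[OF _ _ z0]) (auto intro!: continuous_intros c)
  then have "((\<lambda>r. (\<ointegral>x. u x * poisson (of_real r * p) x) - u p) \<longlongrightarrow> 0) (at_left 1)"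
  proof (rule Lim_null_comparison[rotated])
    show "\<forall>\<^sub>F r in at_left 1. norm ((\<ointegral>x. u x * poisson (of_real r * p) x) - u p)
        \<le> (\<ointegral>x. \<bar>u x - u p\<bar> * poisson (of_real r * p) x)"
      using eventually_at_left_real[OF zero_less_one]
    proof eventually_elim
      case (elim r)
      let ?P = "poisson (of_real r * p)"
      have z: "cmod (of_real r * p) < 1" using elim z0 by (simp add: norm_mult)
      have i: "integrable circle_measure (\<lambda>x. u x * ?P x)"
        by (intro integrable_circle_continuous continuous_intros c continuous_poisson z) measurable
      have "(\<ointegral>x. u x * ?P x) - u p = (\<ointegral>x. u x * ?P x - u p * ?P x)"
        using i integrable_poisson[OF z] integral_poisson[OF z] by simp
      also have "\<dots> = (\<ointegral>x. (u x - u p) * ?P x)" by (simp add: left_diff_distrib)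
      also have "norm \<dots> \<le> (\<ointegral>x. norm ((u x - u p) * ?P x))" by (rule integral_norm_bound)
      also have "\<dots> = (\<ointegral>x. \<bar>u x - u p\<bar> * ?P x)"
        by (simp add: abs_mult poisson_nonneg[OF z])
      finally show ?case .
    qed
  qed
  then show ?thesis by (rule LIM_zero_cancel)
qed

text \<open>Let \<open>U\<close> be analytic with real part the Poisson integral of \<open>u\<close> and \<open>U 0\<close> real. The mean value property of
  \<open>f * exp U\<close>, an outer multiple of \<open>f\<close>, would give the claim if \<open>exp U\<close> had good boundary values. Dilating
  \<open>U\<close> by \<open>r\<close> makes it analytic across the circle, and the real parts converge to \<open>u\<close> as \<open>r\<close> tends to 1.\<close>
lemma outer_function_estimate:
  fixes u :: "complex \<Rightarrow> real"
  assumes f: "hardy_coeffs f c"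
    and g [measurable]: "g \<in> borel_measurable borel" and gc: "continuous_on (sphere 0 1) g"
    and fg: "AE x in circle_measure. boundary_value f x = g x"
    and u [measurable]: "u \<in> borel_measurable borel" and uc: "continuous_on (sphere 0 1) u"
  shows "cmod (f 0) * exp (\<ointegral>x. u x) \<le> (\<ointegral>x. cmod (g x) * exp (u x))"
proof -
  obtain G where G: "0 < G" "\<And>x. cmod x = 1 \<Longrightarrow> cmod (g x) \<le> G" using bounded_on_circle[OF gc] by blast
  obtain M where M: "0 < M" "\<And>x. cmod x = 1 \<Longrightarrow> norm (u x) \<le> M" using bounded_on_circle[OF uc] by blast
  define v where "v = (\<lambda>x. complex_of_real (u x))"
  have v_m [measurable]: "v \<in> borel_measurable borel" unfolding v_def by measurable
  have v: "L2 v"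
    unfolding v_def by (intro L2_continuous continuous_intros uc) measurable
  define I where "I = (\<ointegral>x. u x)"
  have Iv: "(\<ointegral>x. v x) = of_real I" by (simp add: v_def I_def)
  \<comment> \<open>The Herglotz integral of \<open>u\<close>, since \<open>(x + z) / (x - z) = 2 / (1 - z * cnj x) - 1\<close> on the circle.\<close>
  define U where "U = (\<lambda>z. 2 * cauchy_transform v z - of_real I)"
  have U_hol: "U holomorphic_on ball 0 1"
    unfolding U_def using hardy_coeffs_analytic[OF hardy_coeffs_cauchy_transform[OF v]]
    by (intro holomorphic_intros) (simp add: analytic_disc_def)
  have U0: "U 0 = of_real I" by (simp add: U_def cauchy_transform_def Iv)
  have ReU: "Re (U z) = (\<ointegral>x. u x * poisson z x)" if z: "cmod z < 1" for z
  proof -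
    have i: "integrable circle_measure (\<lambda>x. 1 / (1 - z * cnj x) * v x)"
      by (rule integrable_circle_mult[OF L2_szego_cnj[OF z] v])
    have iv: "integrable circle_measure v" by (rule L2_imp_integrable[OF v])
    have "U z = 2 * (\<ointegral>x. 1 / (1 - z * cnj x) * v x) - (\<ointegral>x. v x)"
      unfolding U_def Iv using z by (simp add: cauchy_transform_def)
    also have "\<dots> = (\<ointegral>x. 2 * (1 / (1 - z * cnj x) * v x) - v x)"
      by (subst Bochner_Integration.integral_diff[OF integrable_mult_right[OF i] iv])
         (simp only: Bochner_Integration.integral_mult_right[OF i])
    finally have "Re (U z) = (\<ointegral>x. Re (2 * (1 / (1 - z * cnj x) * v x) - v x))"
      by (simp only:) (rule integral_Re[symmetric], intro Bochner_Integration.integrable_diff integrable_mult_right i iv)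
    also have "\<dots> = (\<ointegral>x. u x * poisson z x)"
    proof (rule integral_cong_AE)
      show "AE x in circle_measure. Re (2 * (1 / (1 - z * cnj x) * v x) - v x) = u x * poisson z x"
        using AE_circle_on
      proof eventually_elim
        case (elim x)
        have "2 * (1 / (1 - z * cnj x) * v x) - v x = of_real (u x) * cnj (2 / (1 - cnj z * x) - 1)"
          by (simp add: v_def algebra_simps)
        then have "Re (2 * (1 / (1 - z * cnj x) * v x) - v x) = u x * Re (cnj (2 / (1 - cnj z * x) - 1))"
          by (simp only: Re_complex_of_real times_complex.sel Im_complex_of_real mult_zero_left diff_zero)
        also have "\<dots> = u x * poisson z x" by (simp only: complex_cnj poisson_eq_Re[OF z elim] cnj.sel)
        finally show ?case .
      qed
    qed measurable
    finally show ?thesis .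
  qed
  have Re_le: "\<bar>Re (U z)\<bar> \<le> M" if z: "cmod z < 1" for z
  proof -
    have "\<bar>Re (U z)\<bar> \<le> (\<ointegral>x. norm (u x * poisson z x))"
      unfolding ReU[OF z] by (metis integral_norm_bound real_norm_def)
    also have "\<dots> \<le> (\<ointegral>x. M * poisson z x)"
    proof (rule integral_circle_mono_on)
      show "integrable circle_measure (\<lambda>x. norm (u x * poisson z x))"
        by (intro integrable_norm integrable_circle_continuous continuous_intros uc continuous_poisson z) measurable
      show "integrable circle_measure (\<lambda>x. M * poisson z x)" using integrable_poisson[OF z] by simp
      fix x :: complex assume "cmod x = 1"
      then show "norm (u x * poisson z x) \<le> M * poisson z x"
        using M(2)[of x] poisson_nonneg[OF z, of x] by (simp add: abs_mult mult_right_mono)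
    qed
    also have "\<dots> = M" using integral_poisson[OF z] by simp
    finally show ?thesis .
  qed
  have step: "cmod (f 0) * exp I \<le> (\<ointegral>x. cmod (g x) * exp (Re (U (of_real r * x))))"
    if r: "0 < r" "r < 1" for r
  proof -
    define h where "h = (\<lambda>z. if cmod z < 1 then exp (U (of_real r * z)) else 0)"
    have rz: "cmod (of_real r * z) < 1" if "cmod z \<le> 1" for z
      using r that by (simp add: norm_mult) (metis le_less_trans mult_left_le norm_ge_zero less_le)
    have "(\<lambda>z. U (of_real r * z)) holomorphic_on ball 0 1"
      by (rule holomorphic_on_compose_gen[OF _ U_hol, unfolded o_def]) (auto intro!: holomorphic_intros rz)
    then have "(\<lambda>z. exp (U (of_real r * z))) holomorphic_on ball 0 1" by (intro holomorphic_intros)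
    then have "h holomorphic_on ball 0 1" by (rule holomorphic_transform) (simp add: h_def)
    then have h_a: "h \<in> analytic_disc" by (simp add: analytic_disc_def h_def)
    have h_b: "cmod (h z) \<le> exp M" if "cmod z < 1" for z
      using Re_le[OF rz, of z] that by (auto simp: h_def abs_le_iff)
    have "(\<lambda>z. f z * h z) \<in> hardy_space"
      by (rule hardy_mult_bounded[OF hardy_coeffs_imp_hardy_space[OF f] h_a h_b])
    then obtain d where d: "hardy_coeffs (\<lambda>z. f z * h z) d" using hardy_space_imp_coeffs by blast
    have bv: "AE x in circle_measure. boundary_value (\<lambda>z. f z * h z) x = g x * exp (U (of_real r * x))"
      using AE_tendsto_boundary_value[OF f] fg AE_circle_on
    proof eventually_elim
      case (elim x)
      have "isCont U (of_real r * x)"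
        using holomorphic_on_imp_continuous_on[OF U_hol] rz[of x] elim
        by (simp add: continuous_on_eq_continuous_at)
      moreover have "((\<lambda>s. of_real r * (of_real s * x)) \<longlongrightarrow> of_real r * (of_real 1 * x)) (at_left (1::real))"
        by (intro tendsto_intros)
      then have "((\<lambda>s. of_real r * (of_real s * x)) \<longlongrightarrow> of_real r * x) (at_left (1::real))" by simp
      ultimately have "((\<lambda>s. U (of_real r * (of_real s * x))) \<longlongrightarrow> U (of_real r * x)) (at_left 1)"
        by (rule isCont_tendsto_compose)
      then have "((\<lambda>s. f (of_real s * x) * exp (U (of_real r * (of_real s * x)))) \<longlongrightarrow> g x * exp (U (of_real r * x))) (at_left 1)"
        using elim by (intro tendsto_intros) auto
      then have "((\<lambda>s. f (of_real s * x) * h (of_real s * x)) \<longlongrightarrow> g x * exp (U (of_real r * x))) (at_left 1)"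
      proof (rule Lim_transform_eventually)
        show "\<forall>\<^sub>F s in at_left 1. f (of_real s * x) * exp (U (of_real r * (of_real s * x))) = f (of_real s * x) * h (of_real s * x)"
          using eventually_at_left_real[OF zero_less_one]
          by eventually_elim (use elim in \<open>simp add: h_def norm_mult\<close>)
      qed
      then show ?case by (rule boundary_value_eqI)
    qed
    have "f 0 * exp (U 0) = f 0 * h 0" by (simp add: h_def)
    also have "\<dots> = (\<ointegral>x. boundary_value (\<lambda>z. f z * h z) x)"
      using hardy_cauchy_formula[OF d, of 0] by simp
    finally have "cmod (f 0 * exp (U 0)) \<le> (\<ointegral>x. cmod (boundary_value (\<lambda>z. f z * h z) x))"
      by (simp only: integral_norm_bound)
    also have "\<dots> = (\<ointegral>x. cmod (g x) * exp (Re (U (of_real r * x))))"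
    proof (rule integral_cong_AE)
      show "(\<lambda>x. cmod (boundary_value (\<lambda>z. f z * h z) x)) \<in> borel_measurable circle_measure"
        using L2_measurable[OF L2_boundary_value[OF d]] by measurable
      have [measurable]: "cauchy_transform v \<in> borel_measurable borel"
        by (rule analytic_disc_measurable[OF hardy_coeffs_analytic[OF hardy_coeffs_cauchy_transform[OF v]]])
      show "(\<lambda>x. cmod (g x) * exp (Re (U (of_real r * x)))) \<in> borel_measurable circle_measure"
        unfolding U_def by measurable
      show "AE x in circle_measure. cmod (boundary_value (\<lambda>z. f z * h z) x) = cmod (g x) * exp (Re (U (of_real r * x)))"
        using bv by eventually_elim (simp add: norm_mult)
    qed
    finally have "cmod (f 0 * exp (U 0)) \<le> (\<ointegral>x. cmod (g x) * exp (Re (U (of_real r * x))))" .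
    moreover have "cmod (f 0 * exp (U 0)) = cmod (f 0) * exp I" by (simp only: U0 norm_mult norm_exp_eq_Re Re_complex_of_real)
    ultimately show ?thesis by simp
  qed
  define r where "r = (\<lambda>n. 1 - 1 / (real n + 2))"
  have r01: "0 < r n" "r n < 1" for n by (simp_all add: r_def)
  have r_lim: "filterlim r (at_left 1) sequentially" unfolding r_def by (rule filterlim_at_left_1)
  have "(\<lambda>n. \<ointegral>x. cmod (g x) * exp (Re (U (of_real (r n) * x)))) \<longlonglongrightarrow> (\<ointegral>x. cmod (g x) * exp (u x))"
  proof (rule integral_dominated_convergence[where w = "\<lambda>_. G * exp M"])
    have [measurable]: "cauchy_transform v \<in> borel_measurable borel"
      by (rule analytic_disc_measurable[OF hardy_coeffs_analytic[OF hardy_coeffs_cauchy_transform[OF v]]])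
    show "(\<lambda>x. cmod (g x) * exp (Re (U (of_real (r n) * x)))) \<in> borel_measurable circle_measure" for n
      unfolding U_def by measurable
    show "AE x in circle_measure. (\<lambda>n. cmod (g x) * exp (Re (U (of_real (r n) * x)))) \<longlonglongrightarrow> cmod (g x) * exp (u x)"
      using AE_circle_on
    proof eventually_elim
      case (elim x)
      have "(\<lambda>n. \<ointegral>\<xi>. u \<xi> * poisson (of_real (r n) * x) \<xi>) \<longlonglongrightarrow> u x"
        by (rule filterlim_compose[OF tendsto_poisson_integral[OF u uc elim] r_lim])
      moreover have "Re (U (of_real (r n) * x)) = (\<ointegral>\<xi>. u \<xi> * poisson (of_real (r n) * x) \<xi>)" for n
        by (rule ReU) (use elim r01[of n] in \<open>simp add: norm_mult\<close>)
      ultimately show ?case by (simp only:) (intro tendsto_intros)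
    qed
    show "AE x in circle_measure. norm (cmod (g x) * exp (Re (U (of_real (r n) * x)))) \<le> G * exp M" for n
      using AE_circle_on
    proof eventually_elim
      case (elim x)
      have "\<bar>Re (U (of_real (r n) * x))\<bar> \<le> M"
        by (rule Re_le) (use elim r01[of n] in \<open>simp add: norm_mult\<close>)
      then show ?case using G(2)[OF elim] G(1) by (simp add: abs_mult) (intro mult_mono, auto)
    qed
  qed auto
  then have "cmod (f 0) * exp I \<le> (\<ointegral>x. cmod (g x) * exp (u x))"
    by (rule LIMSEQ_le_const) (use step r01 in blast)
  then show ?thesis by (simp add: I_def)
qed

text \<open>Jensen's inequality for the boundary function. With \<open>u = - ln (max (cmod g) \<epsilon>)\<close> the previous estimate says
  that \<open>cmod (f 0)\<close> is at most the geometric mean of \<open>max (cmod g) \<epsilon>\<close>, and this mean tends to zero with \<open>\<epsilon>\<close>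
  when \<open>g\<close> vanishes on a set of positive measure.\<close>
lemma hardy_vanishes_at_0:
  assumes f: "hardy_coeffs f c"
    and g [measurable]: "g \<in> borel_measurable borel" and gc: "continuous_on (sphere 0 1) g"
    and fg: "AE x in circle_measure. boundary_value f x = g x"
    and pos: "0 < measure circle_measure {x. cmod x = 1 \<and> g x = 0}"
  shows "f 0 = 0"
proof -
  define Z where "Z = {x. cmod x = 1 \<and> g x = 0}"
  have Z [measurable]: "Z \<in> sets borel" unfolding Z_def by measurable
  define m where "m = measure circle_measure Z"
  have m: "0 < m" using pos by (simp add: m_def Z_def)
  obtain G0 where G0: "0 < G0" "\<And>x. cmod x = 1 \<Longrightarrow> cmod (g x) \<le> G0" using bounded_on_circle[OF gc] by blast
  define G where "G = max 1 G0"
  have G: "1 \<le> G" "\<And>x. cmod x = 1 \<Longrightarrow> cmod (g x) \<le> G" using G0 by (auto simp: G_def le_max_iff_disj)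
  have bound: "cmod (f 0) \<le> G * exp (- (m * real n))" for n
  proof -
    define \<epsilon> where "\<epsilon> = exp (- real n)"
    have \<epsilon>: "0 < \<epsilon>" "\<epsilon> \<le> 1" by (simp_all add: \<epsilon>_def)
    define u where "u = (\<lambda>x. - ln (max (cmod (g x)) \<epsilon>))"
    have u_m [measurable]: "u \<in> borel_measurable borel" unfolding u_def by measurable
    have uc: "continuous_on (sphere 0 1) u"
      unfolding u_def using \<epsilon> by (intro continuous_intros gc) (auto simp: max_def)
    have ui: "integrable circle_measure u" by (rule integrable_circle_continuous[OF u_m uc])
    have "(\<ointegral>x. - ln G + real n * indicator Z x) \<le> (\<ointegral>x. u x)"
    proof (rule integral_circle_mono_on[OF _ ui])
      show "integrable circle_measure (\<lambda>x. - ln G + real n * indicator Z x)"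
        by (rule integrable_circle_bounded[where B = "\<bar>ln G\<bar> + real n"]) (auto intro!: AE_I2 simp: indicator_def)
      fix x :: complex assume x: "cmod x = 1"
      show "- ln G + real n * indicator Z x \<le> u x"
      proof (cases "x \<in> Z")
        case True
        then show ?thesis using \<epsilon> G(1) by (simp add: u_def Z_def \<epsilon>_def max_def)
      next
        case False
        have "max (cmod (g x)) \<epsilon> \<le> G" using G(2)[OF x] \<epsilon> G(1) by simp
        then show ?thesis using False \<epsilon> by (simp add: u_def)
      qed
    qed
    moreover have "(\<ointegral>x. - ln G + real n * indicator Z x) = - ln G + real n * m"
    proof -
      have "integrable circle_measure (indicator Z :: complex \<Rightarrow> real)"
        by (rule integrable_circle_bounded[where B = 1]) (auto intro!: AE_I2 simp: indicator_def)
      then show ?thesis by (subst Bochner_Integration.integral_add) (auto simp: m_def)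
    qed
    ultimately have I: "- ln G + real n * m \<le> (\<ointegral>x. u x)" by simp
    have "cmod (f 0) * exp (\<ointegral>x. u x) \<le> (\<ointegral>x. cmod (g x) * exp (u x))"
      by (rule outer_function_estimate[OF f g gc fg u_m uc])
    also have "\<dots> \<le> (\<ointegral>x. 1)"
    proof (rule integral_circle_mono_on)
      show "integrable circle_measure (\<lambda>x. cmod (g x) * exp (u x))"
        by (intro integrable_circle_continuous continuous_intros gc uc) measurable
      show "cmod (g x) * exp (u x) \<le> 1" for x
        using \<epsilon> by (simp add: u_def exp_minus field_simps)
    qed simp
    finally have "cmod (f 0) * exp (\<ointegral>x. u x) \<le> 1" by simp
    moreover have "cmod (f 0) * exp (- ln G + real n * m) \<le> cmod (f 0) * exp (\<ointegral>x. u x)"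
      using I by (intro mult_left_mono) auto
    ultimately have "cmod (f 0) * exp (- ln G + real n * m) \<le> 1" by linarith
    moreover have "exp (- ln G + real n * m) = exp (real n * m) / G"
      using G(1) exp_diff[of "real n * m" "ln G"] by simp
    ultimately have "cmod (f 0) * (exp (real n * m) / G) \<le> 1" by simp
    then show ?thesis using G(1) by (simp add: exp_minus field_simps)
  qed
  have "(\<lambda>n. G * exp (- m) ^ n) \<longlonglongrightarrow> G * 0"
    using m by (intro tendsto_intros LIMSEQ_power_zero) auto
  then have "(\<lambda>n. G * exp (- (m * real n))) \<longlonglongrightarrow> 0"
    by (simp add: exp_of_nat_mult[symmetric] mult.commute)
  then have "cmod (f 0) \<le> 0" by (rule LIMSEQ_le_const) (use bound in blast)
  then show ?thesis by simp
qed

text \<open>Once the coefficients before the \<open>n\<close>-th are known to vanish, the factor \<open>z ^ n\<close> is divided out. On the circle this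
  does not change the zeros of the boundary function, so the value at the origin, which is the
  \<open>n\<close>-th coefficient, vanishes as well.\<close>
lemma hardy_boundary_uniqueness:
  assumes f: "hardy_coeffs f c"
    and g [measurable]: "g \<in> borel_measurable borel" and gc: "continuous_on (sphere 0 1) g"
    and fg: "AE x in circle_measure. boundary_value f x = g x"
    and pos: "0 < measure circle_measure {x. cmod x = 1 \<and> g x = 0}"
  shows "f = (\<lambda>_. 0)"
proof -
  have c: "summable (\<lambda>n. (cmod (c n))\<^sup>2)" and fz: "\<And>z. cmod z < 1 \<Longrightarrow> (\<lambda>n. c n * z ^ n) sums f z"
    using f by (auto simp: hardy_coeffs_def)
  have c0: "c n = 0" for n
  proof (induction n rule: less_induct)
    case (less n)
    define d where "d = (\<lambda>k. c (k + n))"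
    have d: "summable (\<lambda>k. (cmod (d k))\<^sup>2)" unfolding d_def using c by (subst summable_iff_shift)
    define \<psi> where "\<psi> = (\<lambda>z. if cmod z < 1 then (\<Sum>k. d k * z ^ k) else 0)"
    have ds: "(\<lambda>k. d k * z ^ k) sums \<psi> z" if z: "cmod z < 1" for z
    proof -
      have "summable (\<lambda>k. cmod (d k * z ^ k))"
        using hardy_coeffs_summable_norm[OF d _ z] by (simp add: norm_mult norm_power)
      then have "summable (\<lambda>k. d k * z ^ k)" by (rule summable_norm_cancel)
      then show ?thesis using z by (simp add: \<psi>_def summable_sums)
    qed
    have \<psi>: "hardy_coeffs \<psi> d"
      unfolding hardy_coeffs_def using d ds by (auto simp: \<psi>_def)
    have f\<psi>: "f z = z ^ n * \<psi> z" if z: "cmod z < 1" for z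
    proof (rule sums_unique2)
      have "(\<lambda>k. c (k + n) * z ^ (k + n)) sums (z ^ n * \<psi> z)"
        using sums_mult[OF ds[OF z], of "z ^ n"] by (simp add: d_def power_add mult_ac)
      then have "(\<lambda>k. c k * z ^ k) sums (z ^ n * \<psi> z + (\<Sum>k<n. c k * z ^ k))"
        by (subst (asm) sums_iff_shift)
      then show "(\<lambda>k. c k * z ^ k) sums (z ^ n * \<psi> z)" using less by simp
    qed (rule fz[OF z])
    define h where "h = (\<lambda>x. g x / x ^ n)"
    have "\<psi> 0 = 0"
    proof (rule hardy_vanishes_at_0[OF \<psi>])
      show "h \<in> borel_measurable borel" unfolding h_def by measurable
      show "continuous_on (sphere 0 1) h" unfolding h_def by (intro continuous_intros gc) auto
      have "{x. cmod x = 1 \<and> h x = 0} = {x. cmod x = 1 \<and> g x = 0}" by (auto simp: h_def)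
      then show "0 < measure circle_measure {x. cmod x = 1 \<and> h x = 0}" using pos by simp
      show "AE x in circle_measure. boundary_value \<psi> x = h x"
        using AE_tendsto_boundary_value[OF f] fg AE_circle_on
      proof eventually_elim
        case (elim x)
        have "((\<lambda>r. f (of_real r * x) / (of_real r * x) ^ n) \<longlongrightarrow> g x / (of_real 1 * x) ^ n) (at_left (1::real))"
          using elim by (intro tendsto_intros) auto
        then have "((\<lambda>r. f (of_real r * x) / (of_real r * x) ^ n) \<longlongrightarrow> h x) (at_left (1::real))" by (simp add: h_def)
        then have "((\<lambda>r. \<psi> (of_real r * x)) \<longlongrightarrow> h x) (at_left 1)"
        proof (rule Lim_transform_eventually)
          show "\<forall>\<^sub>F r in at_left 1. f (of_real r * x) / (of_real r * x) ^ n = \<psi> (of_real r * x)"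
            using eventually_at_left_real[OF zero_less_one]
          proof eventually_elim
            case (elim r)
            then have "cmod (of_real r * x) < 1" "of_real r * x \<noteq> 0"
              using \<open>cmod x = 1\<close> by (auto simp: norm_mult)
            then show ?case by (simp add: f\<psi> del: mult_eq_0_iff)
          qed
        qed
        then show ?case by (rule boundary_value_eqI)
      qed
    qed
    moreover have "\<psi> 0 = d 0" using ds[of 0] powser_sums_zero_iff[of d "\<psi> 0"] by simp
    ultimately show "c n = 0" by (simp add: d_def)
  qed
  show ?thesis
  proof
    fix z
    show "f z = 0"
    proof (cases "cmod z < 1")
      case True
      from fz[OF True] show ?thesis by (simp add: c0 sums_iff)
    qed (use f in \<open>simp add: hardy_coeffs_def\<close>)
  qed
qed

section \<open>Toeplitz operators on kernel functions\<close>

lemma Hinf_unit_ball_norm_le: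
  assumes "b \<in> Hinf_unit_ball" "cmod z < 1"
  shows "cmod (b z) \<le> 1"
proof -
  have "bounded (b ` unit_disc)" "Hinf_norm b \<le> 1"
    using assms by (auto simp: Hinf_unit_ball_def Hinf_def)
  then have "bdd_above ((\<lambda>z. cmod (b z)) ` unit_disc)"
    unfolding bounded_iff bdd_above_def by fastforce
  then have "cmod (b z) \<le> Hinf_norm b"
    unfolding Hinf_norm_def by (rule cSUP_upper2) (use assms in auto)
  then show ?thesis using \<open>Hinf_norm b \<le> 1\<close> by simp
qed

lemma Hinf_imp_hardy_space: "f \<in> Hinf \<Longrightarrow> f \<in> hardy_space"
proof -
  assume f: "f \<in> Hinf"
  then obtain B where "\<forall>x\<in>f ` unit_disc. cmod x \<le> B" by (auto simp: Hinf_def bounded_iff)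
  then show "f \<in> hardy_space"
    using f by (intro bounded_analytic_hardy_space[of f B]) (auto simp: Hinf_def)
qed

lemma norm_boundary_value_le:
  assumes "radial_limit f x (boundary_value f x)" "cmod x = 1"
    and B: "\<And>z. cmod z < 1 \<Longrightarrow> cmod (f z) \<le> B"
  shows "cmod (boundary_value f x) \<le> B"
proof (rule tendsto_upperbound[OF tendsto_norm[OF assms(1)]])
  show "\<forall>\<^sub>F r in at_left 1. cmod (f (of_real r * x)) \<le> B"
    using eventually_at_left_real[OF zero_less_one]
    by eventually_elim (use assms(2) in \<open>auto intro!: B simp: norm_mult\<close>)
qed simp

lemma AE_norm_boundary_value_le:
  assumes f: "hardy_coeffs f c" and B: "\<And>z. cmod z < 1 \<Longrightarrow> cmod (f z) \<le> B"
  shows "AE x in circle_measure. cmod (boundary_value f x) \<le> B"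
  using AE_tendsto_boundary_value[OF f] AE_circle_on
  by eventually_elim (rule norm_boundary_value_le[OF _ _ B])

lemma toeplitz_zero: "toeplitz_cnj (\<lambda>_. 0) f = (\<lambda>_. 0)"
proof -
  have "boundary_value (\<lambda>_. 0) x = 0" for x by (rule boundary_value_eqI) simp
  then have "toeplitz_cnj (\<lambda>_. 0) f = hardy_projection (\<lambda>_. 0)" by (simp add: toeplitz_cnj_def)
  also have "\<dots> = cauchy_transform (\<lambda>_. 0)" by (rule hardy_projection_eq_cauchy_transform) simp
  also have "\<dots> = (\<lambda>_. 0)" by (simp add: cauchy_transform_def fun_eq_iff)
  finally show ?thesis .
qed

lemma (in function_inner_space) compact_operator_zero: "compact_operator (\<lambda>_ _. 0)"
proof -
  have "linear_operator (\<lambda>_ _. 0)" using zero_mem by (auto simp: linear_operator_def)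
  moreover have im: "(\<lambda>_ _. 0) ` {f \<in> H. ip_norm f \<le> 1} = {\<lambda>_. 0}"
  proof -
    have "(\<lambda>_. 0) \<in> {f \<in> H. ip_norm f \<le> 1}" using zero_mem by (simp add: ip_norm_def ip_zero_left)
    then show ?thesis by blast
  qed
  moreover have cl: "mtopology closure_of {\<lambda>_. 0} = {\<lambda>_. 0}"
    using zero_mem by (intro closure_of_closedin closedin_Hausdorff_singleton) (auto simp: Hausdorff_space_mtopology)
  moreover have "compactin mtopology {\<lambda>_. 0}"
    using zero_mem by (intro finite_imp_compactin) auto
  ultimately show ?thesis
    unfolding compact_operator_def im cl by blast
qed

text \<open>A compact operator sends the vectors \<open>e n\<close> to a sequence with a norm-convergent subsequence. Its limit
  is close to some fixed \<open>T (e m)\<close>, which becomes orthogonal to \<open>e n\<close>. It thus suffices to test weak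
  convergence of \<open>e n\<close> against vectors in the range of \<open>T\<close>.\<close>
lemma (in function_inner_space) compact_operator_orthogonal_limit:
  assumes T: "compact_operator T"
    and e: "\<And>n::nat. e n \<in> H" "\<And>n. ip_norm (e n) \<le> 1"
    and weak: "\<And>m. (\<lambda>n. ip (T (e m)) (e n)) \<longlonglongrightarrow> 0"
    and lim: "(\<lambda>n. ip (T (e n)) (e n)) \<longlonglongrightarrow> L"
  shows "L = 0"
proof (rule ccontr)
  assume "L \<noteq> 0"
  define d where "d = cmod L / 4"
  have d: "0 < d" using \<open>L \<noteq> 0\<close> by (simp add: d_def)
  have TH: "T f \<in> H" if "f \<in> H" for f
    using T that by (auto simp: compact_operator_def linear_operator_def)
  define S where "S = mtopology closure_of (T ` {f \<in> H. ip_norm f \<le> 1})"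
  have S: "compactin mtopology S" using T by (simp add: compact_operator_def S_def)
  have "T ` {f \<in> H. ip_norm f \<le> 1} \<subseteq> S"
    unfolding S_def by (intro closure_of_subset) (auto intro: TH)
  then have "range (\<lambda>n. T (e n)) \<subseteq> S" using e by blast
  then obtain l \<rho> where l: "l \<in> S" and \<rho>: "strict_mono \<rho>" and conv: "limitin mtopology ((\<lambda>n. T (e n)) \<circ> \<rho>) l sequentially"
    using S unfolding compactin_sequentially by meson
  have lH: "l \<in> H" and near: "\<And>\<epsilon>. 0 < \<epsilon> \<Longrightarrow> \<forall>\<^sub>F n in sequentially. ip_dist (T (e (\<rho> n))) l < \<epsilon>"
    using conv by (auto simp: limitin_metric elim: eventually_mono)
  have cs: "cmod (ip f g - ip h g) \<le> ip_dist f h" if "f \<in> H" "h \<in> H" "g \<in> H" "ip_norm g \<le> 1" for f g h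
  proof -
    have "ip (\<lambda>z. f z - h z) g = ip f g - ip h g"
      using ip_add[of f "\<lambda>z. -1 * h z" g] ip_scale[of h g "-1"] scale_mem[of h "-1"] that by simp
    then have "cmod (ip f g - ip h g) = cmod (ip (\<lambda>z. f z - h z) g)" by simp
    also have "\<dots> \<le> ip_norm g * ip_norm (\<lambda>z. f z - h z)"
      using that diff_mem by (intro cauchy_schwarz) auto
    also have "\<dots> \<le> 1 * ip_norm (\<lambda>z. f z - h z)"
      using that ip_self_nonneg[OF diff_mem[OF that(1,2)]] by (intro mult_right_mono) (auto simp: ip_norm_def)
    finally show ?thesis using that by (simp add: ip_dist_def)
  qed
  obtain M where M: "ip_dist (T (e (\<rho> M))) l < d"
    using eventually_happens'[OF _ near[OF d]] by auto
  have "(\<lambda>n. ip (T (e (\<rho> M))) (e (\<rho> n))) \<longlonglongrightarrow> 0"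
    using LIMSEQ_subseq_LIMSEQ[OF weak \<rho>, of "\<rho> M"] by (simp add: o_def)
  then have "\<forall>\<^sub>F n in sequentially. cmod (ip (T (e (\<rho> M))) (e (\<rho> n))) < d"
    using d by (auto dest: tendstoD simp: dist_norm)
  moreover have "(\<lambda>n. ip (T (e (\<rho> n))) (e (\<rho> n))) \<longlonglongrightarrow> L"
    using LIMSEQ_subseq_LIMSEQ[OF lim \<rho>] by (simp add: o_def)
  then have "\<forall>\<^sub>F n in sequentially. cmod (ip (T (e (\<rho> n))) (e (\<rho> n)) - L) < d"
    using d by (auto dest: tendstoD simp: dist_norm)
  ultimately have "\<forall>\<^sub>F n in sequentially. False"
    using near[OF d]
  proof eventually_elim
    case (elim n)
    let ?x = "ip (T (e (\<rho> n))) (e (\<rho> n))" and ?y = "ip l (e (\<rho> n))" and ?z = "ip (T (e (\<rho> M))) (e (\<rho> n))"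
    have "cmod (?x - ?y) \<le> ip_dist (T (e (\<rho> n))) l" by (intro cs TH e lH)
    moreover have "cmod (?z - ?y) \<le> ip_dist (T (e (\<rho> M))) l" by (intro cs TH e lH)
    moreover have "cmod L \<le> cmod (?x - ?y) + cmod (?z - ?y) + cmod ?z + cmod (?x - L)"
    proof -
      have L: "((?x - ?y) - (?z - ?y) + ?z) - (?x - L) = L" by simp
      show ?thesis
        using norm_triangle_ineq4[of "(?x - ?y) - (?z - ?y) + ?z" "?x - L", unfolded L]
          norm_triangle_ineq[of "(?x - ?y) - (?z - ?y)" ?z] norm_triangle_ineq4[of "?x - ?y" "?z - ?y"]
        by linarith
    qed
    ultimately have "cmod L < 4 * d" using elim M by linarith
    then show False by (simp add: d_def)
  qed
  then show False by simp
qed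

lemma dBR_kernel_hardy:
  assumes b: "b \<in> Hinf_unit_ball" and w: "cmod w < 1"
  obtains c where "hardy_coeffs (dBR_kernel b w) c"
proof -
  have ba: "b \<in> analytic_disc" using b by (simp add: Hinf_unit_ball_def Hinf_def)
  have hol: "(\<lambda>z. (1 - cnj (b w) * b z) / (1 - cnj w * z)) holomorphic_on unit_disc"
    by (intro holomorphic_intros)
       (use ba one_minus_disc_circle_ne_0[of "cnj w"] w in \<open>auto simp: analytic_disc_def\<close>)
  have a: "dBR_kernel b w \<in> analytic_disc"
    unfolding analytic_disc_def using holomorphic_transform[OF hol, of "dBR_kernel b w"]
    by (auto simp: dBR_kernel_def)
  have "dBR_kernel b w \<in> hardy_space"
  proof (rule bounded_analytic_hardy_space[OF a])
    fix z assume z: "cmod z < 1"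
    have "cmod (b z) \<le> 1" "cmod (b w) \<le> 1" using Hinf_unit_ball_norm_le[OF b] z w by auto
    then have "cmod (cnj (b w) * b z) \<le> 1" by (simp add: norm_mult mult_le_one)
    then have n: "cmod (1 - cnj (b w) * b z) \<le> 2"
      using norm_triangle_ineq4[of 1 "cnj (b w) * b z"] by simp
    have "cmod (cnj w * z) \<le> cmod w" using z by (simp add: norm_mult mult_left_le)
    then have "1 - cmod w \<le> cmod (1 - cnj w * z)"
      using norm_triangle_ineq2[of 1 "cnj w * z"] by simp
    then show "cmod (dBR_kernel b w z) \<le> 2 / (1 - cmod w)"
      using n w z by (simp add: dBR_kernel_def norm_divide) (intro frac_le, auto)
  qed
  then show ?thesis using that hardy_space_imp_coeffs by blast
qed

lemma boundary_value_dBR_kernel: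
  assumes "radial_limit b x (boundary_value b x)" "cmod x = 1" "cmod w < 1"
  shows "boundary_value (dBR_kernel b w) x = (1 - cnj (b w) * boundary_value b x) / (1 - cnj w * x)"
proof (rule boundary_value_eqI)
  have "1 - cnj w * x \<noteq> 0" using one_minus_disc_circle_ne_0[of "cnj w" x] assms by simp
  then have "((\<lambda>r. (1 - cnj (b w) * b (of_real r * x)) / (1 - cnj w * (of_real r * x))) \<longlongrightarrow>
      (1 - cnj (b w) * boundary_value b x) / (1 - cnj w * (of_real 1 * x))) (at_left (1::real))"
    by (intro tendsto_intros assms(1)) simp
  then have "((\<lambda>r. (1 - cnj (b w) * b (of_real r * x)) / (1 - cnj w * (of_real r * x))) \<longlongrightarrow>
      (1 - cnj (b w) * boundary_value b x) / (1 - cnj w * x)) (at_left (1::real))" by simp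
  then show "((\<lambda>r. dBR_kernel b w (of_real r * x)) \<longlongrightarrow> (1 - cnj (b w) * boundary_value b x) / (1 - cnj w * x)) (at_left 1)"
  proof (rule Lim_transform_eventually)
    show "\<forall>\<^sub>F r in at_left 1. (1 - cnj (b w) * b (of_real r * x)) / (1 - cnj w * (of_real r * x)) = dBR_kernel b w (of_real r * x)"
      using eventually_at_left_real[OF zero_less_one]
      by eventually_elim (use assms(2) in \<open>simp add: dBR_kernel_def norm_mult\<close>)
  qed
qed

text \<open>On the circle the product of the Szego kernel at \<open>w\<close> and its conjugate is the Poisson kernel at \<open>w\<close>,
  divided by \<open>1 - (cmod w)\<^sup>2\<close>.\<close>
lemma integral_against_kernel:
  assumes b: "b \<in> Hinf_unit_ball" and w: "cmod w < 1"
    and v [measurable]: "v \<in> borel_measurable borel"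
  shows "of_real (1 - (cmod w)\<^sup>2) * (\<ointegral>x. v x * boundary_value (dBR_kernel b w) x / (1 - w * cnj x))
    = (\<ointegral>x. v x * (1 - cnj (b w) * boundary_value b x) * of_real (poisson w x))"
proof -
  have bh: "b \<in> hardy_space" using b by (intro Hinf_imp_hardy_space) (simp add: Hinf_unit_ball_def)
  then obtain c where c: "hardy_coeffs b c" using hardy_space_imp_coeffs by blast
  obtain c' where c': "hardy_coeffs (dBR_kernel b w) c'" using dBR_kernel_hardy[OF b w] by blast
  have [measurable]: "boundary_value b \<in> borel_measurable borel" "boundary_value (dBR_kernel b w) \<in> borel_measurable borel"
    using c c' by (auto intro: L2_measurable L2_boundary_value)
  have "of_real (1 - (cmod w)\<^sup>2) * (\<ointegral>x. v x * boundary_value (dBR_kernel b w) x / (1 - w * cnj x))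
      = (\<ointegral>x. of_real (1 - (cmod w)\<^sup>2) * (v x * boundary_value (dBR_kernel b w) x / (1 - w * cnj x)))"
    by (rule Bochner_Integration.integral_mult_right_zero[symmetric])
  also have "\<dots> = (\<ointegral>x. v x * (1 - cnj (b w) * boundary_value b x) * of_real (poisson w x))"
  proof (rule integral_cong_AE)
    show "AE x in circle_measure. of_real (1 - (cmod w)\<^sup>2) * (v x * boundary_value (dBR_kernel b w) x / (1 - w * cnj x))
        = v x * (1 - cnj (b w) * boundary_value b x) * of_real (poisson w x)"
      using AE_tendsto_boundary_value[OF c] AE_circle_on
    proof eventually_elim
      case (elim x)
      define q where "q = 1 - cnj w * x"
      have q: "cnj q = 1 - w * cnj x" by (simp add: q_def)
      have "complex_of_real (poisson w x) = of_real (1 - (cmod w)\<^sup>2) / of_real ((cmod q)\<^sup>2)"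
        by (simp only: poisson_def of_real_divide q_def)
      also have "\<dots> = of_real (1 - (cmod w)\<^sup>2) / (q * cnj q)" by (simp only: complex_norm_square)
      finally have P: "complex_of_real (poisson w x) = of_real (1 - (cmod w)\<^sup>2) / (q * cnj q)" .
      show ?case
        unfolding boundary_value_dBR_kernel[OF elim w] P q[symmetric] q_def[symmetric] by simp
    qed
  qed measurable
  finally show ?thesis .
qed

lemma toeplitz_kernel_diagonal:
  assumes b: "b \<in> Hinf_unit_ball" and w: "cmod w < 1" and \<phi>: "\<phi> \<in> Hinf"
    and g [measurable]: "g \<in> borel_measurable borel"
    and g_eq: "AE x in circle_measure. boundary_value \<phi> x = g x"
  shows toeplitz_dBR_kernel_hardy: "\<exists>c. hardy_coeffs (toeplitz_cnj \<phi> (dBR_kernel b w)) c"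
    and "of_real (1 - (cmod w)\<^sup>2) * toeplitz_cnj \<phi> (dBR_kernel b w) w
      = (\<ointegral>x. cnj (g x) * (1 - cnj (b w) * boundary_value b x) * of_real (poisson w x))"
proof -
  let ?k = "dBR_kernel b w"
  obtain c where c: "hardy_coeffs ?k c" using dBR_kernel_hardy[OF b w] by blast
  obtain d where d: "hardy_coeffs \<phi> d" using Hinf_imp_hardy_space[OF \<phi>] hardy_space_imp_coeffs by blast
  obtain B where "\<forall>x\<in>\<phi> ` unit_disc. cmod x \<le> B" using \<phi> by (auto simp: Hinf_def bounded_iff)
  then have B: "\<And>z. cmod z < 1 \<Longrightarrow> cmod (\<phi> z) \<le> B" by simp
  have [measurable]: "boundary_value \<phi> \<in> borel_measurable borel" "boundary_value ?k \<in> borel_measurable borel"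
    using c d by (auto intro: L2_measurable L2_boundary_value)
  define u where "u = (\<lambda>x. cnj (boundary_value \<phi> x) * boundary_value ?k x)"
  have u: "L2 u"
    unfolding u_def
  proof (rule L2_mult_bounded[OF L2_boundary_value[OF c]])
    show "AE x in circle_measure. cmod (cnj (boundary_value \<phi> x)) \<le> B"
      using AE_norm_boundary_value_le[OF d B] by simp
  qed measurable
  have T: "toeplitz_cnj \<phi> ?k = cauchy_transform u"
    unfolding toeplitz_cnj_def u_def[symmetric] by (rule hardy_projection_eq_cauchy_transform[OF u])
  show "\<exists>c. hardy_coeffs (toeplitz_cnj \<phi> ?k) c"
    unfolding T using hardy_coeffs_cauchy_transform[OF u] by blast
  have "toeplitz_cnj \<phi> ?k w = (\<ointegral>x. u x / (1 - w * cnj x))"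
    using w by (simp add: T cauchy_transform_def)
  also have "\<dots> = (\<ointegral>x. cnj (g x) * boundary_value ?k x / (1 - w * cnj x))"
    unfolding u_def by (rule integral_cong_AE) (use g_eq in \<open>auto elim: eventually_mono\<close>)
  finally show "of_real (1 - (cmod w)\<^sup>2) * toeplitz_cnj \<phi> ?k w
      = (\<ointegral>x. cnj (g x) * (1 - cnj (b w) * boundary_value b x) * of_real (poisson w x))"
    using integral_against_kernel[OF b w, of "\<lambda>x. cnj (g x)"] by simp
qed

section \<open>Compactness on the de Branges-Rovnyak space\<close>

text \<open>The denominator is the integral of \<open>1 - cnj (b w) * b\<close> against the Poisson kernel at \<open>w = r p\<close>, and the numerator
  is the same integral with the additional factor \<open>cnj g\<close>. By continuity of \<open>g\<close> this factor may be
  replaced by its value at \<open>p\<close>. The quotient is controlled because the denominator stays away from zero.\<close>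
lemma toeplitz_kernel_quotient_limit:
  assumes b: "b \<in> Hinf_unit_ball" and \<phi>: "\<phi> \<in> Hinf"
    and g [measurable]: "g \<in> borel_measurable borel" and gc: "continuous_on (sphere 0 1) g"
    and g_eq: "AE x in circle_measure. boundary_value \<phi> x = g x"
    and z0: "cmod p = 1" and lim: "radial_limit b p \<beta>" and \<beta>: "cmod \<beta> < 1"
  shows "((\<lambda>r. of_real (1 - r\<^sup>2) * toeplitz_cnj \<phi> (dBR_kernel b (of_real r * p)) (of_real r * p)
            / of_real (1 - (cmod (b (of_real r * p)))\<^sup>2)) \<longlongrightarrow> cnj (g p)) (at_left 1)"
proof -
  obtain c where c: "hardy_coeffs b c"
    using b Hinf_imp_hardy_space hardy_space_imp_coeffs by (auto simp: Hinf_unit_ball_def)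
  have bv: "L2 (boundary_value b)" by (rule L2_boundary_value[OF c])
  then have [measurable]: "boundary_value b \<in> borel_measurable borel" by (rule L2_measurable)
  have bv1: "AE x in circle_measure. cmod (boundary_value b x) \<le> 1"
    by (rule AE_norm_boundary_value_le[OF c Hinf_unit_ball_norm_le[OF b]])
  define N where "N = (\<lambda>r. of_real (1 - r\<^sup>2) * toeplitz_cnj \<phi> (dBR_kernel b (of_real r * p)) (of_real r * p))"
  define D where "D = (\<lambda>r. 1 - (cmod (b (of_real r * p)))\<^sup>2)"
  define \<epsilon> where "\<epsilon> = (\<lambda>r. \<ointegral>x. cmod (g x - g p) * poisson (of_real r * p) x)"
  have \<epsilon>: "(\<epsilon> \<longlongrightarrow> 0) (at_left 1)"
    unfolding \<epsilon>_def by (rule tendsto_integral_poisson_0[OF _ _ z0]) (auto intro!: continuous_intros gc)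
  have D: "(D \<longlongrightarrow> 1 - (cmod \<beta>)\<^sup>2) (at_left 1)"
    unfolding D_def by (intro tendsto_intros lim)
  have \<beta>2: "0 < 1 - (cmod \<beta>)\<^sup>2" using \<beta> by (simp add: abs_square_less_1)
  have diff: "cmod (N r - cnj (g p) * of_real (D r)) \<le> 2 * \<epsilon> r" if r: "0 < r" "r < 1" for r
  proof -
    define w where "w = of_real r * p"
    have nw: "cmod w = r" and w: "cmod w < 1" using r z0 by (simp_all add: w_def norm_mult)
    have ne: "1 - cnj w * w \<noteq> 0" using one_minus_disc_circle_ne_0[of "cnj w" w] w by simp
    obtain c' where c': "hardy_coeffs (dBR_kernel b w) c'" using dBR_kernel_hardy[OF b w] by blast
    define q where "q = (\<lambda>x. 1 - cnj (b w) * boundary_value b x)"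
    have q_m [measurable]: "q \<in> borel_measurable borel" unfolding q_def by measurable
    have q2: "AE x in circle_measure. cmod (q x) \<le> 2"
      using bv1
    proof eventually_elim
      case (elim x)
      have "cmod (cnj (b w) * boundary_value b x) \<le> 1"
        using elim Hinf_unit_ball_norm_le[OF b w] by (simp add: norm_mult mult_le_one)
      then show ?case using norm_triangle_ineq4[of 1 "cnj (b w) * boundary_value b x"] by (simp add: q_def)
    qed
    have q: "L2 q" by (rule L2_bounded[OF q_m q2])
    have int: "integrable circle_measure (\<lambda>x. v x * q x * of_real (poisson w x))"
      if [measurable]: "v \<in> borel_measurable borel" and "continuous_on (sphere 0 1) v" for v
    proof -
      have "L2 (\<lambda>x. v x * of_real (poisson w x))"
        by (intro L2_continuous continuous_intros that continuous_poisson w) measurable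
      from integrable_circle_mult[OF this q] show ?thesis by (simp add: mult_ac)
    qed
    have "of_real (D r) = of_real (1 - (cmod w)\<^sup>2) * dBR_kernel b w w"
    proof -
      have "complex_of_real (1 - (cmod w)\<^sup>2) = 1 - cnj w * w"
        by (simp only: of_real_diff of_real_1 complex_norm_square mult.commute)
      moreover have "complex_of_real (D r) = 1 - cnj (b w) * b w"
        unfolding D_def w_def[symmetric]
        by (simp only: of_real_diff of_real_1 complex_norm_square mult.commute)
      ultimately show ?thesis using w ne by (simp add: dBR_kernel_def)
    qed
    also have "dBR_kernel b w w = (\<ointegral>x. 1 * boundary_value (dBR_kernel b w) x / (1 - w * cnj x))"
      using hardy_cauchy_formula[OF c' w] by simp
    also have "of_real (1 - (cmod w)\<^sup>2) * \<dots> = (\<ointegral>x. 1 * q x * of_real (poisson w x))"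
      unfolding q_def by (rule integral_against_kernel[OF b w]) simp
    finally have "cnj (g p) * of_real (D r) = (\<ointegral>x. cnj (g p) * (1 * q x * of_real (poisson w x)))"
      by simp
    then have D': "cnj (g p) * of_real (D r) = (\<ointegral>x. cnj (g p) * q x * of_real (poisson w x))"
      by (simp only: mult_1_left mult.assoc)
    have N': "N r = (\<ointegral>x. cnj (g x) * q x * of_real (poisson w x))"
      using toeplitz_kernel_diagonal(2)[OF b w \<phi> g g_eq] by (simp only: N_def w_def[symmetric] nw q_def)
    let ?P = "\<lambda>x. cnj (g x) * q x * of_real (poisson w x)" and ?Q = "\<lambda>x. cnj (g p) * q x * of_real (poisson w x)"
    have i1: "integrable circle_measure (\<lambda>x. ?P x)"
      by (rule int) (measurable, intro continuous_intros gc)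
    have i2: "integrable circle_measure (\<lambda>x. ?Q x)"
      by (rule int) auto
    have "N r - cnj (g p) * of_real (D r) = (\<ointegral>x. ?P x - ?Q x)"
      unfolding N' D' by (rule Bochner_Integration.integral_diff[OF i1 i2, symmetric])
    then have "cmod (N r - cnj (g p) * of_real (D r)) \<le> (\<ointegral>x. cmod (?P x - ?Q x))"
      by (simp only: integral_norm_bound)
    also have "\<dots> \<le> (\<ointegral>x. 2 * (cmod (g x - g p) * poisson w x))"
    proof (rule integral_mono_AE)
      show "integrable circle_measure (\<lambda>x. cmod (?P x - ?Q x))"
        by (intro integrable_norm Bochner_Integration.integrable_diff i1 i2)
      show "integrable circle_measure (\<lambda>x. 2 * (cmod (g x - g p) * poisson w x))"
        by (intro integrable_circle_continuous continuous_intros gc continuous_poisson w) measurable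
      show "AE x in circle_measure. cmod (?P x - ?Q x)
          \<le> 2 * (cmod (g x - g p) * poisson w x)"
        using q2
      proof eventually_elim
        case (elim x)
        have "?P x - ?Q x = cnj (g x - g p) * of_real (poisson w x) * q x"
          by (simp add: algebra_simps)
        then have "cmod (?P x - ?Q x) = (cmod (g x - g p) * poisson w x) * cmod (q x)"
          using poisson_nonneg[OF w, of x] by (simp only: norm_mult complex_mod_cnj norm_of_real abs_of_nonneg)
        also have "\<dots> \<le> (cmod (g x - g p) * poisson w x) * 2"
          using elim poisson_nonneg[OF w, of x] by (intro mult_left_mono) auto
        finally show ?case by simp
      qed
    qed
    also have "\<dots> = 2 * \<epsilon> r" by (simp add: \<epsilon>_def w_def)
    finally show ?thesis .
  qed
  have "((\<lambda>r. N r / of_real (D r) - cnj (g p)) \<longlongrightarrow> 0) (at_left 1)"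
  proof (rule Lim_null_comparison)
    show "((\<lambda>r. 2 * \<epsilon> r / D r) \<longlongrightarrow> 0) (at_left 1)"
      using tendsto_divide[OF tendsto_mult[OF tendsto_const \<epsilon>, of 2] D] \<beta>2 by simp
    show "\<forall>\<^sub>F r in at_left 1. norm (N r / of_real (D r) - cnj (g p)) \<le> 2 * \<epsilon> r / D r"
      using eventually_at_left_real[OF zero_less_one] order_tendstoD(1)[OF D \<beta>2]
    proof eventually_elim
      case (elim r)
      have "N r / of_real (D r) - cnj (g p) = (N r - cnj (g p) * of_real (D r)) / of_real (D r)"
        using elim by (simp add: field_simps)
      then have "norm (N r / of_real (D r) - cnj (g p)) = cmod (N r - cnj (g p) * of_real (D r)) / D r"
        using elim by (simp only: norm_divide norm_of_real abs_of_pos)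
      also have "\<dots> \<le> 2 * \<epsilon> r / D r" using diff[of r] elim by (intro divide_right_mono) auto
      finally show ?case .
    qed
  qed
  then show ?thesis unfolding N_def D_def by (rule LIM_zero_cancel)
qed

text \<open>The vectors \<open>e n\<close> are the normalised kernels at points \<open>w n\<close> tending radially to \<open>p\<close>. Their norms before
  normalisation are of exact order \<open>1 / sqrt (1 - (cmod w)\<^sup>2)\<close> because \<open>cmod \<beta> < 1\<close>, so functions of
  the Hardy space become orthogonal to them by \<open>hardy_growth\<close>.\<close>
lemma compact_toeplitz_boundary_zero:
  assumes rk: "reproducing_kernel_hilbert_space H ip unit_disc (dBR_kernel b)"
    and b: "b \<in> Hinf_unit_ball" and \<phi>: "\<phi> \<in> Hinf"
    and g: "g \<in> borel_measurable borel" and gc: "continuous_on (sphere 0 1) g"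
    and g_eq: "AE x in circle_measure. boundary_value \<phi> x = g x"
    and T: "function_inner_space.compact_operator H ip (toeplitz_cnj \<phi>)"
    and z0: "cmod p = 1" and lim: "radial_limit b p \<beta>" and \<beta>: "cmod \<beta> < 1"
  shows "g p = 0"
proof -
  interpret reproducing_kernel_hilbert_space H ip unit_disc "dBR_kernel b" by (rule rk)
  let ?k = "dBR_kernel b" and ?T = "toeplitz_cnj \<phi>"
  have b_ev: "\<forall>\<^sub>F r in at_left 1. cmod (b (of_real r * p)) < 1"
    using order_tendstoD(2)[OF tendsto_norm[OF lim] \<beta>] .
  define s where "s = (\<lambda>n. 1 - 1 / (real n + 2))"
  have s01: "0 < s n" "s n < 1" for n by (simp_all add: s_def)
  have s_lim: "filterlim s (at_left 1) sequentially" unfolding s_def by (rule filterlim_at_left_1)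
  obtain n0 where n0: "\<And>n. n0 \<le> n \<Longrightarrow> cmod (b (of_real (s n) * p)) < 1"
    using filterlim_iff[THEN iffD1, OF s_lim, rule_format, OF b_ev] by (auto simp: eventually_sequentially)
  define r where "r = (\<lambda>n. s (n + n0))"
  have r01: "0 < r n" "r n < 1" for n using s01 by (auto simp: r_def)
  have r_lim: "filterlim r (at_left 1) sequentially"
    unfolding r_def by (rule filterlim_compose[OF s_lim filterlim_add_const_nat_at_top])
  define w where "w = (\<lambda>n. of_real (r n) * p)"
  have nw: "cmod (w n) = r n" for n using r01[of n] z0 by (simp add: w_def norm_mult)
  then have w: "cmod (w n) < 1" "w n \<in> unit_disc" for n using r01[of n] by auto
  have bw: "cmod (b (w n)) < 1" for n using n0[of "n + n0"] by (simp add: w_def r_def)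
  define \<kappa> where "\<kappa> = (\<lambda>n. (1 - (cmod (b (w n)))\<^sup>2) / (1 - (r n)\<^sup>2))"
  have num: "0 < 1 - (cmod (b (w n)))\<^sup>2" and den: "0 < 1 - (r n)\<^sup>2" for n
    using bw[of n] r01[of n] by (auto simp: abs_square_less_1)
  then have \<kappa>: "0 < \<kappa> n" for n by (simp add: \<kappa>_def)
  have kk: "?k (w n) (w n) = of_real (\<kappa> n)" for n
  proof -
    have "complex_of_real (1 - (r n)\<^sup>2) = 1 - cnj (w n) * w n"
      by (simp only: nw[symmetric] of_real_diff of_real_1 complex_norm_square mult.commute)
    moreover have "complex_of_real (1 - (cmod (b (w n)))\<^sup>2) = 1 - cnj (b (w n)) * b (w n)"
      by (simp only: of_real_diff of_real_1 complex_norm_square mult.commute)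
    ultimately show ?thesis using w(1)[of n] by (simp add: dBR_kernel_def \<kappa>_def of_real_divide del: of_real_diff)
  qed
  define \<gamma> where "\<gamma> = (\<lambda>n. complex_of_real (1 / sqrt (\<kappa> n)))"
  have \<gamma>_sq: "\<gamma> n * \<gamma> n = of_real (1 / \<kappa> n)" for n
    using \<kappa>[of n] unfolding \<gamma>_def by (simp flip: of_real_mult)
  define e where "e = (\<lambda>n z. \<gamma> n * ?k (w n) z)"
  have kH: "?k (w n) \<in> H" for n by (rule kernel_mem[OF w(2)])
  have eH: "e n \<in> H" for n unfolding e_def by (rule scale_mem[OF kH])
  have ip_e: "ip f (e n) = \<gamma> n * f (w n)" if f: "f \<in> H" for f n
  proof -
    have "ip f (e n) = cnj (ip (e n) f)" by (rule ip_cnj[OF eH f])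
    also have "ip (e n) f = \<gamma> n * ip (?k (w n)) f" unfolding e_def by (rule ip_scale[OF kH f])
    also have "ip (?k (w n)) f = cnj (f (w n))" using ip_cnj[OF f kH] reproducing[OF f w(2)] by simp
    finally show ?thesis by (simp add: \<gamma>_def)
  qed
  have e_norm: "ip_norm (e n) \<le> 1" for n
  proof -
    have "ip (e n) (e n) = \<gamma> n * \<gamma> n * ?k (w n) (w n)"
      by (simp add: ip_e[OF eH]) (simp add: e_def)
    also have "\<dots> = 1" unfolding \<gamma>_sq kk using \<kappa>[of n] by simp
    finally show ?thesis by (simp add: ip_norm_def)
  qed
  have Tlin: "linear_operator ?T" using T by (simp add: compact_operator_def)
  have TH: "?T f \<in> H" if "f \<in> H" for f using Tlin that by (auto simp: linear_operator_def)
  have Te: "?T (e n) = (\<lambda>z. \<gamma> n * ?T (?k (w n)) z)" for n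
    unfolding e_def using Tlin kH by (simp add: linear_operator_def)
  have ip_Te: "ip (?T (e m)) (e n) = \<gamma> n * (\<gamma> m * ?T (?k (w m)) (w n))" for m n
    using ip_e[OF TH[OF eH[of m]], of n] by (simp only: Te)
  have \<gamma>_norm: "cmod (\<gamma> n) = sqrt (1 - (r n)\<^sup>2) / sqrt (1 - (cmod (b (w n)))\<^sup>2)" for n
  proof -
    have "cmod (\<gamma> n) = 1 / sqrt (\<kappa> n)" using \<kappa>[of n] by (simp only: \<gamma>_def norm_of_real) simp
    then show ?thesis by (simp add: \<kappa>_def real_sqrt_divide)
  qed
  have "cnj (g p) = 0"
  proof (rule compact_operator_orthogonal_limit[OF T eH e_norm])
    fix m
    obtain c where c: "hardy_coeffs (?T (?k (w m))) c"
      using toeplitz_dBR_kernel_hardy[OF b w(1) \<phi> g g_eq] by blast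
    define F where "F = (\<lambda>r. cmod (\<gamma> m) * ((cmod (?T (?k (w m)) (of_real r * p)) * sqrt (1 - r\<^sup>2)) / sqrt (1 - (cmod (b (of_real r * p)))\<^sup>2)))"
    have "0 < 1 - (cmod \<beta>)\<^sup>2" using \<beta> by (simp add: abs_square_less_1)
    then have "(F \<longlongrightarrow> cmod (\<gamma> m) * (0 / sqrt (1 - (cmod \<beta>)\<^sup>2))) (at_left 1)"
      unfolding F_def by (intro tendsto_intros hardy_growth[OF c z0] lim) auto
    then have "(\<lambda>n. F (r n)) \<longlonglongrightarrow> 0" by (intro filterlim_compose[OF _ r_lim]) simp
    moreover have "F (r n) = cmod (ip (?T (e m)) (e n))" for n
      unfolding ip_Te norm_mult \<gamma>_norm[of n] by (simp add: F_def w_def mult_ac)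
    ultimately show "(\<lambda>n. ip (?T (e m)) (e n)) \<longlonglongrightarrow> 0"
      by (simp add: tendsto_norm_zero_iff)
  next
    have "(\<lambda>n. of_real (1 - (r n)\<^sup>2) * ?T (?k (w n)) (w n) / of_real (1 - (cmod (b (w n)))\<^sup>2)) \<longlonglongrightarrow> cnj (g p)"
      unfolding w_def by (rule filterlim_compose[OF toeplitz_kernel_quotient_limit[OF b \<phi> g gc g_eq z0 lim \<beta>] r_lim])
    moreover have "of_real (1 - (r n)\<^sup>2) * ?T (?k (w n)) (w n) / of_real (1 - (cmod (b (w n)))\<^sup>2) = ip (?T (e n)) (e n)" for n
    proof -
      have "ip (?T (e n)) (e n) = \<gamma> n * \<gamma> n * ?T (?k (w n)) (w n)"
        unfolding ip_Te by simp
      also have "\<gamma> n * \<gamma> n = of_real (1 - (r n)\<^sup>2) / of_real (1 - (cmod (b (w n)))\<^sup>2)"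
        unfolding \<gamma>_sq by (simp add: \<kappa>_def del: of_real_diff)
      finally show ?thesis by simp
    qed
    ultimately show "(\<lambda>n. ip (?T (e n)) (e n)) \<longlonglongrightarrow> cnj (g p)" by simp
  qed
  then show ?thesis by simp
qed

theorem corollary3p4:
  fixes b \<phi> :: "complex \<Rightarrow> complex"
    and H :: "(complex \<Rightarrow> complex) set"
    and ip :: "(complex \<Rightarrow> complex) \<Rightarrow> (complex \<Rightarrow> complex) \<Rightarrow> complex"
  assumes "extreme_point_Hinf_unit_ball b"
    and "\<not> inner_function b"
    and "de_Branges_Rovnyak_space b H ip"
    and "\<phi> \<in> Hinf_continuous"
  shows "function_inner_space.compact_operator H ip (toeplitz_cnj \<phi>) \<longleftrightarrow> \<phi> = (\<lambda>_. 0)"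
proof
  have b: "b \<in> Hinf_unit_ball" using assms(1) by (simp add: extreme_point_Hinf_unit_ball_def)
  have rk: "reproducing_kernel_hilbert_space H ip unit_disc (dBR_kernel b)"
    using assms(3) by (simp add: de_Branges_Rovnyak_space_def)
  then interpret function_inner_space H ip by (simp add: reproducing_kernel_hilbert_space_def)
  {
    assume "\<phi> = (\<lambda>_. 0)"
    then have "toeplitz_cnj \<phi> = (\<lambda>_ _. 0)" using toeplitz_zero by blast
    then show "compact_operator (toeplitz_cnj \<phi>)" using compact_operator_zero by simp
  }
  assume T: "compact_operator (toeplitz_cnj \<phi>)"
  have \<phi>: "\<phi> \<in> Hinf" using assms(4) by (simp add: Hinf_continuous_def)
  obtain g0 where g0: "continuous_on (sphere 0 1) g0" "AE x in circle_measure. boundary_value \<phi> x = g0 x"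
    using assms(4) by (auto simp: Hinf_continuous_def)
  \<comment> \<open>Extension by zero makes the boundary function Borel measurable on the whole plane.\<close>
  define g where "g = (\<lambda>x. if x \<in> sphere 0 1 then g0 x else 0)"
  have g: "g \<in> borel_measurable borel"
    unfolding g_def using g0(1) by (intro borel_measurable_continuous_on_if) auto
  have gc: "continuous_on (sphere 0 1) g"
    using g0(1) by (rule continuous_on_eq) (simp add: g_def)
  have g_eq: "AE x in circle_measure. boundary_value \<phi> x = g x"
    using g0(2) AE_circle_on by eventually_elim (simp add: g_def)
  obtain c where c: "hardy_coeffs b c"
    using b Hinf_imp_hardy_space hardy_space_imp_coeffs by (auto simp: Hinf_unit_ball_def)
  obtain d where d: "hardy_coeffs \<phi> d" using Hinf_imp_hardy_space[OF \<phi>] hardy_space_imp_coeffs by blast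
  have dichotomy: "AE x in circle_measure. cmod (boundary_value b x) = 1 \<or> g x = 0"
    using AE_tendsto_boundary_value[OF c] AE_circle_on
  proof eventually_elim
    case (elim x)
    have "cmod (boundary_value b x) \<le> 1"
      by (rule norm_boundary_value_le[OF elim Hinf_unit_ball_norm_le[OF b]])
    moreover have "g x = 0" if "cmod (boundary_value b x) < 1"
      by (rule compact_toeplitz_boundary_zero[OF rk b \<phi> g gc g_eq T elim(2,1) that])
    ultimately show ?case by linarith
  qed
  have "0 < measure circle_measure {x. cmod x = 1 \<and> g x = 0}"
  proof (rule ccontr)
    have [measurable]: "{x. cmod x = 1 \<and> g x = 0} \<in> sets borel" using g by measurable
    assume "\<not> 0 < measure circle_measure {x. cmod x = 1 \<and> g x = 0}"
    then have "measure circle_measure {x. cmod x = 1 \<and> g x = 0} = 0"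
      using measure_nonneg[of circle_measure "{x. cmod x = 1 \<and> g x = 0}"] by linarith
    then have "emeasure circle_measure {x. cmod x = 1 \<and> g x = 0} = 0"
      using circle.emeasure_eq_measure by simp
    then have "{x. cmod x = 1 \<and> g x = 0} \<in> null_sets circle_measure" by (intro null_setsI) auto
    from AE_not_in[OF this] dichotomy AE_circle_on
    have "AE x in circle_measure. cmod (boundary_value b x) = 1"
      by eventually_elim auto
    then show False using assms(2) b by (simp add: inner_function_def)
  qed
  then show "\<phi> = (\<lambda>_. 0)" by (rule hardy_boundary_uniqueness[OF d g gc g_eq])
qed

end
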